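(* Let $\ell>0$, let $(u,\mu)\in\mathcal{D}_{\mathrm{per}}$ and let $(u_k,\mu_k)$ be a sequence of pairs in $\mathcal{D}_{\mathrm{per}}$. Let $\Delta$ and $\Delta_k$ denote the Floquet discriminants associated with $(u,\mu)$ and $(u_k,\mu_k)$, respectively. If the pairs $(u_k,\mu_k)$ converge to $(u,\mu)$ in $\mathcal{D}_{\mathrm{per}}$ as $k\to\infty$, then the entire functions $\Delta_k$ converge to $\Delta$ locally uniformly on $\mathbb{C}$.
   Context: Borel measures on $\mathbb{R}$ are assumed finite on compact sets. Fix $\ell>0$. $H^1_{\mathrm{loc}}(\mathbb{R})$ is the space of locally absolutely continuous functions with locally square integrable derivative, and $H^1_{\mathrm{c}}(\mathbb{R})$ the subspace of those with compact support. $\mathcal{D}_{\mathrm{per}}$ is the set of all pairs $(u,\mu)$ such that $u$ is an $\ell$-periodic real-valued function in $H^1_{\mathrm{loc}}(\mathbb{R})$ and $\mu$ is an $\ell$-periodic non-negative Borel measure on $\mathbb{R}$ with $\mu(B)\ge\int_B u(x)^2+u'(x)^2\,dx$ for every Borel set $B\subseteq\mathbb{R}$. Topology: $\mathcal{D}_{\mathrm{per}}$ carries the initial topology with respect to the functionals $(u,\mu)\mapsto\int_{\mathbb{R}}u(x)h(x)\,dx+\int_{\mathbb{R}}u'(x)h'(x)\,dx+\int_{\mathbb{R}}g\,d\mu$ for all $h\in H^1_{\mathrm{c}}(\mathbb{R})$ and $g\in C_{\mathrm{c}}(\mathbb{R})$ (continuous functions with compact support). With $(u,\mu)$ one associates the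 distribution $\omega(h)=\int_{\mathbb{R}}u h\,dx+\int_{\mathbb{R}}u'h'\,dx$, $h\in H^1_{\mathrm{c}}(\mathbb{R})$ (i.e. $\omega=u-u''$), and the $\ell$-periodic non-negative Borel measure $\upsilon$ given by $\mu(B)=\int_B u(x)^2+u'(x)^2\,dx+\upsilon(B)$ for all Borel sets $B$. For $z\in\mathbb{C}$, a solution of $$-f''+\tfrac14 f=z\,\omega f+z^2\upsilon f\qquad(\mathrm{E})$$ is a (complex-valued) function $f\in H^1_{\mathrm{loc}}(\mathbb{R})$ with $\int_{\mathbb{R}}f'h'\,dx+\frac14\int_{\mathbb{R}}fh\,dx=z\,\omega(fh)+z^2\int_{\mathbb{R}}fh\,d\upsilon$ for all $h\in H^1_{\mathrm{c}}(\mathbb{R})$. For each solution $f$ there is a unique left-continuous function $f^{[1]}$ (the quasi-derivative) with $f^{[1]}=f'-zu'f$ almost everywhere. For every $a\in\mathbb{R}$ and $d_1,d_2\in\mathbb{C}$ there is a unique solution of (E) with $f(a)=d_1$, $f^{[1]}(a)=d_2$. Fix a base point $a\in\mathbb{R}$; $c(z,\cdot)$ and $s(z,\cdot)$ are the solutions of (E) with $c(z,a)=s^{[1]}(z,a)=1$, $c^{[1]}(z,a)=s(z,a)=0$. The Floquet discriminant of $(u,\mu)$ is the real entire function $\Delta(z)=\frac12\bigl(c(z,a+\ell)+s^{[1]}(z,a+\ell)\bigr)$; it does not depend on the choice of the base point $a$. $\Delta_k$ is defined in the same way from $(u_k,\mu_k)$. *)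

theory Defs
  imports "HOL-Analysis.Analysis"
begin

text \<open>
  All function spaces consist of functions on the real line with values in a Euclidean space, which
  below is either \<^typ>\<open>real\<close> (for \<open>u\<close>) or \<^typ>\<open>complex\<close> (for solutions and test functions). A
  locally absolutely continuous function is differentiable almost everywhere; \<open>vderiv f\<close> is this
  derivative, with an irrelevant value on the exceptional null set. Integrals with respect to
  \<open>dx\<close> are taken over \<^const>\<open>lebesgue\<close>, the completion of Borel-Lebesgue measure, so that this
  value does not influence measurability.
\<close>

abbreviation vderiv :: "(real \<Rightarrow> 'a::euclidean_space) \<Rightarrow> real \<Rightarrow> 'a" where
  "vderiv f x \<equiv> vector_derivative f (at x)"

definition absolutely_continuous_Icc :: "real \<Rightarrow> real \<Rightarrow> (real \<Rightarrow> 'a::euclidean_space) \<Rightarrow> bool" where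
  "absolutely_continuous_Icc a b f \<longleftrightarrow>
     (\<forall>\<epsilon>>0. \<exists>\<delta>>0. \<forall>(n::nat) x y.
        (\<forall>i<n. a \<le> x i \<and> x i \<le> y i \<and> y i \<le> b) \<longrightarrow>
        disjoint_family_on (\<lambda>i. {x i<..<y i}) {..<n} \<longrightarrow>
        (\<Sum>i<n. y i - x i) < \<delta> \<longrightarrow>
        (\<Sum>i<n. norm (f (y i) - f (x i))) < \<epsilon>)"

definition locally_absolutely_continuous :: "(real \<Rightarrow> 'a::euclidean_space) \<Rightarrow> bool" where
  "locally_absolutely_continuous f \<longleftrightarrow> (\<forall>a b. absolutely_continuous_Icc a b f)"

definition H1_loc :: "(real \<Rightarrow> 'a::euclidean_space) set" where
  "H1_loc = {f. locally_absolutely_continuous f \<and>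
                (\<forall>a b. set_integrable lebesgue {a..b} (\<lambda>x. (norm (vderiv f x))\<^sup>2))}"

definition compact_support :: "(real \<Rightarrow> 'a::zero) \<Rightarrow> bool" where
  "compact_support f \<longleftrightarrow> compact (closure {x. f x \<noteq> 0})"

definition H1_c :: "(real \<Rightarrow> complex) set" where
  "H1_c = {h \<in> H1_loc. compact_support h}"

definition C_c :: "(real \<Rightarrow> complex) set" where
  "C_c = {g. continuous_on UNIV g \<and> compact_support g}"

definition Borel_measure :: "real measure \<Rightarrow> bool" where
  "Borel_measure \<mu> \<longleftrightarrow> sets \<mu> = sets borel \<and> (\<forall>K. compact K \<longrightarrow> emeasure \<mu> K < \<infinity>)"

definition D_per :: "real \<Rightarrow> ((real \<Rightarrow> real) \<times> real measure) set" where
  "D_per l = {(u, \<mu>).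
     u \<in> H1_loc \<and> (\<forall>x. u (x + l) = u x) \<and>
     Borel_measure \<mu> \<and> (\<forall>B \<in> sets borel. emeasure \<mu> ((\<lambda>x. x + l) ` B) = emeasure \<mu> B) \<and>
     (\<forall>B \<in> sets borel. emeasure \<mu> B \<ge> (\<integral>\<^sup>+x\<in>B. ennreal ((u x)\<^sup>2 + (vderiv u x)\<^sup>2) \<partial>lebesgue))}"

definition omega :: "(real \<Rightarrow> real) \<Rightarrow> (real \<Rightarrow> complex) \<Rightarrow> complex" where
  "omega u h = (LINT x|lebesgue. of_real (u x) * h x)
             + (LINT x|lebesgue. of_real (vderiv u x) * vderiv h x)"

text \<open>The initial topology on \<open>D_per l\<close>, generated by preimages of open sets.\<close>

definition D_per_topology :: "real \<Rightarrow> ((real \<Rightarrow> real) \<times> real measure) topology" where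
  "D_per_topology l = topology_generated_by
     {{(u, \<mu>) \<in> D_per l. omega u h + (LINT x|\<mu>. g x) \<in> V} | h g V.
        h \<in> H1_c \<and> g \<in> C_c \<and> open V}"

text \<open>
  The measure is determined uniquely because \<open>\<mu>\<close> is finite on compact sets. A pointwise difference
  of extended nonnegative values would be wrong on sets of infinite measure.
\<close>

definition upsilon :: "(real \<Rightarrow> real) \<Rightarrow> real measure \<Rightarrow> real measure" where
  "upsilon u \<mu> = (THE \<upsilon>. Borel_measure \<upsilon> \<and>
     (\<forall>B \<in> sets borel. emeasure \<mu> B =
        (\<integral>\<^sup>+x\<in>B. ennreal ((u x)\<^sup>2 + (vderiv u x)\<^sup>2) \<partial>lebesgue) + emeasure \<upsilon> B))"

definition is_solution ::
  "(real \<Rightarrow> real) \<Rightarrow> real measure \<Rightarrow> complex \<Rightarrow> (real \<Rightarrow> complex) \<Rightarrow> bool" where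
  "is_solution u \<mu> z f \<longleftrightarrow> f \<in> H1_loc \<and>
     (\<forall>h \<in> H1_c.
        (LINT x|lebesgue. vderiv f x * vderiv h x) + 1/4 * (LINT x|lebesgue. f x * h x)
        = z * omega u (\<lambda>x. f x * h x) + z\<^sup>2 * (LINT x|upsilon u \<mu>. f x * h x))"

definition quasi_deriv ::
  "(real \<Rightarrow> real) \<Rightarrow> complex \<Rightarrow> (real \<Rightarrow> complex) \<Rightarrow> real \<Rightarrow> complex" where
  "quasi_deriv u z f = (THE q. (\<forall>x. continuous (at_left x) q) \<and>
     (AE x in lebesgue. q x = vderiv f x - z * of_real (vderiv u x) * f x))"

definition solution_at ::
  "real \<Rightarrow> (real \<Rightarrow> real) \<Rightarrow> real measure \<Rightarrow> complex \<Rightarrow> complex \<Rightarrow> complex \<Rightarrow> real \<Rightarrow> complex" where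
  "solution_at a u \<mu> z d1 d2 =
     (THE f. is_solution u \<mu> z f \<and> f a = d1 \<and> quasi_deriv u z f a = d2)"

definition c_sol :: "real \<Rightarrow> (real \<Rightarrow> real) \<Rightarrow> real measure \<Rightarrow> complex \<Rightarrow> real \<Rightarrow> complex" where
  "c_sol a u \<mu> z = solution_at a u \<mu> z 1 0"

definition s_sol :: "real \<Rightarrow> (real \<Rightarrow> real) \<Rightarrow> real measure \<Rightarrow> complex \<Rightarrow> real \<Rightarrow> complex" where
  "s_sol a u \<mu> z = solution_at a u \<mu> z 0 1"

definition floquet_discriminant ::
  "real \<Rightarrow> real \<Rightarrow> (real \<Rightarrow> real) \<Rightarrow> real measure \<Rightarrow> complex \<Rightarrow> complex" where
  "floquet_discriminant l a u \<mu> z =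
     1/2 * (c_sol a u \<mu> z (a + l) + quasi_deriv u z (s_sol a u \<mu> z) (a + l))"

lemma topspace_D_per_topology: "topspace (D_per_topology l) = D_per l"
proof -
  have "(\<lambda>_. 0) \<in> H1_c"
    by (auto simp: H1_c_def H1_loc_def compact_support_def set_integrable_def
        locally_absolutely_continuous_def absolutely_continuous_Icc_def intro: exI[of _ 1])
  moreover have "(\<lambda>_. 0) \<in> C_c"
    by (simp add: C_c_def compact_support_def)
  ultimately have "D_per l \<in> {{(u, \<mu>) \<in> D_per l. omega u h + (LINT x|\<mu>. g x) \<in> V} | h g V.
        h \<in> H1_c \<and> g \<in> C_c \<and> open V}"
    by (intro CollectI exI[of _ "\<lambda>_. 0"] exI[of _ UNIV]) auto
  then show ?thesis
    unfolding D_per_topology_def topology_generated_by_topspace by blast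
qed

end

theory Submission
  imports Defs
begin

text \<open>
  Writing a solution as \<open>exp (z u) \<phi>\<close> and its quasi-derivative as \<open>exp (- z u) \<psi>\<close> gives the system
  \<open>\<phi>' = exp (- 2 z u) \<psi>\<close>, \<open>d\<psi> = exp (2 z u) \<phi> ((1/4 - z u + z\<^sup>2 u\<^sup>2) dx - z\<^sup>2 d\<mu>)\<close>, from which the
  derivative of \<open>u\<close> has disappeared. Since \<open>u\<close> is periodic, the discriminant is half the trace of the
  monodromy matrix of this system. Convergence in \<open>D_per\<close> implies that \<open>u\<^sub>k\<close> converges locally
  uniformly (weak convergence in \<open>H\<^sup>1\<close> and a Hoelder bound coming from \<open>\<mu>\<^sub>k\<close>) and \<open>\<mu>\<^sub>k\<close> vaguely, which
  is enough to pass to the limit in the system, also along \<open>z\<^sub>k \<rightarrow> z\<close>, provided that the base point is not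
  an atom of \<open>\<mu>\<close>; the trace does not depend on the base point. Convergence along all
  sequences \<open>z\<^sub>k \<rightarrow> z\<close> is locally uniform convergence.
\<close>

section \<open>Variation of absolutely continuous functions\<close>

text \<open>Weak convergence in H^1 gives no control of the squares of the derivatives of u_k, and
  the measures \<open>upsilon\<close> of the approximating pairs need not converge; only the sum of
  both, \<mu>, behaves well. The weak form is therefore rewritten so that the squared derivative and
  \<open>upsilon\<close> recombine into \<mu>. Vague convergence gives convergence of integrals over
  an interval only if neither end point is an atom of the limit, so the second component of the
  system is controlled merely at almost every point. This is enough, because it enters the first
  component under a dx integral, where dominated convergence applies. At the ends of one period
  atoms are excluded by the choice of the base point; periodicity carries the choice from b to b +
  l. Two further demands come from the definitions. Absolute continuity is an epsilon-delta
  condition, so the fundamental theorem of calculus for it is derived through total variation and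
  Radon-Nikodym. And \<open>upsilon\<close>, \<open>quasi_deriv\<close> and
  \<open>solution_at\<close> are definite descriptions, so existence and uniqueness must be proved
  before anything can be computed with them.\<close>

lemma sum_length_disjoint_le:
  fixes x y :: "'i \<Rightarrow> real"
  assumes "finite I" "\<And>i. i \<in> I \<Longrightarrow> a \<le> x i \<and> x i \<le> y i \<and> y i \<le> b"
    and "disjoint_family_on (\<lambda>i. {x i<..<y i}) I" "a \<le> b"
  shows "(\<Sum>i\<in>I. y i - x i) \<le> b - a"
proof -
  have "(\<Sum>i\<in>I. y i - x i) = (\<Sum>i\<in>I. measure lborel {x i<..<y i})"
    using assms(2) by (intro sum.cong) auto
  also have "\<dots> = measure lborel (\<Union>i\<in>I. {x i<..<y i})"
    using assms(1,2,3) by (intro measure_finite_Union[symmetric]) auto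
  also have "\<dots> \<le> measure lborel {a..b}"
  proof (rule measure_mono_fmeasurable)
    show "(\<Union>i\<in>I. {x i<..<y i}) \<subseteq> {a..b}" using assms(2) by fastforce
    show "(\<Union>i\<in>I. {x i<..<y i}) \<in> sets lborel"
      using assms(1) by auto
  qed (use assms(4) in \<open>auto simp: fmeasurable_def\<close>)
  finally show ?thesis using assms(4) by simp
qed

lemma disjoint_family_on_reindex:
  assumes "bij_betw g J I" "disjoint_family_on A I"
  shows "disjoint_family_on (A \<circ> g) J"
  using assms unfolding disjoint_family_on_def bij_betw_def inj_on_def
  by (metis comp_apply image_eqI)

text \<open>The definition numbers the intervals by an initial segment of the naturals. Other index
  types are needed later: pairs for a family of subdivisions, and intervals that index themselves in
  a covering.\<close>

lemma absolutely_continuous_IccE: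
  assumes "absolutely_continuous_Icc a b f" "0 < \<epsilon>"
  obtains \<delta> where "0 < \<delta>"
    "\<And>(I :: 'i set) x y. finite I \<Longrightarrow> (\<And>i. i \<in> I \<Longrightarrow> a \<le> x i \<and> x i \<le> y i \<and> y i \<le> b) \<Longrightarrow>
        disjoint_family_on (\<lambda>i. {x i<..<y i}) I \<Longrightarrow> (\<Sum>i\<in>I. y i - x i) < \<delta> \<Longrightarrow>
        (\<Sum>i\<in>I. norm (f (y i) - f (x i))) < \<epsilon>"
proof -
  obtain \<delta> where \<delta>: "\<delta> > 0" "\<And>(n::nat) x y.
        (\<forall>i<n. a \<le> x i \<and> x i \<le> y i \<and> y i \<le> b) \<Longrightarrow>
        disjoint_family_on (\<lambda>i. {x i<..<y i}) {..<n} \<Longrightarrow>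
        (\<Sum>i<n. y i - x i) < \<delta> \<Longrightarrow>
        (\<Sum>i<n. norm (f (y i) - f (x i))) < \<epsilon>"
    using assms unfolding absolutely_continuous_Icc_def by meson
  show ?thesis
  proof (rule that[OF \<delta>(1)])
    fix I :: "'i set" and x y
    assume I: "finite I" "\<And>i. i \<in> I \<Longrightarrow> a \<le> x i \<and> x i \<le> y i \<and> y i \<le> b"
      "disjoint_family_on (\<lambda>i. {x i<..<y i}) I" "(\<Sum>i\<in>I. y i - x i) < \<delta>"
    obtain g where g: "bij_betw g {..<card I} I"
      using ex_bij_betw_nat_finite[OF I(1)] by (auto simp: atLeast0LessThan)
    have "(\<Sum>i<card I. norm (f ((y \<circ> g) i) - f ((x \<circ> g) i))) < \<epsilon>"
    proof (rule \<delta>(2))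
      show "\<forall>i<card I. a \<le> (x \<circ> g) i \<and> (x \<circ> g) i \<le> (y \<circ> g) i \<and> (y \<circ> g) i \<le> b"
        using I(2) bij_betwE[OF g] by auto
      show "disjoint_family_on (\<lambda>i. {(x \<circ> g) i<..<(y \<circ> g) i}) {..<card I}"
        using disjoint_family_on_reindex[OF g I(3)] by (simp add: o_def)
      show "(\<Sum>i<card I. (y \<circ> g) i - (x \<circ> g) i) < \<delta>"
        using sum.reindex_bij_betw[OF g, of "\<lambda>i. y i - x i"] I(4) by simp
    qed
    then show "(\<Sum>i\<in>I. norm (f (y i) - f (x i))) < \<epsilon>"
      using sum.reindex_bij_betw[OF g, of "\<lambda>i. norm (f (y i) - f (x i))"] by simp
  qed
qed

text \<open>Finite families of nonoverlapping intervals, gaps allowed, instead of partitions: the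
  supremum is the usual total variation, and the families are exactly those of
  \<open>absolutely_continuous_Icc\<close>, so the two notions can be compared without refining
  partitions.\<close>

definition variation_sums :: "(real \<Rightarrow> 'a::real_normed_vector) \<Rightarrow> real \<Rightarrow> real \<Rightarrow> real set" where
  "variation_sums f a b = {\<Sum>i<n. norm (f (y i) - f (x i)) | (n::nat) x y.
     (\<forall>i<n. a \<le> x i \<and> x i \<le> y i \<and> y i \<le> b) \<and> disjoint_family_on (\<lambda>i. {x i<..<y i}) {..<n}}"

definition variation :: "(real \<Rightarrow> 'a::real_normed_vector) \<Rightarrow> real \<Rightarrow> real \<Rightarrow> real" where
  "variation f a b = Sup (variation_sums f a b)"

lemma variation_sumsI:
  assumes "finite I" "\<And>i. i \<in> I \<Longrightarrow> a \<le> x i \<and> x i \<le> y i \<and> y i \<le> b"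
    and "disjoint_family_on (\<lambda>i. {x i<..<y i}) I"
  shows "(\<Sum>i\<in>I. norm (f (y i) - f (x i))) \<in> variation_sums f a b"
proof -
  obtain g where g: "bij_betw g {..<card I} I"
    using ex_bij_betw_nat_finite[OF assms(1)] by (auto simp: atLeast0LessThan)
  have "(\<Sum>i<card I. norm (f ((y \<circ> g) i) - f ((x \<circ> g) i))) = (\<Sum>i\<in>I. norm (f (y i) - f (x i)))"
    using sum.reindex_bij_betw[OF g, of "\<lambda>i. norm (f (y i) - f (x i))"] by simp
  moreover have "\<forall>i<card I. a \<le> (x \<circ> g) i \<and> (x \<circ> g) i \<le> (y \<circ> g) i \<and> (y \<circ> g) i \<le> b"
    using assms(2) bij_betwE[OF g] by auto
  moreover have "disjoint_family_on (\<lambda>i. {(x \<circ> g) i<..<(y \<circ> g) i}) {..<card I}"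
    using disjoint_family_on_reindex[OF g assms(3)] by (simp add: o_def)
  ultimately show ?thesis unfolding variation_sums_def
    by (intro CollectI exI[of _ "card I"] exI[of _ "x \<circ> g"] exI[of _ "y \<circ> g"]) auto
qed

lemma variation_sumsE:
  assumes "v \<in> variation_sums f a b"
  obtains n :: nat and x y where "v = (\<Sum>i<n. norm (f (y i) - f (x i)))"
    "\<And>i. i < n \<Longrightarrow> a \<le> x i \<and> x i \<le> y i \<and> y i \<le> b"
    "disjoint_family_on (\<lambda>i. {x i<..<y i}) {..<n}"
  using assms unfolding variation_sums_def by blast

lemma zero_in_variation_sums: "0 \<in> variation_sums f a b"
  using variation_sumsI[of "{}::nat set" a _ _ b f] by (simp add: disjoint_family_on_def)

text \<open>Each interval is cut at \<open>b\<close> by \<open>min\<close> and \<open>max\<close>.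
  An interval on one side of \<open>b\<close> leaves a degenerate piece on the other, which
  contributes 0, so one index set serves for all cases; the inequality is the triangle inequality at
  \<open>b\<close>.\<close>

lemma variation_sums_split:
  assumes "v \<in> variation_sums f a c" "a \<le> b" "b \<le> c"
  obtains v1 v2 where "v1 \<in> variation_sums f a b" "v2 \<in> variation_sums f b c" "v \<le> v1 + v2"
proof -
  obtain n :: nat and x y where v: "v = (\<Sum>i<n. norm (f (y i) - f (x i)))"
    "\<And>i. i < n \<Longrightarrow> a \<le> x i \<and> x i \<le> y i \<and> y i \<le> c"
    "disjoint_family_on (\<lambda>i. {x i<..<y i}) {..<n}"
    using variation_sumsE[OF assms(1)] by blast
  show ?thesis
  proof (rule that)
    show "(\<Sum>i<n. norm (f (min (y i) b) - f (min (x i) b))) \<in> variation_sums f a b"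
    proof (rule variation_sumsI)
      show "disjoint_family_on (\<lambda>i. {min (x i) b<..<min (y i) b}) {..<n}"
        unfolding disjoint_family_on_def
      proof (intro ballI impI)
        fix i j assume "i \<in> {..<n}" "j \<in> {..<n}" "i \<noteq> j"
        then have "{x i<..<y i} \<inter> {x j<..<y j} = {}"
          using v(3) by (auto simp: disjoint_family_on_def)
        moreover have "{min (x i) b<..<min (y i) b} \<subseteq> {x i<..<y i}" for i by auto
        ultimately show "{min (x i) b<..<min (y i) b} \<inter> {min (x j) b<..<min (y j) b} = {}"
          by blast
      qed
    qed (use v(2) assms in \<open>force simp: min_def\<close>)+
    show "(\<Sum>i<n. norm (f (max (y i) b) - f (max (x i) b))) \<in> variation_sums f b c"
    proof (rule variation_sumsI)
      show "disjoint_family_on (\<lambda>i. {max (x i) b<..<max (y i) b}) {..<n}"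
        unfolding disjoint_family_on_def
      proof (intro ballI impI)
        fix i j assume "i \<in> {..<n}" "j \<in> {..<n}" "i \<noteq> j"
        then have "{x i<..<y i} \<inter> {x j<..<y j} = {}"
          using v(3) by (auto simp: disjoint_family_on_def)
        moreover have "{max (x i) b<..<max (y i) b} \<subseteq> {x i<..<y i}" for i by auto
        ultimately show "{max (x i) b<..<max (y i) b} \<inter> {max (x j) b<..<max (y j) b} = {}"
          by blast
      qed
    qed (use v(2) assms in \<open>force simp: max_def\<close>)+
    have "norm (f (y i) - f (x i)) \<le>
        norm (f (min (y i) b) - f (min (x i) b)) + norm (f (max (y i) b) - f (max (x i) b))"
      if "i < n" for i
    proof -
      have *: "norm (f (y i) - f (x i)) \<le> norm (f b - f (x i)) + norm (f (y i) - f b)"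
        using norm_triangle_ineq[of "f b - f (x i)" "f (y i) - f b"] by simp
      show ?thesis using v(2)[OF that] * by (auto simp: min_def max_def)
    qed
    then show "v \<le> (\<Sum>i<n. norm (f (min (y i) b) - f (min (x i) b))) +
        (\<Sum>i<n. norm (f (max (y i) b) - f (max (x i) b)))"
      unfolding v(1) sum.distrib[symmetric] by (intro sum_mono) auto
  qed
qed

lemma variation_sums_join:
  assumes "v1 \<in> variation_sums f a b" "v2 \<in> variation_sums f b c" "a \<le> b" "b \<le> c"
  shows "v1 + v2 \<in> variation_sums f a c"
proof -
  obtain n :: nat and x y where v: "v1 = (\<Sum>i<n. norm (f (y i) - f (x i)))"
    "\<And>i. i < n \<Longrightarrow> a \<le> x i \<and> x i \<le> y i \<and> y i \<le> b"
    "disjoint_family_on (\<lambda>i. {x i<..<y i}) {..<n}"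
    using variation_sumsE[OF assms(1)] by blast
  obtain n' :: nat and x' y' where v': "v2 = (\<Sum>i<n'. norm (f (y' i) - f (x' i)))"
    "\<And>i. i < n' \<Longrightarrow> b \<le> x' i \<and> x' i \<le> y' i \<and> y' i \<le> c"
    "disjoint_family_on (\<lambda>i. {x' i<..<y' i}) {..<n'}"
    using variation_sumsE[OF assms(2)] by blast
  \<comment> \<open>The disjoint sum of the two index sets carries the combined family, so that
    nothing has to be renumbered.\<close>
  define X where "X = case_sum x x'"
  define Y where "Y = case_sum y y'"
  have "(\<Sum>i\<in>{..<n} <+> {..<n'}. norm (f (Y i) - f (X i))) \<in> variation_sums f a c"
  proof (rule variation_sumsI)
    show "disjoint_family_on (\<lambda>i. {X i<..<Y i}) ({..<n} <+> {..<n'})"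
      unfolding disjoint_family_on_def
    proof (intro ballI impI)
      fix i j assume ij: "i \<in> {..<n} <+> {..<n'}" "j \<in> {..<n} <+> {..<n'}" "i \<noteq> j"
      have mixed: "{x k<..<y k} \<inter> {x' m<..<y' m} = {}" if "k < n" "m < n'" for k m
        using v(2)[OF that(1)] v'(2)[OF that(2)] by auto
      show "{X i<..<Y i} \<inter> {X j<..<Y j} = {}"
      proof (cases i; cases j)
        fix k m assume [simp]: "i = Inl k" "j = Inl m"
        have "k < n" "m < n" "k \<noteq> m" using ij by auto
        then have "{x k<..<y k} \<inter> {x m<..<y m} = {}" using v(3) unfolding disjoint_family_on_def by blast
        then show ?thesis unfolding X_def Y_def \<open>i = Inl k\<close> \<open>j = Inl m\<close> by simp
      next
        fix k m assume "i = Inl k" "j = Inr m"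
        then show ?thesis using ij mixed[of k m] by (auto simp: X_def Y_def)
      next
        fix k m assume "i = Inr m" "j = Inl k"
        then show ?thesis using ij mixed[of k m] by (auto simp: X_def Y_def)
      next
        fix k m assume [simp]: "i = Inr k" "j = Inr m"
        have "k < n'" "m < n'" "k \<noteq> m" using ij by auto
        then have "{x' k<..<y' k} \<inter> {x' m<..<y' m} = {}" using v'(3) unfolding disjoint_family_on_def by blast
        then show ?thesis unfolding X_def Y_def \<open>i = Inr k\<close> \<open>j = Inr m\<close> by simp
      qed
    qed
    show "a \<le> X i \<and> X i \<le> Y i \<and> Y i \<le> c" if "i \<in> {..<n} <+> {..<n'}" for i
      using that v(2) v'(2) assms(3,4) unfolding X_def Y_def
      by (cases i) (fastforce dest: order_trans)+
  qed simp
  moreover have "(\<Sum>i\<in>{..<n} <+> {..<n'}. norm (f (Y i) - f (X i))) = v1 + v2"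
    unfolding v v' by (subst sum.Plus) (auto simp: X_def Y_def)
  ultimately show ?thesis by simp
qed

text \<open>Bisection reduces the claim to short intervals: boundedness passes to adjacent intervals
  by \<open>variation_sums_split\<close>, and near a point the total length of any family stays
  below the \<delta> that absolute continuity assigns to \<epsilon> = 1.\<close>

lemma bdd_above_variation_sums:
  assumes "locally_absolutely_continuous f" "a \<le> b"
  shows "bdd_above (variation_sums f a b)"
  using assms(2)
proof (induction rule: Bolzano)
  case (trans a b c)
  then obtain B1 B2 where B: "\<And>v. v \<in> variation_sums f a b \<Longrightarrow> v \<le> B1"
    "\<And>v. v \<in> variation_sums f b c \<Longrightarrow> v \<le> B2"
    unfolding bdd_above_def by blast
  show ?case
  proof (rule bdd_aboveI[of _ "B1 + B2"])
    fix v assume "v \<in> variation_sums f a c"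
    then obtain v1 v2 where "v1 \<in> variation_sums f a b" "v2 \<in> variation_sums f b c" "v \<le> v1 + v2"
      using variation_sums_split trans by metis
    then show "v \<le> B1 + B2" using B by fastforce
  qed
next
  case (local x)
  have "absolutely_continuous_Icc (x - 1) (x + 1) f"
    using assms(1) by (simp add: locally_absolutely_continuous_def)
  from absolutely_continuous_IccE[OF this zero_less_one, where 'i=nat]
  obtain \<delta> where \<delta>: "0 < \<delta>"
    "\<And>(I :: nat set) X y. finite I \<Longrightarrow> (\<And>i. i \<in> I \<Longrightarrow> x - 1 \<le> X i \<and> X i \<le> y i \<and> y i \<le> x + 1) \<Longrightarrow>
        disjoint_family_on (\<lambda>i. {X i<..<y i}) I \<Longrightarrow> (\<Sum>i\<in>I. y i - X i) < \<delta> \<Longrightarrow>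
        (\<Sum>i\<in>I. norm (f (y i) - f (X i))) < 1" by blast
  show ?case
  proof (intro exI[of _ "min \<delta> 1"] conjI allI impI)
    fix a b assume ab: "a \<le> x \<and> x \<le> b \<and> b - a < min \<delta> 1"
    show "bdd_above (variation_sums f a b)"
    proof (rule bdd_aboveI[of _ 1])
      fix v assume "v \<in> variation_sums f a b"
      then obtain n :: nat and X y where v: "v = (\<Sum>i<n. norm (f (y i) - f (X i)))"
        "\<And>i. i < n \<Longrightarrow> a \<le> X i \<and> X i \<le> y i \<and> y i \<le> b"
        "disjoint_family_on (\<lambda>i. {X i<..<y i}) {..<n}"
        using variation_sumsE by blast
      have "(\<Sum>i<n. y i - X i) \<le> b - a"
        by (rule sum_length_disjoint_le) (use v ab in auto)
      then have "v < 1" unfolding v(1)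
        using v(2) ab by (intro \<delta>(2)[OF _ _ v(3)]) fastforce+
      then show "v \<le> 1" by simp
    qed
  qed (use \<delta>(1) in auto)
qed

lemma variation_add:
  assumes "locally_absolutely_continuous f" "a \<le> b" "b \<le> c"
  shows "variation f a c = variation f a b + variation f b c"
proof (rule antisym)
  note bdd = bdd_above_variation_sums[OF assms(1)]
  show "variation f a c \<le> variation f a b + variation f b c"
    unfolding variation_def[of f a c]
  proof (rule cSup_least)
    fix v assume "v \<in> variation_sums f a c"
    then obtain v1 v2 where "v1 \<in> variation_sums f a b" "v2 \<in> variation_sums f b c" "v \<le> v1 + v2"
      using variation_sums_split assms by metis
    moreover have "v1 \<le> variation f a b" "v2 \<le> variation f b c" unfolding variation_def
      using calculation bdd assms by (auto intro!: cSup_upper)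
    ultimately show "v \<le> variation f a b + variation f b c" by simp
  qed (use zero_in_variation_sums[of f a c] in auto)
  \<comment> \<open>The two families vary independently, so the bound for a joined family survives
    taking the suprema one variable at a time.\<close>
  have "v1 + v2 \<le> variation f a c" if "v1 \<in> variation_sums f a b" "v2 \<in> variation_sums f b c" for v1 v2
    unfolding variation_def using variation_sums_join[OF that] assms(2,3) bdd[of a c]
    by (intro cSup_upper) auto
  then have "v1 \<le> variation f a c - v2" if "v1 \<in> variation_sums f a b" "v2 \<in> variation_sums f b c" for v1 v2
    using that by fastforce
  then have "variation f a b \<le> variation f a c - v2" if "v2 \<in> variation_sums f b c" for v2
    unfolding variation_def[of f a b]
    using that zero_in_variation_sums[of f a b] by (intro cSup_least) auto
  then have "v2 \<le> variation f a c - variation f a b" if "v2 \<in> variation_sums f b c" for v2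
    using that by fastforce
  then have "variation f b c \<le> variation f a c - variation f a b"
    unfolding variation_def[of f b c]
    using zero_in_variation_sums[of f b c] by (intro cSup_least) auto
  then show "variation f a b + variation f b c \<le> variation f a c" by simp
qed

lemma norm_le_variation:
  assumes "locally_absolutely_continuous f" "a \<le> b"
  shows "norm (f b - f a) \<le> variation f a b"
proof -
  have "(\<Sum>i\<in>{0::nat}. norm (f b - f a)) \<in> variation_sums f a b"
    using assms(2) by (intro variation_sumsI) (auto simp: disjoint_family_on_def)
  then show ?thesis unfolding variation_def
    using bdd_above_variation_sums[OF assms] by (intro cSup_upper) auto
qed

text \<open>The sign on the negative axis makes every increment the variation over the interval in
  question, so the function is nondecreasing on the whole line.\<close>

definition variation_from_0 :: "(real \<Rightarrow> 'a::real_normed_vector) \<Rightarrow> real \<Rightarrow> real" where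
  "variation_from_0 f x = (if 0 \<le> x then variation f 0 x else - variation f x 0)"

lemma variation_from_0_diff:
  assumes "locally_absolutely_continuous f" "x \<le> y"
  shows "variation_from_0 f y - variation_from_0 f x = variation f x y"
  using variation_add[OF assms(1), of 0 x y] variation_add[OF assms(1), of x 0 y]
    variation_add[OF assms(1), of x y 0] assms(2)
  unfolding variation_from_0_def by (auto simp: not_le)

text \<open>Near-optimal families for the variations over the given intervals are pooled into one
  family. It is again disjoint and its total length has not grown, so the \<delta> of
  \<open>f\<close> for \<epsilon> / 2 serves; the other half of \<epsilon> preserves a strict
  inequality after the passage to suprema.\<close>

lemma locally_absolutely_continuous_variation_from_0:
  assumes "locally_absolutely_continuous f"
  shows "locally_absolutely_continuous (variation_from_0 f)"
  unfolding locally_absolutely_continuous_def absolutely_continuous_Icc_def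
proof (intro allI impI)
  fix a b \<epsilon> :: real assume "0 < \<epsilon>"
  then have "0 < \<epsilon> / 2" by simp
  have "absolutely_continuous_Icc a b f"
    using assms by (simp add: locally_absolutely_continuous_def)
  from absolutely_continuous_IccE[OF this \<open>0 < \<epsilon> / 2\<close>, where 'i="nat \<times> nat"]
  obtain \<delta> where \<delta>: "0 < \<delta>"
    "\<And>(I :: (nat \<times> nat) set) x y. finite I \<Longrightarrow> (\<And>i. i \<in> I \<Longrightarrow> a \<le> x i \<and> x i \<le> y i \<and> y i \<le> b) \<Longrightarrow>
        disjoint_family_on (\<lambda>i. {x i<..<y i}) I \<Longrightarrow> (\<Sum>i\<in>I. y i - x i) < \<delta> \<Longrightarrow>
        (\<Sum>i\<in>I. norm (f (y i) - f (x i))) < \<epsilon> / 2"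
    by blast
  show "\<exists>\<delta>>0. \<forall>(n::nat) x y. (\<forall>i<n. a \<le> x i \<and> x i \<le> y i \<and> y i \<le> b) \<longrightarrow>
      disjoint_family_on (\<lambda>i. {x i<..<y i}) {..<n} \<longrightarrow> (\<Sum>i<n. y i - x i) < \<delta> \<longrightarrow>
      (\<Sum>i<n. norm (variation_from_0 f (y i) - variation_from_0 f (x i))) < \<epsilon>"
  proof (intro exI[of _ \<delta>] conjI allI impI)
    fix n :: nat and x y
    assume xy: "\<forall>i<n. a \<le> x i \<and> x i \<le> y i \<and> y i \<le> b"
      and disj: "disjoint_family_on (\<lambda>i. {x i<..<y i}) {..<n}"
      and len: "(\<Sum>i<n. y i - x i) < \<delta>"
    \<comment> \<open>Here n is fixed and \<eta> is free, so the total error of n near-optimal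
      choices can be made as small as desired.\<close>
    have le: "(\<Sum>i<n. variation f (x i) (y i)) \<le> \<epsilon> / 2 + real n * \<eta>" if "\<eta> > 0" for \<eta>
    proof -
      define P where "P i m X Y \<longleftrightarrow> variation f (x i) (y i) - \<eta> < (\<Sum>j<(m::nat). norm (f (Y j) - f (X j)))
          \<and> (\<forall>j<m. x i \<le> X j \<and> X j \<le> Y j \<and> Y j \<le> y i)
          \<and> disjoint_family_on (\<lambda>j. {X j<..<Y j}) {..<m}" for i m X Y
      have "\<exists>m X Y. P i m X Y" for i
      proof -
        have "\<exists>v\<in>variation_sums f (x i) (y i). variation f (x i) (y i) - \<eta> < v"
          using that zero_in_variation_sums unfolding variation_def by (intro less_cSupD) auto
        then obtain v where v: "v \<in> variation_sums f (x i) (y i)" "variation f (x i) (y i) - \<eta> < v"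
          by blast
        obtain m :: nat and X Y where "v = (\<Sum>j<m. norm (f (Y j) - f (X j)))"
          "\<forall>j<m. x i \<le> X j \<and> X j \<le> Y j \<and> Y j \<le> y i"
          "disjoint_family_on (\<lambda>j. {X j<..<Y j}) {..<m}"
          using v(1) unfolding variation_sums_def by blast
        then show ?thesis using v(2) unfolding P_def
          by (intro exI[of _ m] exI[of _ X] exI[of _ Y] conjI) simp_all
      qed
      then obtain m X Y where "\<And>i. P i (m i) (X i) (Y i)" by metis
      then have m: "\<And>i. variation f (x i) (y i) - \<eta> < (\<Sum>j<m i. norm (f (Y i j) - f (X i j)))"
          "\<And>i j. j < m i \<Longrightarrow> x i \<le> X i j \<and> X i j \<le> Y i j \<and> Y i j \<le> y i"
          "\<And>i. disjoint_family_on (\<lambda>j. {X i j<..<Y i j}) {..<m i}"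
        unfolding P_def by auto
      let ?I = "Sigma {..<n} (\<lambda>i. {..<m i})"
      have "(\<Sum>p\<in>?I. norm (f (case_prod Y p) - f (case_prod X p))) < \<epsilon> / 2"
      proof (rule \<delta>(2))
        show "disjoint_family_on (\<lambda>p. {case_prod X p<..<case_prod Y p}) ?I"
          unfolding disjoint_family_on_def
        proof (intro ballI impI)
          fix p q assume pq: "p \<in> ?I" "q \<in> ?I" "p \<noteq> q"
          obtain i j i' j' where ij: "p = (i, j)" "q = (i', j')" by fastforce
          show "{case_prod X p<..<case_prod Y p} \<inter> {case_prod X q<..<case_prod Y q} = {}"
          proof (cases "i = i'")
            case True
            then show ?thesis using pq ij m(3)[of i] by (auto simp: disjoint_family_on_def)
          next
            case False
            then have "{x i<..<y i} \<inter> {x i'<..<y i'} = {}"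
              using pq ij disj by (auto simp: disjoint_family_on_def)
            moreover have "{X i j<..<Y i j} \<subseteq> {x i<..<y i}" "{X i' j'<..<Y i' j'} \<subseteq> {x i'<..<y i'}"
              using m(2)[of j i] m(2)[of j' i'] pq ij by auto
            ultimately show ?thesis unfolding ij case_prod_conv by blast
          qed
        qed
        have "(\<Sum>p\<in>?I. case_prod Y p - case_prod X p) = (\<Sum>i<n. \<Sum>j<m i. Y i j - X i j)"
          by (subst sum.Sigma) (auto simp: case_prod_unfold)
        also have "\<dots> \<le> (\<Sum>i<n. y i - x i)"
          using m(2,3) xy by (intro sum_mono sum_length_disjoint_le) auto
        finally show "(\<Sum>p\<in>?I. case_prod Y p - case_prod X p) < \<delta>" using len by simp
        show "a \<le> case_prod X p \<and> case_prod X p \<le> case_prod Y p \<and> case_prod Y p \<le> b" if "p \<in> ?I" for p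
          using that m(2) xy by (auto, force+)
      qed auto
      moreover have "(\<Sum>p\<in>?I. norm (f (case_prod Y p) - f (case_prod X p))) =
          (\<Sum>i<n. \<Sum>j<m i. norm (f (Y i j) - f (X i j)))"
        by (subst sum.Sigma) (auto simp: case_prod_unfold)
      moreover have "(\<Sum>i<n. variation f (x i) (y i)) \<le> (\<Sum>i<n. (\<Sum>j<m i. norm (f (Y i j) - f (X i j))) + \<eta>)"
        using m(1) by (intro sum_mono less_imp_le) (simp add: diff_less_eq)
      ultimately show ?thesis by (simp add: sum.distrib)
    qed
    have "(\<Sum>i<n. variation f (x i) (y i)) \<le> \<epsilon> / 2 + e" if "e > 0" for e
    proof -
      have "real n * (e / (real n + 1)) \<le> e" using that by (simp add: field_simps)
      then show ?thesis using le[of "e / (real n + 1)"] that by fastforce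
    qed
    then have "(\<Sum>i<n. variation f (x i) (y i)) \<le> \<epsilon> / 2" by (rule field_le_epsilon)
    moreover have "norm (variation_from_0 f (y i) - variation_from_0 f (x i)) = variation f (x i) (y i)"
      if "i < n" for i
      using variation_from_0_diff[OF assms, of "x i" "y i"] norm_le_variation[OF assms, of "x i" "y i"] xy that
      by (smt (verit) norm_ge_zero real_norm_def)
    ultimately show "(\<Sum>i<n. norm (variation_from_0 f (y i) - variation_from_0 f (x i))) < \<epsilon>"
      using \<open>0 < \<epsilon>\<close> by simp
  qed (use \<delta>(1) in auto)
qed

lemma isCont_locally_absolutely_continuous:
  assumes "locally_absolutely_continuous f"
  shows "isCont f x"
  unfolding continuous_at_eps_delta
proof (intro allI impI)
  fix e :: real assume "0 < e"
  have "absolutely_continuous_Icc (x - 1) (x + 1) f"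
    using assms by (simp add: locally_absolutely_continuous_def)
  from absolutely_continuous_IccE[OF this \<open>0 < e\<close>, where 'i=nat]
  obtain \<delta> where \<delta>: "0 < \<delta>"
    "\<And>(I :: nat set) X y. finite I \<Longrightarrow> (\<And>i. i \<in> I \<Longrightarrow> x - 1 \<le> X i \<and> X i \<le> y i \<and> y i \<le> x + 1) \<Longrightarrow>
        disjoint_family_on (\<lambda>i. {X i<..<y i}) I \<Longrightarrow> (\<Sum>i\<in>I. y i - X i) < \<delta> \<Longrightarrow>
        (\<Sum>i\<in>I. norm (f (y i) - f (X i))) < e" by blast
  show "\<exists>d>0. \<forall>x'. dist x' x < d \<longrightarrow> dist (f x') (f x) < e"
  proof (intro exI[of _ "min \<delta> 1"] conjI allI impI)
    fix x' assume "dist x' x < min \<delta> 1"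
    then have "(\<Sum>i\<in>{0::nat}. norm (f (max x x') - f (min x x'))) < e"
      by (intro \<delta>(2)) (auto simp: dist_real_def disjoint_family_on_def)
    then show "dist (f x') (f x) < e"
      by (auto simp: dist_norm max_def min_def norm_minus_commute split: if_splits)
  qed (use \<delta>(1) in auto)
qed

lemma continuous_on_locally_absolutely_continuous:
  "locally_absolutely_continuous f \<Longrightarrow> continuous_on S f"
  by (simp add: continuous_at_imp_continuous_on isCont_locally_absolutely_continuous)

section \<open>Absolutely continuous functions are indefinite integrals\<close>

text \<open>A null set lies in an open set of length below \<delta>. Nonoverlapping closed intervals
  inside this open set still cover the null set, and any finitely many of them have a total
  increment of \<open>F\<close> below \<epsilon>; continuity of the measure from below then reaches
  all of them.\<close>

lemma emeasure_interval_measure_cover_le: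
  assumes mono: "\<And>x y. x \<le> y \<Longrightarrow> F x \<le> F y" and lac: "locally_absolutely_continuous F"
    and S: "S \<subseteq> {-m..m}" "S \<in> null_sets lborel" and "0 < m" "0 < \<epsilon>"
  shows "emeasure (interval_measure F) S \<le> ennreal \<epsilon>"
proof -
  have cont: "continuous_on UNIV F" "\<And>x. continuous (at_right x) F"
    using isCont_locally_absolutely_continuous[OF lac]
    by (auto intro: continuous_at_imp_continuous_on continuous_at_imp_continuous_at_within)
  have "absolutely_continuous_Icc (-m) m F"
    using lac by (simp add: locally_absolutely_continuous_def)
  from absolutely_continuous_IccE[OF this \<open>0 < \<epsilon>\<close>, where 'i="real set"]
  obtain \<delta> where \<delta>: "0 < \<delta>"
    "\<And>(I :: real set set) x y. finite I \<Longrightarrow> (\<And>i. i \<in> I \<Longrightarrow> - m \<le> x i \<and> x i \<le> y i \<and> y i \<le> m) \<Longrightarrow>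
        disjoint_family_on (\<lambda>i. {x i<..<y i}) I \<Longrightarrow> (\<Sum>i\<in>I. y i - x i) < \<delta> \<Longrightarrow>
        (\<Sum>i\<in>I. norm (F (y i) - F (x i))) < \<epsilon>" by blast
  have Sb: "S \<in> sets borel" using S(2) by auto
  obtain U where U: "open U" "S \<subseteq> U" "emeasure lborel (U - S) < ennreal \<delta>"
    using outer_regular_lborel[OF Sb \<delta>(1)] by blast
  have "emeasure lborel U \<le> emeasure lborel (S \<union> (U - S))"
    using U Sb by (intro emeasure_mono) auto
  also have "\<dots> \<le> emeasure lborel S + emeasure lborel (U - S)"
    using U Sb by (intro emeasure_subadditive) auto
  also have "\<dots> < ennreal \<delta>" using U(3) S(2) by (simp add: null_sets_def)
  finally have U\<delta>: "emeasure lborel U < ennreal \<delta>" .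
  \<comment> \<open>The covering lemma keeps every interval inside the gauge of one of its points in
    \<open>S\<close>, so this gauge forces all intervals into \<open>U\<close>.\<close>
  define g where "g x = (if x \<in> U then U else UNIV)" for x
  have "gauge g" using U(1) by (auto simp: gauge_def g_def)
  obtain \<D> where \<D>: "countable \<D>" "\<Union>\<D> \<subseteq> cbox (-m) m"
    "\<And>K. K \<in> \<D> \<Longrightarrow> interior K \<noteq> {} \<and> (\<exists>c d. K = cbox c d)"
    "pairwise (\<lambda>A B. interior A \<inter> interior B = {}) \<D>"
    "\<And>K. K \<in> \<D> \<Longrightarrow> \<exists>x \<in> S \<inter> K. K \<subseteq> g x" "S \<subseteq> \<Union>\<D>"
  proof (rule covering_lemma[OF _ _ \<open>gauge g\<close>, of S "-m" m])
    show "S \<subseteq> cbox (-m) m" "box (-m) m \<noteq> {}" using S(1) \<open>0 < m\<close> by auto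
  qed (erule that)
  have K: "K = {Inf K..Sup K}" "Inf K < Sup K" "-m \<le> Inf K" "Sup K \<le> m" "K \<subseteq> U" "K \<in> sets borel"
    if "K \<in> \<D>" for K
  proof -
    obtain c d where "K = {c..d}" using \<D>(3)[OF \<open>K \<in> \<D>\<close>] by auto
    moreover have "c < d" using \<D>(3)[OF \<open>K \<in> \<D>\<close>] \<open>K = {c..d}\<close> by auto
    ultimately have cd: "c < d" "K = {c..d}" "Inf K = c" "Sup K = d" by auto
    show "K = {Inf K..Sup K}" "Inf K < Sup K" "K \<in> sets borel" using cd by auto
    have "K \<subseteq> {-m..m}" using \<D>(2) that by auto
    then show "-m \<le> Inf K" "Sup K \<le> m" using cd by auto
    show "K \<subseteq> U" using \<D>(5)[OF that] U(2) by (auto simp: g_def split: if_splits)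
  qed
  have fin: "emeasure (interval_measure F) (\<Union>D) \<le> ennreal \<epsilon>" if D: "D \<subseteq> \<D>" "finite D" for D
  proof -
    have disj: "disjoint_family_on (\<lambda>K. {Inf K<..<Sup K}) D"
      unfolding disjoint_family_on_def
    proof (intro ballI impI)
      fix A B assume "A \<in> D" "B \<in> D" "A \<noteq> B"
      then have "interior A \<inter> interior B = {}" using \<D>(4) D(1) by (auto simp: pairwise_def)
      moreover have "interior A = {Inf A<..<Sup A}" "interior B = {Inf B<..<Sup B}"
        using arg_cong[OF K(1), of A interior] arg_cong[OF K(1), of B interior] \<open>A \<in> D\<close> \<open>B \<in> D\<close> D(1)
        by (simp_all add: interior_atLeastAtMost_real subset_iff)
      ultimately show "{Inf A<..<Sup A} \<inter> {Inf B<..<Sup B} = {}" by simp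
    qed
    have "ennreal (\<Sum>K\<in>D. Sup K - Inf K) = (\<Sum>K\<in>D. ennreal (Sup K - Inf K))"
      using K(2) D(1) by (intro sum_ennreal[symmetric]) (auto intro: less_imp_le)
    also have "\<dots> = (\<Sum>K\<in>D. emeasure lborel {Inf K<..<Sup K})"
      using K(2) D(1) by (intro sum.cong refl) (subst emeasure_lborel_Ioo, auto intro!: less_imp_le)
    also have "\<dots> = emeasure lborel (\<Union>K\<in>D. {Inf K<..<Sup K})"
      using D(2) disj by (intro sum_emeasure) auto
    also have "\<dots> \<le> emeasure lborel U"
    proof (rule emeasure_mono)
      have "{Inf K<..<Sup K} \<subseteq> U" if "K \<in> D" for K
      proof -
        have "{Inf K..Sup K} \<subseteq> U" using K(1,5)[of K] that D(1) by auto
        then show ?thesis by auto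
      qed
      then show "(\<Union>K\<in>D. {Inf K<..<Sup K}) \<subseteq> U" by blast
    qed (use U(1) in auto)
    finally have "ennreal (\<Sum>K\<in>D. Sup K - Inf K) < ennreal \<delta>"
      using U\<delta> by (rule le_less_trans)
    then have len: "(\<Sum>K\<in>D. Sup K - Inf K) < \<delta>"
      by (rule contrapos_pp) (simp only: not_less ennreal_leI)
    have "emeasure (interval_measure F) (\<Union>D) \<le> (\<Sum>K\<in>D. emeasure (interval_measure F) K)"
      using emeasure_subadditive_finite[of D "\<lambda>K. K" "interval_measure F"] D K(6) by auto
    also have "\<dots> = (\<Sum>K\<in>D. ennreal (norm (F (Sup K) - F (Inf K))))"
    proof (rule sum.cong)
      fix A assume "A \<in> D"
      then have "A \<in> \<D>" using D(1) by blast
      note A = K(1,2)[OF this]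
      have "emeasure (interval_measure F) A = emeasure (interval_measure F) {Inf A..Sup A}"
        by (rule arg_cong[OF A(1)])
      also have "emeasure (interval_measure F) {Inf A..Sup A} = F (Sup A) - F (Inf A)"
        by (rule emeasure_interval_measure_Icc) (use A(2) mono cont in auto)
      finally show "emeasure (interval_measure F) A = ennreal (norm (F (Sup A) - F (Inf A)))"
        using A(2) mono[of "Inf A" "Sup A"] by simp
    qed simp
    also have "\<dots> = ennreal (\<Sum>K\<in>D. norm (F (Sup K) - F (Inf K)))" by (intro sum_ennreal) auto
    also have "\<dots> \<le> ennreal \<epsilon>"
      by (rule ennreal_leI, rule less_imp_le, rule \<delta>(2)[OF D(2) _ disj len])
         (use K(2)[THEN less_imp_le] K(3,4) D(1) in auto)
    finally show ?thesis .
  qed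
  show ?thesis
  proof (cases "\<D> = {}")
    case True
    then have "S = {}" using \<D>(6) by auto
    then show ?thesis by simp
  next
    case False
    \<comment> \<open>\<open>from_nat_into\<close> enumerates finite families too, with repetitions,
      which do no harm in a union.\<close>
    define E where "E n = \<Union>(from_nat_into \<D> ` {..<n})" for n
    have "from_nat_into \<D> i \<in> \<D>" for i using False by (rule from_nat_into)
    then have E: "emeasure (interval_measure F) (E n) \<le> ennreal \<epsilon>" "E n \<in> sets borel" for n
      unfolding E_def using K(6) by (auto intro!: fin)
    have "\<Union>\<D> = (\<Union>n. E n)"
    proof -
      have "(\<Union>n. E n) = \<Union>(range (from_nat_into \<D>))" unfolding E_def by blast
      then show ?thesis using range_from_nat_into[OF False \<D>(1)] by simp
    qed
    then have "emeasure (interval_measure F) S \<le> emeasure (interval_measure F) (\<Union>n. E n)"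
      using \<D>(6) E(2) by (intro emeasure_mono) auto
    also have "\<dots> = (SUP n. emeasure (interval_measure F) (E n))"
    proof (rule SUP_emeasure_incseq[symmetric])
      show "incseq E" unfolding E_def by (auto simp: incseq_def) (meson lessThan_iff less_le_trans)
    qed (use E(2) in auto)
    also have "\<dots> \<le> ennreal \<epsilon>" using E(1) by (rule SUP_least)
    finally show ?thesis .
  qed
qed

lemma absolutely_continuous_interval_measure:
  assumes mono: "\<And>x y. x \<le> y \<Longrightarrow> F x \<le> F y" and lac: "locally_absolutely_continuous F"
  shows "absolutely_continuous lborel (interval_measure F)"
  unfolding absolutely_continuous_def
proof
  fix N :: "real set" assume N: "N \<in> null_sets lborel"
  have "N \<inter> {-real (Suc n)..real (Suc n)} \<in> null_sets (interval_measure F)" for n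
  proof (rule null_setsI)
    have "N \<inter> {-real (Suc n)..real (Suc n)} \<in> null_sets lborel"
      using N by (intro null_set_Int2) auto
    then have "emeasure (interval_measure F) (N \<inter> {-real (Suc n)..real (Suc n)}) \<le> ennreal e" if "e > 0" for e
      using emeasure_interval_measure_cover_le[OF assms _ _ _ that, of _ "real (Suc n)"] by auto
    then show "emeasure (interval_measure F) (N \<inter> {-real (Suc n)..real (Suc n)}) = 0"
      by (metis ennreal_le_epsilon add_0 le_zero_eq)
  qed (use N in auto)
  then have "(\<Union>n. N \<inter> {-real (Suc n)..real (Suc n)}) \<in> null_sets (interval_measure F)"
    by (rule null_sets_UN)
  moreover have "(\<Union>n. N \<inter> {-real (Suc n)..real (Suc n)}) = N"
  proof -
    have "\<exists>n. x \<in> {-real (Suc n)..real (Suc n)}" for x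
    proof -
      obtain n :: nat where "\<bar>x\<bar> \<le> real n" using real_arch_simple by blast
      then show ?thesis by (intro exI[of _ n]) auto
    qed
    then show ?thesis by blast
  qed
  ultimately show "N \<in> null_sets (interval_measure F)" by simp
qed

text \<open>The density is Borel and not just Lebesgue measurable, because it will occur in products
  with Borel measures such as \<mu>.\<close>

definition indefinite_integral :: "(real \<Rightarrow> 'a::euclidean_space) \<Rightarrow> (real \<Rightarrow> 'a) \<Rightarrow> bool" where
  "indefinite_integral f g \<longleftrightarrow> g \<in> borel_measurable borel \<and>
     (\<forall>a b. set_integrable lborel {a..b} g) \<and>
     (\<forall>a b. a \<le> b \<longrightarrow> f b - f a = (LINT x:{a..b}|lborel. g x))"

text \<open>The Stieltjes measure of \<open>F\<close> is absolutely continuous, so Radon-Nikodym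
  gives a density. Sigma-finiteness of the measure makes it finite almost everywhere, which allows
  the passage to real values.\<close>

lemma indefinite_integral_monotone:
  fixes F :: "real \<Rightarrow> real"
  assumes mono: "\<And>x y. x \<le> y \<Longrightarrow> F x \<le> F y" and lac: "locally_absolutely_continuous F"
  shows "\<exists>g. indefinite_integral F g"
proof -
  have cont: "continuous_on UNIV F" "\<And>x. continuous (at_right x) F"
    using isCont_locally_absolutely_continuous[OF lac]
    by (auto intro: continuous_at_imp_continuous_on continuous_at_imp_continuous_at_within)
  obtain h where h: "h \<in> borel_measurable lborel" "density lborel h = interval_measure F"
    using sigma_finite_measure.Radon_Nikodym[OF sigma_finite_lborel, OF absolutely_continuous_interval_measure[OF assms]] by auto
  have "sigma_finite_measure (density lborel h)"
    unfolding h(2) by (rule sigma_finite_interval_measure[OF mono cont(2)])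
  then have fin: "AE x in lborel. h x \<noteq> \<infinity>"
    using sigma_finite_measure.sigma_finite_iff_density_finite[OF sigma_finite_lborel h(1)] by simp
  define g where "g x = enn2real (h x)" for x
  have [measurable]: "g \<in> borel_measurable borel" unfolding g_def using h(1) by measurable
  have *: "integrable lborel (\<lambda>x. indicator {a..b} x *\<^sub>R g x) \<and>
      integral\<^sup>L lborel (\<lambda>x. indicator {a..b} x *\<^sub>R g x) = F b - F a" if "a \<le> b" for a b
  proof (rule nn_integral_eq_integrable[THEN iffD1])
    have "(\<integral>\<^sup>+x. ennreal (indicator {a..b} x *\<^sub>R g x) \<partial>lborel) = (\<integral>\<^sup>+x. h x * indicator {a..b} x \<partial>lborel)"
      using fin by (intro nn_integral_cong_AE) (auto simp: g_def indicator_def less_top)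
    also have "\<dots> = emeasure (density lborel h) {a..b}"
      using h(1) by (simp add: emeasure_density)
    also have "\<dots> = ennreal (F b - F a)"
      unfolding h(2) by (rule emeasure_interval_measure_Icc[OF that mono cont(1)])
    finally show "(\<integral>\<^sup>+x. ennreal (indicator {a..b} x *\<^sub>R g x) \<partial>lborel) = ennreal (F b - F a)" .
    show "(\<lambda>x. indicator {a..b} x *\<^sub>R g x) \<in> borel_measurable lborel" by measurable
  qed (use mono that in \<open>auto simp: g_def\<close>)
  have "set_integrable lborel {a..b} g" for a b
    using *[of a b] by (cases "a \<le> b") (auto simp: set_integrable_def)
  then show ?thesis
    using * unfolding indefinite_integral_def set_lebesgue_integral_def by (intro exI[of _ g]) auto
qed

lemma indefinite_integral_diff:
  assumes "indefinite_integral f g" "indefinite_integral f' g'"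
  shows "indefinite_integral (\<lambda>x. f x - f' x) (\<lambda>x. g x - g' x)"
  using assms unfolding indefinite_integral_def
  by (auto simp: algebra_simps)

text \<open>One criterion behind all closure properties: on compact intervals the increments of
  differences, products, exponentials and Lipschitz functions are bounded by increments of functions
  already known to be absolutely continuous.\<close>

lemma locally_absolutely_continuous_bound2:
  assumes f: "locally_absolutely_continuous f" and g: "locally_absolutely_continuous g"
    and bd: "\<And>a b. \<exists>L. \<forall>x\<in>{a..b}. \<forall>y\<in>{a..b}. norm (h y - h x) \<le> L * (norm (f y - f x) + norm (g y - g x))"
  shows "locally_absolutely_continuous h"
  unfolding locally_absolutely_continuous_def absolutely_continuous_Icc_def
proof (intro allI impI)
  fix a b e :: real assume "0 < e"
  obtain L0 where L0: "\<And>x y. x \<in> {a..b} \<Longrightarrow> y \<in> {a..b} \<Longrightarrow> norm (h y - h x) \<le> L0 * (norm (f y - f x) + norm (g y - g x))"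
    using bd by meson
  \<comment> \<open>The maximum makes the constant positive, so that \<open>e\<close> can be divided
    by it.\<close>
  define L where "L = max L0 1"
  have L: "L > 0" and Lh: "norm (h y - h x) \<le> L * (norm (f y - f x) + norm (g y - g x))"
    if "x \<in> {a..b}" "y \<in> {a..b}" for x y
    using order_trans[OF L0[OF that] mult_right_mono[of L0 L]] by (auto simp: L_def)
  have "L > 0" by (simp add: L_def)
  then have e': "0 < e / (2 * L)" using \<open>0 < e\<close> by simp
  obtain \<delta>1 where \<delta>1: "0 < \<delta>1" "\<And>(n::nat) x y. (\<forall>i<n. a \<le> x i \<and> x i \<le> y i \<and> y i \<le> b) \<Longrightarrow>
        disjoint_family_on (\<lambda>i. {x i<..<y i}) {..<n} \<Longrightarrow> (\<Sum>i<n. y i - x i) < \<delta>1 \<Longrightarrow>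
        (\<Sum>i<n. norm (f (y i) - f (x i))) < e / (2 * L)"
    using f e' unfolding locally_absolutely_continuous_def absolutely_continuous_Icc_def by meson
  obtain \<delta>2 where \<delta>2: "0 < \<delta>2" "\<And>(n::nat) x y. (\<forall>i<n. a \<le> x i \<and> x i \<le> y i \<and> y i \<le> b) \<Longrightarrow>
        disjoint_family_on (\<lambda>i. {x i<..<y i}) {..<n} \<Longrightarrow> (\<Sum>i<n. y i - x i) < \<delta>2 \<Longrightarrow>
        (\<Sum>i<n. norm (g (y i) - g (x i))) < e / (2 * L)"
    using g e' unfolding locally_absolutely_continuous_def absolutely_continuous_Icc_def by meson
  show "\<exists>\<delta>>0. \<forall>(n::nat) x y. (\<forall>i<n. a \<le> x i \<and> x i \<le> y i \<and> y i \<le> b) \<longrightarrow>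
      disjoint_family_on (\<lambda>i. {x i<..<y i}) {..<n} \<longrightarrow> (\<Sum>i<n. y i - x i) < \<delta> \<longrightarrow>
      (\<Sum>i<n. norm (h (y i) - h (x i))) < e"
  proof (intro exI[of _ "min \<delta>1 \<delta>2"] conjI allI impI)
    fix n :: nat and x y
    assume *: "\<forall>i<n. a \<le> x i \<and> x i \<le> y i \<and> y i \<le> b"
        "disjoint_family_on (\<lambda>i. {x i<..<y i}) {..<n}" "(\<Sum>i<n. y i - x i) < min \<delta>1 \<delta>2"
    have "norm (h (y i) - h (x i)) \<le> L * (norm (f (y i) - f (x i)) + norm (g (y i) - g (x i)))" if "i < n" for i
      using *(1) that by (intro Lh) fastforce+
    then have "(\<Sum>i<n. norm (h (y i) - h (x i))) \<le> (\<Sum>i<n. L * (norm (f (y i) - f (x i)) + norm (g (y i) - g (x i))))"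
      by (intro sum_mono) auto
    also have "\<dots> = L * ((\<Sum>i<n. norm (f (y i) - f (x i))) + (\<Sum>i<n. norm (g (y i) - g (x i))))"
      by (simp add: sum_distrib_left[symmetric] sum.distrib)
    also have "\<dots> < L * (e / (2 * L) + e / (2 * L))"
      using \<delta>1(2)[OF *(1,2)] \<delta>2(2)[OF *(1,2)] *(3) \<open>L > 0\<close> by (intro mult_strict_left_mono add_strict_mono) auto
    also have "\<dots> = e" using \<open>L > 0\<close> by (simp add: field_simps)
    finally show "(\<Sum>i<n. norm (h (y i) - h (x i))) < e" .
  qed (use \<delta>1(1) \<delta>2(1) in auto)
qed

lemma locally_absolutely_continuous_bound:
  assumes "locally_absolutely_continuous f"
    and "\<And>a b. \<exists>L. \<forall>x\<in>{a..b}. \<forall>y\<in>{a..b}. norm (h y - h x) \<le> L * norm (f y - f x)"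
  shows "locally_absolutely_continuous h"
proof (rule locally_absolutely_continuous_bound2[OF assms(1,1)])
  fix a b
  obtain L where L: "\<forall>x\<in>{a..b}. \<forall>y\<in>{a..b}. norm (h y - h x) \<le> L * norm (f y - f x)"
    using assms(2) by blast
  then show "\<exists>L. \<forall>x\<in>{a..b}. \<forall>y\<in>{a..b}. norm (h y - h x) \<le> L * (norm (f y - f x) + norm (f y - f x))"
    by (intro exI[of _ "L / 2"]) auto
qed

lemma locally_absolutely_continuous_id: "locally_absolutely_continuous (\<lambda>x::real. x)"
  unfolding locally_absolutely_continuous_def absolutely_continuous_Icc_def
  by (auto intro!: exI[of _ "_::real"])

text \<open>Jordan decomposition: \<open>f\<close> is its variation function minus the difference of
  the variation function and \<open>f\<close>, and both of these are nondecreasing and absolutely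
  continuous.\<close>

lemma indefinite_integral_real_exists:
  fixes f :: "real \<Rightarrow> real"
  assumes "locally_absolutely_continuous f"
  shows "\<exists>g. indefinite_integral f g"
proof -
  let ?V = "variation_from_0 f"
  note V = locally_absolutely_continuous_variation_from_0[OF assms]
  have d: "norm (f y - f x) \<le> ?V y - ?V x" if "x \<le> y" for x y
    using variation_from_0_diff[OF assms that] norm_le_variation[OF assms that] by simp
  have "\<exists>g. indefinite_integral ?V g"
    by (rule indefinite_integral_monotone[OF _ V]) (use d in \<open>smt (verit) norm_ge_zero\<close>)
  moreover have "\<exists>g. indefinite_integral (\<lambda>x. ?V x - f x) g"
  proof (rule indefinite_integral_monotone)
    show "?V x - f x \<le> ?V y - f y" if "x \<le> y" for x y using d[OF that] by (simp add: abs_le_iff)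
    show "locally_absolutely_continuous (\<lambda>x. ?V x - f x)"
      by (rule locally_absolutely_continuous_bound2[OF V assms]) (intro exI[of _ 1], auto)
  qed
  ultimately obtain g1 g2 where "indefinite_integral ?V g1" "indefinite_integral (\<lambda>x. ?V x - f x) g2" by blast
  from indefinite_integral_diff[OF this] show ?thesis by auto
qed

lemma indefinite_integralD:
  assumes "indefinite_integral f g"
  shows "g \<in> borel_measurable borel" "set_integrable lborel {a..b} g"
    "a \<le> b \<Longrightarrow> f b - f a = (LINT x:{a..b}|lborel. g x)"
  using assms by (auto simp: indefinite_integral_def)

lemma indefinite_integral_exists:
  fixes f :: "real \<Rightarrow> 'a::euclidean_space"
  assumes "locally_absolutely_continuous f"
  shows "\<exists>g. indefinite_integral f g"
proof -
  have "\<exists>g. indefinite_integral (\<lambda>x. f x \<bullet> b) g" if "b \<in> Basis" for b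
  proof (rule indefinite_integral_real_exists, rule locally_absolutely_continuous_bound[OF assms])
    show "\<exists>L. \<forall>x\<in>{p..q}. \<forall>y\<in>{p..q}. norm (f y \<bullet> b - f x \<bullet> b) \<le> L * norm (f y - f x)" for p q
      using that by (intro exI[of _ 1]) (auto simp: inner_diff_left[symmetric] Basis_le_norm)
  qed
  then obtain g where g: "\<And>b. b \<in> Basis \<Longrightarrow> indefinite_integral (\<lambda>x. f x \<bullet> b) (g b)" by metis
  note gD = indefinite_integralD[OF g]
  let ?g = "\<lambda>x. \<Sum>b\<in>Basis. g b x *\<^sub>R b"
  have [measurable]: "b \<in> Basis \<Longrightarrow> g b \<in> borel_measurable borel" for b using gD(1) .
  have si: "set_integrable lborel {p..q} (\<lambda>x. g b x *\<^sub>R b)" if "b \<in> Basis" for b p q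
    using gD(2)[OF that] by (intro set_integrable_scaleR_left) auto
  have "indefinite_integral f ?g"
    unfolding indefinite_integral_def
  proof (intro conjI allI impI)
    show "?g \<in> borel_measurable borel" by measurable
    show int: "set_integrable lborel {p..q} ?g" for p q
      using si unfolding set_integrable_def scaleR_sum_right by (intro Bochner_Integration.integrable_sum) auto
    show "f q - f p = (LINT x:{p..q}|lborel. ?g x)" if "p \<le> q" for p q
    proof -
      have "(LINT x:{p..q}|lborel. ?g x) = (\<Sum>b\<in>Basis. LINT x:{p..q}|lborel. g b x *\<^sub>R b)"
        using si unfolding set_lebesgue_integral_def set_integrable_def scaleR_sum_right
        by (intro Bochner_Integration.integral_sum) auto
      also have "\<dots> = (\<Sum>b\<in>Basis. (LINT x:{p..q}|lborel. g b x) *\<^sub>R b)"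
      proof (intro sum.cong refl)
        fix b :: 'a assume "b \<in> Basis"
        then show "(LINT x:{p..q}|lborel. g b x *\<^sub>R b) = (LINT x:{p..q}|lborel. g b x) *\<^sub>R b"
          using gD(2)[of b p q] integral_scaleR_left[of b lborel "\<lambda>x. indicator {p..q} x *\<^sub>R g b x"]
          by (simp add: set_lebesgue_integral_def set_integrable_def)
      qed
      also have "\<dots> = (\<Sum>b\<in>Basis. ((f q - f p) \<bullet> b) *\<^sub>R b)"
        using gD(3)[OF _ that] by (intro sum.cong refl) (simp add: inner_diff_left)
      finally show ?thesis by (simp add: euclidean_representation)
    qed
  qed
  then show ?thesis by blast
qed

text \<open>Lebesgue differentiation in its one-sided form treats the averages to the right of a
  point. Averages to the left are right averages of the reflected function at the reflected point,
  at the price of a second null set.\<close>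

lemma AE_has_vector_derivative_indefinite_integral:
  fixes f :: "real \<Rightarrow> 'a::euclidean_space"
  assumes "indefinite_integral f g"
  shows "AE x in lborel. (f has_vector_derivative g x) (at x)"
proof -
  note gD = indefinite_integralD[OF assms]
  have int: "g integrable_on {p..q}" for p q
    using set_borel_integral_eq_integral(1)[OF gD(2)] .
  have eq: "f q - f p = integral {p..q} g" if "p \<le> q" for p q
    using set_borel_integral_eq_integral(2)[OF gD(2)] gD(3)[OF that] by metis
  obtain N1 where N1: "negligible N1" "\<And>x e. x \<notin> N1 \<Longrightarrow> 0 < e \<Longrightarrow>
      \<exists>d>0. \<forall>h. 0 < h \<and> h < d \<longrightarrow> norm (integral {x..x + h} g /\<^sub>R h - g x) < e"
    using integrable_ccontinuous_explicit[of g] int by (auto simp: mult.commute)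
  have int': "(\<lambda>x. g (- x)) integrable_on {p..q}" for p q
    using int[of "-q" "-p"] Henstock_Kurzweil_Integration.integrable_reflect_real[of g p q]
    by (metis Henstock_Kurzweil_Integration.integrable_reflect_real minus_minus)
  obtain N2 where N2: "negligible N2" "\<And>x e. x \<notin> N2 \<Longrightarrow> 0 < e \<Longrightarrow>
      \<exists>d>0. \<forall>h. 0 < h \<and> h < d \<longrightarrow> norm (integral {x..x + h} (\<lambda>x. g (- x)) /\<^sub>R h - g (- x)) < e"
    using integrable_ccontinuous_explicit[of "\<lambda>x. g (- x)"] int' by (auto simp: mult.commute)
  have "negligible (uminus ` N2)" using N2(1)
    by (intro negligible_differentiable_image_negligible) (auto intro!: derivative_intros)
  then have "negligible (N1 \<union> uminus ` N2)" using N1(1) by (rule negligible_Un[rotated])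
  then have "AE x in lebesgue. x \<notin> N1 \<union> uminus ` N2"
    unfolding negligible_iff_null_sets by (rule AE_not_in)
  then have "AE x in lborel. x \<notin> N1 \<union> uminus ` N2" by (simp add: AE_completion_iff)
  then show ?thesis
  proof eventually_elim
    fix x assume x: "x \<notin> N1 \<union> uminus ` N2"
    then have x1: "x \<notin> N1" "- x \<notin> N2" by force+
    show "(f has_vector_derivative g x) (at x)"
      unfolding has_vector_derivative_def has_derivative_at_alt
    proof (intro conjI allI impI bounded_linear_scaleR_left)
      fix e :: real assume "0 < e"
      obtain d1 where d1: "d1 > 0" "\<And>h. 0 < h \<Longrightarrow> h < d1 \<Longrightarrow> norm (integral {x..x + h} g /\<^sub>R h - g x) < e"
        using N1(2)[OF x1(1) \<open>0 < e\<close>] by blast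
      obtain d2 where d2: "d2 > 0" "\<And>h. 0 < h \<Longrightarrow> h < d2 \<Longrightarrow> norm (integral {-x..-x + h} (\<lambda>x. g (- x)) /\<^sub>R h - g x) < e"
        using N2(2)[OF x1(2) \<open>0 < e\<close>] by auto
      show "\<exists>d>0. \<forall>y. norm (y - x) < d \<longrightarrow> norm (f y - f x - (y - x) *\<^sub>R g x) \<le> e * norm (y - x)"
      proof (intro exI[of _ "min d1 d2"] conjI allI impI)
        fix y assume y: "norm (y - x) < min d1 d2"
        have scale: "norm (v - h *\<^sub>R w) \<le> e * h" if "norm (v /\<^sub>R h - w) < e" "h > 0" for v w :: 'a and h
        proof -
          have "v - h *\<^sub>R w = h *\<^sub>R (v /\<^sub>R h - w)" using that by (simp add: scaleR_diff_right)
          then have "norm (v - h *\<^sub>R w) = h * norm (v /\<^sub>R h - w)" using that by simp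
          then show ?thesis using that by (simp add: mult.commute)
        qed
        consider "y = x" | "y > x" | "y < x" by linarith
        then show "norm (f y - f x - (y - x) *\<^sub>R g x) \<le> e * norm (y - x)"
        proof cases
          case 2
          then have "norm (integral {x..x + (y - x)} g - (y - x) *\<^sub>R g x) \<le> e * (y - x)"
            using y by (intro scale d1) auto
          then show ?thesis using 2 eq[of x y] by simp
        next
          case 3
          then have "norm (integral {-x..-x + (x - y)} (\<lambda>x. g (- x)) - (x - y) *\<^sub>R g x) \<le> e * (x - y)"
            using y by (intro scale d2) auto
          moreover have "integral {-x..-x + (x - y)} (\<lambda>x. g (- x)) = f x - f y"
            using Henstock_Kurzweil_Integration.integral_reflect_real[of x y g] 3 eq[of y x] by simp
          moreover have "norm (f y - f x - (y - x) *\<^sub>R g x) = norm (f x - f y - (x - y) *\<^sub>R g x)"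
            by (subst norm_minus_cancel[symmetric]) (simp add: algebra_simps)
          ultimately show ?thesis using 3 by simp
        qed simp
      qed (use d1 d2 in auto)
    qed
  qed
qed

lemma indefinite_integral_cong_AE:
  assumes "indefinite_integral f g" "g' \<in> borel_measurable borel" "AE x in lborel. g x = g' x"
  shows "indefinite_integral f g'"
proof -
  note gD = indefinite_integralD[OF assms(1)]
  have [measurable]: "g \<in> borel_measurable borel" "g' \<in> borel_measurable borel" using gD(1) assms(2) by auto
  have "set_integrable lborel {a..b} g'" for a b
    using gD(2)[of a b] assms(3)
    by (subst set_integrable_cong_AE[where g=g]) auto
  moreover have "(LINT x:{a..b}|lborel. g x) = (LINT x:{a..b}|lborel. g' x)" for a b
    using assms(3) by (intro set_lebesgue_integral_cong_AE) auto
  ultimately show ?thesis using gD assms(2) by (simp add: indefinite_integral_def)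
qed

lemma locally_absolutely_continuous_indefinite_integral:
  assumes "locally_absolutely_continuous f" "g \<in> borel_measurable borel"
    and "AE x in lborel. (f has_vector_derivative g x) (at x)"
  shows "indefinite_integral f g"
proof -
  obtain g' where g': "indefinite_integral f g'" using indefinite_integral_exists[OF assms(1)] by blast
  show ?thesis
    by (rule indefinite_integral_cong_AE[OF g' assms(2)])
       (use assms(3) AE_has_vector_derivative_indefinite_integral[OF g'] in eventually_elim,
         rule vector_derivative_unique_at)
qed

section \<open>Almost everywhere derivatives and local Sobolev functions\<close>

definition ae_derivative :: "(real \<Rightarrow> 'a::euclidean_space) \<Rightarrow> (real \<Rightarrow> 'a) \<Rightarrow> bool" where
  "ae_derivative f g \<longleftrightarrow> g \<in> borel_measurable borel \<and> (AE x in lborel. (f has_vector_derivative g x) (at x))"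

lemma ae_derivative_AE_vderiv:
  assumes "ae_derivative f g"
  shows "AE x in lebesgue. vderiv f x = g x"
  using assms unfolding ae_derivative_def
  by (intro AE_completion) (auto elim!: eventually_mono intro: vector_derivative_at)

lemma borel_measurable_vderiv:
  assumes "ae_derivative f g"
  shows "vderiv f \<in> borel_measurable lebesgue"
proof (rule borel_measurable_AE)
  show "g \<in> borel_measurable lebesgue"
    using assms by (auto simp: ae_derivative_def intro: measurable_completion)
  show "AE x in lebesgue. g x = vderiv f x"
    using ae_derivative_AE_vderiv[OF assms] by eventually_elim simp
qed

lemma H1_loc_ae_derivative:
  assumes "f \<in> H1_loc"
  obtains g where "ae_derivative f g"
  using assms AE_has_vector_derivative_indefinite_integral indefinite_integral_exists[of f]
  unfolding H1_loc_def ae_derivative_def indefinite_integral_def by blast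

definition locally_square_integrable :: "(real \<Rightarrow> 'a::euclidean_space) \<Rightarrow> bool" where
  "locally_square_integrable g \<longleftrightarrow> g \<in> borel_measurable borel \<and>
     (\<forall>a b. set_integrable lborel {a..b} (\<lambda>x. (norm (g x))\<^sup>2))"

text \<open>The passage from \<open>vderiv\<close> over the completed measure to a Borel version of
  the derivative over \<open>lborel\<close>: the two derivatives differ only on a null set, and the
  completion does not change integrability of Borel functions.\<close>

lemma H1_loc_iff:
  assumes "ae_derivative f g"
  shows "f \<in> H1_loc \<longleftrightarrow> locally_absolutely_continuous f \<and> locally_square_integrable g"
proof -
  have [measurable]: "vderiv f \<in> borel_measurable lebesgue" "g \<in> borel_measurable borel"
    using borel_measurable_vderiv[OF assms] assms by (auto simp: ae_derivative_def)
  have [measurable]: "g \<in> borel_measurable lebesgue" by (simp add: measurable_completion)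
  have "set_integrable lebesgue {a..b} (\<lambda>x. (norm (vderiv f x))\<^sup>2) \<longleftrightarrow>
      set_integrable lborel {a..b} (\<lambda>x. (norm (g x))\<^sup>2)" for a b
  proof -
    have "set_integrable lebesgue {a..b} (\<lambda>x. (norm (vderiv f x))\<^sup>2) \<longleftrightarrow>
        set_integrable lebesgue {a..b} (\<lambda>x. (norm (g x))\<^sup>2)"
      using ae_derivative_AE_vderiv[OF assms]
      by (intro set_integrable_cong_AE) (auto elim: eventually_mono)
    also have "\<dots> \<longleftrightarrow> set_integrable lborel {a..b} (\<lambda>x. (norm (g x))\<^sup>2)"
      unfolding set_integrable_def by (rule integrable_completion) measurable
    finally show ?thesis .
  qed
  then show ?thesis by (auto simp: H1_loc_def locally_square_integrable_def)
qed

lemma continuous_bounded_Icc: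
  fixes f :: "real \<Rightarrow> 'a::real_normed_vector"
  assumes "continuous_on UNIV f"
  obtains B where "B > 0" "\<And>x. x \<in> {a..b} \<Longrightarrow> norm (f x) \<le> B"
proof -
  have "compact (f ` {a..b})"
    using assms by (intro compact_continuous_image) (auto intro: continuous_on_subset)
  then show ?thesis using that compact_imp_bounded bounded_pos by (metis imageI)
qed

lemma locally_absolutely_continuous_mult:
  fixes f g :: "real \<Rightarrow> 'a::{real_normed_algebra, euclidean_space}"
  assumes "locally_absolutely_continuous f" "locally_absolutely_continuous g"
  shows "locally_absolutely_continuous (\<lambda>x. f x * g x)"
proof (rule locally_absolutely_continuous_bound2[OF assms])
  fix a b
  obtain B where B: "B > 0" "\<And>x. x \<in> {a..b} \<Longrightarrow> norm (f x) \<le> B"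
    using continuous_bounded_Icc[OF continuous_on_locally_absolutely_continuous[OF assms(1)]] by metis
  obtain C where C: "C > 0" "\<And>x. x \<in> {a..b} \<Longrightarrow> norm (g x) \<le> C"
    using continuous_bounded_Icc[OF continuous_on_locally_absolutely_continuous[OF assms(2)]] by metis
  have "norm (f y * g y - f x * g x) \<le> (B + C) * (norm (f y - f x) + norm (g y - g x))"
    if "x \<in> {a..b}" "y \<in> {a..b}" for x y
  proof -
    have "f y * g y - f x * g x = f y * (g y - g x) + (f y - f x) * g x" by (simp add: algebra_simps)
    also have "norm \<dots> \<le> norm (f y) * norm (g y - g x) + norm (f y - f x) * norm (g x)"
      by (rule order_trans[OF norm_triangle_ineq add_mono[OF norm_mult_ineq norm_mult_ineq]])
    also have "\<dots> \<le> B * norm (g y - g x) + norm (f y - f x) * C"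
      using B(2)[OF that(2)] C(2)[OF that(1)] by (intro add_mono mult_right_mono mult_left_mono) auto
    also have "\<dots> \<le> (B + C) * (norm (f y - f x) + norm (g y - g x))"
      using B(1) C(1) by (simp add: algebra_simps)
    finally show ?thesis .
  qed
  then show "\<exists>L. \<forall>x\<in>{a..b}. \<forall>y\<in>{a..b}. norm (f y * g y - f x * g x) \<le> L * (norm (f y - f x) + norm (g y - g x))"
    by blast
qed

lemma norm_exp_diff_le:
  fixes v w :: complex
  assumes "norm v \<le> B" "norm w \<le> B"
  shows "norm (exp w - exp v) \<le> exp B * norm (w - v)"
proof (rule field_differentiable_bound[where S="cball 0 B" and f=exp and f'=exp])
  show "cmod (exp x) \<le> exp B" if "x \<in> cball 0 B" for x
    using that norm_exp[of x] by (auto intro: order_trans)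
qed (use assms in \<open>auto intro: derivative_eq_intros DERIV_subset[OF DERIV_exp]\<close>)

lemma locally_absolutely_continuous_exp:
  fixes f :: "real \<Rightarrow> complex"
  assumes "locally_absolutely_continuous f"
  shows "locally_absolutely_continuous (\<lambda>x. exp (f x))"
proof (rule locally_absolutely_continuous_bound[OF assms])
  fix a b
  obtain B where B: "B > 0" "\<And>x. x \<in> {a..b} \<Longrightarrow> norm (f x) \<le> B"
    using continuous_bounded_Icc[OF continuous_on_locally_absolutely_continuous[OF assms(1)]] by metis
  then show "\<exists>L. \<forall>x\<in>{a..b}. \<forall>y\<in>{a..b}. norm (exp (f y) - exp (f x)) \<le> L * norm (f y - f x)"
    by (intro exI[of _ "exp B"]) (auto intro: norm_exp_diff_le)
qed

lemma locally_absolutely_continuous_scale: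
  fixes u :: "real \<Rightarrow> real" and c :: complex
  assumes "locally_absolutely_continuous u"
  shows "locally_absolutely_continuous (\<lambda>x. c * of_real (u x))"
proof (rule locally_absolutely_continuous_bound[OF assms])
  fix a b
  have "norm (c * of_real (u y) - c * of_real (u x)) = norm c * norm (u y - u x)" for x y
    by (simp add: right_diff_distrib[symmetric] of_real_diff[symmetric] norm_mult del: of_real_diff)
  then show "\<exists>L. \<forall>x\<in>{a..b}. \<forall>y\<in>{a..b}. norm (c * of_real (u y) - c * of_real (u x)) \<le> L * norm (u y - u x)"
    by (intro exI[of _ "norm c"]) simp
qed

lemma locally_absolutely_continuous_lipschitz:
  assumes "\<And>a b. \<exists>L. \<forall>x\<in>{a..b}. \<forall>y\<in>{a..b}. norm (h y - h x) \<le> L * \<bar>y - x\<bar>"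
  shows "locally_absolutely_continuous h"
  using locally_absolutely_continuous_bound[OF locally_absolutely_continuous_id, of h] assms by simp

lemma ae_derivative_mult:
  fixes f g :: "real \<Rightarrow> complex"
  assumes "ae_derivative f f'" "ae_derivative g g'" "continuous_on UNIV f" "continuous_on UNIV g"
  shows "ae_derivative (\<lambda>x. f x * g x) (\<lambda>x. f x * g' x + f' x * g x)"
  unfolding ae_derivative_def
proof
  have [measurable]: "f \<in> borel_measurable borel" "g \<in> borel_measurable borel"
    "f' \<in> borel_measurable borel" "g' \<in> borel_measurable borel"
    using assms by (auto simp: ae_derivative_def borel_measurable_continuous_onI)
  show "(\<lambda>x. f x * g' x + f' x * g x) \<in> borel_measurable borel" by measurable
  have "AE x in lborel. (f has_vector_derivative f' x) (at x)" "AE x in lborel. (g has_vector_derivative g' x) (at x)"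
    using assms by (auto simp: ae_derivative_def)
  then show "AE x in lborel. ((\<lambda>x. f x * g x) has_vector_derivative f x * g' x + f' x * g x) (at x)"
    by eventually_elim (rule has_vector_derivative_mult)
qed

lemma ae_derivative_exp_scale:
  fixes u :: "real \<Rightarrow> real" and c :: complex
  assumes "ae_derivative u u'" "continuous_on UNIV u"
  shows "ae_derivative (\<lambda>x. exp (c * of_real (u x))) (\<lambda>x. c * of_real (u' x) * exp (c * of_real (u x)))"
  unfolding ae_derivative_def
proof
  have [measurable]: "u \<in> borel_measurable borel" "u' \<in> borel_measurable borel"
    using assms by (auto simp: ae_derivative_def borel_measurable_continuous_onI)
  show "(\<lambda>x. c * of_real (u' x) * exp (c * of_real (u x))) \<in> borel_measurable borel" by measurable
  have "AE x in lborel. (u has_vector_derivative u' x) (at x)"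
    using assms by (auto simp: ae_derivative_def)
  then show "AE x in lborel. ((\<lambda>x. exp (c * of_real (u x))) has_vector_derivative c * of_real (u' x) * exp (c * of_real (u x))) (at x)"
  proof eventually_elim
    fix x assume "(u has_vector_derivative u' x) (at x)"
    then have "(u has_real_derivative u' x) (at x)"
      by (simp add: has_real_derivative_iff_has_vector_derivative)
    then have "((\<lambda>x. c * of_real (u x)) has_vector_derivative c * of_real (u' x)) (at x)"
      by (intro has_vector_derivative_mult_right has_vector_derivative_of_real)
    from field_vector_diff_chain_at[OF this DERIV_exp]
    show "((\<lambda>x. exp (c * of_real (u x))) has_vector_derivative c * of_real (u' x) * exp (c * of_real (u x))) (at x)"
      by (simp add: o_def)
  qed
qed

section \<open>Locally finite Borel measures and the measure \<open>upsilon\<close>\<close>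

lemma Borel_measureD:
  assumes "Borel_measure M"
  shows "sets M = sets borel" "space M = UNIV" "emeasure M {a..b} < \<infinity>"
  using assms sets_eq_imp_space_eq[of M borel] by (auto simp: Borel_measure_def)

lemma Borel_measure_lborel: "Borel_measure (lborel :: real measure)"
  unfolding Borel_measure_def by (auto intro: emeasure_bounded_finite compact_imp_bounded simp del: infinity_ennreal_def)

lemma sigma_finite_Borel_measure:
  assumes "Borel_measure M"
  shows "sigma_finite_measure M"
proof
  note M = Borel_measureD[OF assms]
  show "\<exists>A. countable A \<and> A \<subseteq> sets M \<and> \<Union> A = space M \<and> (\<forall>a\<in>A. emeasure M a \<noteq> \<infinity>)"
  proof (intro exI[of _ "range (\<lambda>n::nat. {-real n..real n})"] conjI)
    have "\<exists>n. x \<in> {-real n..real n}" for x :: real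
      using real_arch_simple[of "\<bar>x\<bar>"] by (auto simp: abs_le_iff) (metis minus_le_iff)
    then show "(\<Union>n. {-real n..real n}) = space M" using M(2) by auto
  qed (use M in \<open>auto simp: less_top\<close>)
qed

text \<open>Radon-Nikodym with \<open>M\<close> as the reference measure. Where the density exceeds
  1, the dominated measure would outweigh \<open>M\<close>, so this set must be null.\<close>

lemma dominated_density:
  assumes M: "Borel_measure M" and e: "e \<in> borel_measurable borel" "\<And>x. 0 \<le> e x"
    and le: "\<And>B. B \<in> sets borel \<Longrightarrow> emeasure (density lborel (\<lambda>x. ennreal (e x))) B \<le> emeasure M B"
  obtains g where "g \<in> borel_measurable borel" "\<And>x. 0 \<le> g x" "AE x in M. g x \<le> 1"
    "density M (\<lambda>x. ennreal (g x)) = density lborel (\<lambda>x. ennreal (e x))"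
proof -
  note MD = Borel_measureD[OF M]
  let ?\<nu> = "density lborel (\<lambda>x. ennreal (e x))"
  interpret sigma_finite_measure M by (rule sigma_finite_Borel_measure[OF M])
  have [measurable_cong, simp]: "sets M = sets borel" by (rule MD)
  have "absolutely_continuous M ?\<nu>"
    unfolding absolutely_continuous_def
  proof
    fix N assume "N \<in> null_sets M"
    then show "N \<in> null_sets ?\<nu>" using le[of N] by (auto simp: null_sets_def)
  qed
  then obtain h where h: "h \<in> borel_measurable M" "density M h = ?\<nu>"
    using Radon_Nikodym by force
  have [measurable]: "h \<in> borel_measurable borel"
    using h(1) by (simp add: measurable_cong_sets[OF MD(1) refl])
  have "AE x in M. x \<notin> {-real n..real n} \<inter> {x. 1 < h x}" for n :: nat
  proof -
    \<comment> \<open>Cutting to a bounded interval makes the set finite for \<open>M\<close>, as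
      the subtraction of the two integrals requires.\<close>
    define A where "A = {-real n..real n} \<inter> {x. 1 < h x}"
    have [measurable]: "A \<in> sets borel" unfolding A_def by measurable
    have fin: "emeasure M A < \<infinity>"
    proof -
      have "emeasure M A \<le> emeasure M {-real n..real n}" by (intro emeasure_mono) (auto simp: A_def)
      then show ?thesis using MD(3)[of "-real n" "real n"] by (auto simp: less_top intro: le_less_trans)
    qed
    have "(\<integral>\<^sup>+x. h x * indicator A x - indicator A x \<partial>M) =
        (\<integral>\<^sup>+x. h x * indicator A x \<partial>M) - (\<integral>\<^sup>+x. indicator A x \<partial>M)"
    proof (rule nn_integral_diff)
      show "(\<integral>\<^sup>+x. indicator A x \<partial>M) \<noteq> \<infinity>" using fin by simp
      show "AE x in M. indicator A x \<le> h x * indicator A x"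
        by (intro AE_I2) (auto simp: A_def indicator_def less_imp_le)
    qed measurable
    also have "\<dots> = emeasure ?\<nu> A - emeasure M A"
      unfolding h(2)[symmetric] by (simp add: emeasure_density)
    also have "\<dots> = 0" using le[of A] le_less_trans[OF le[of A] fin] by (intro diff_eq_0_ennreal) auto
    finally have "AE x in M. h x * indicator A x - indicator A x = 0"
      by (subst (asm) nn_integral_0_iff_AE) auto
    then show ?thesis
      unfolding A_def[symmetric]
    proof eventually_elim
      case (elim x)
      show ?case
      proof
        assume "x \<in> A"
        then have "h x \<le> 1" using elim by (simp add: ennreal_minus_eq_0 diff_eq_0_iff_ennreal)
        then show False using \<open>x \<in> A\<close> by (auto simp: A_def)
      qed
    qed
  qed
  then have "AE x in M. \<forall>n::nat. x \<notin> {-real n..real n} \<inter> {x. 1 < h x}"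
    by (subst AE_all_countable) blast
  then have h1: "AE x in M. h x \<le> 1"
  proof eventually_elim
    case (elim x)
    obtain n :: nat where "\<bar>x\<bar> \<le> real n" using real_arch_simple by blast
    then have "x \<in> {-real n..real n}" by auto
    then show ?case using elim by (auto simp: not_less)
  qed
  define g where "g x = enn2real (h x)" for x
  have eq: "AE x in M. ennreal (g x) = h x"
    using h1
  proof eventually_elim
    case (elim x)
    then have "h x < top" by (rule le_less_trans) simp
    then show ?case by (simp add: g_def)
  qed
  show ?thesis
  proof (rule that)
    show "g \<in> borel_measurable borel" unfolding g_def by measurable
    then have [measurable]: "g \<in> borel_measurable borel" .
    show "density M (\<lambda>x. ennreal (g x)) = ?\<nu>"
      unfolding h(2)[symmetric] using eq h(1) by (intro density_cong) auto
    show "AE x in M. g x \<le> 1"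
      using h1 eq by eventually_elim (metis ennreal_le_1)
  qed (simp add: g_def)
qed

text \<open>With \<open>g\<close> the density of the energy with respect to \<mu>, the measure with
  density 1 - g satisfies the description of \<open>upsilon\<close>, and integrals against it split
  into the two terms of the claim. Working with a density avoids the subtraction of
  measures.\<close>

lemma upsilon_integral:
  assumes M: "Borel_measure \<mu>" and u: "continuous_on UNIV u" "ae_derivative u u'"
    and le: "\<And>B. B \<in> sets borel \<Longrightarrow>
        (\<integral>\<^sup>+x\<in>B. ennreal ((u x)\<^sup>2 + (vderiv u x)\<^sup>2) \<partial>lebesgue) \<le> emeasure \<mu> B"
    and F: "F \<in> borel_measurable borel" "integrable \<mu> F"
  shows "integral\<^sup>L (upsilon u \<mu>) F = integral\<^sup>L \<mu> F - (LINT x|lborel. ((u x)\<^sup>2 + (u' x)\<^sup>2) *\<^sub>R (F x :: complex))"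
    and "integrable lborel (\<lambda>x. ((u x)\<^sup>2 + (u' x)\<^sup>2) *\<^sub>R F x)"
proof -
  note MD = Borel_measureD[OF M]
  have [measurable_cong, simp]: "sets \<mu> = sets borel" by (rule MD)
  have [measurable]: "u \<in> borel_measurable borel" "u' \<in> borel_measurable borel"
    "F \<in> borel_measurable borel"
    using u F by (auto simp: ae_derivative_def borel_measurable_continuous_onI)
  define e where "e x = (u x)\<^sup>2 + (u' x)\<^sup>2" for x
  have [measurable]: "e \<in> borel_measurable borel" unfolding e_def by measurable
  have e0: "0 \<le> e x" for x by (simp add: e_def)
  let ?\<nu> = "density lborel (\<lambda>x. ennreal (e x))"
  have \<nu>: "(\<integral>\<^sup>+x\<in>B. ennreal ((u x)\<^sup>2 + (vderiv u x)\<^sup>2) \<partial>lebesgue) = emeasure ?\<nu> B"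
    if [measurable]: "B \<in> sets borel" for B
  proof -
    have "(\<integral>\<^sup>+x\<in>B. ennreal ((u x)\<^sup>2 + (vderiv u x)\<^sup>2) \<partial>lebesgue) = (\<integral>\<^sup>+x\<in>B. ennreal (e x) \<partial>lebesgue)"
      using ae_derivative_AE_vderiv[OF u(2)] by (intro nn_integral_cong_AE) (auto elim!: eventually_mono simp: e_def)
    also have "\<dots> = emeasure ?\<nu> B" by (simp add: nn_integral_completion emeasure_density)
    finally show ?thesis .
  qed
  obtain g where g: "g \<in> borel_measurable borel" "\<And>x. 0 \<le> g x" "AE x in \<mu>. g x \<le> 1"
    "density \<mu> (\<lambda>x. ennreal (g x)) = ?\<nu>"
    using dominated_density[OF M, of e] e0 le \<nu> by auto
  have [measurable]: "g \<in> borel_measurable borel" by (rule g)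
  define \<upsilon> where "\<upsilon> = density \<mu> (\<lambda>x. ennreal (1 - g x))"
  have sum: "emeasure \<mu> B = emeasure ?\<nu> B + emeasure \<upsilon> B" if [measurable]: "B \<in> sets borel" for B
  proof -
    have "emeasure ?\<nu> B + emeasure \<upsilon> B = (\<integral>\<^sup>+x. ennreal (g x) * indicator B x \<partial>\<mu>) + (\<integral>\<^sup>+x. ennreal (1 - g x) * indicator B x \<partial>\<mu>)"
      unfolding g(4)[symmetric] \<upsilon>_def by (simp add: emeasure_density)
    also have "\<dots> = (\<integral>\<^sup>+x. ennreal (g x) * indicator B x + ennreal (1 - g x) * indicator B x \<partial>\<mu>)"
      by (rule nn_integral_add[symmetric]) auto
    also have "\<dots> = (\<integral>\<^sup>+x. indicator B x \<partial>\<mu>)"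
      using g(3) by (intro nn_integral_cong_AE)
        (auto elim!: eventually_mono simp: indicator_def ennreal_plus[symmetric] g(2) simp del: ennreal_plus)
    finally show ?thesis by simp
  qed
  have B\<upsilon>: "Borel_measure \<upsilon>"
    unfolding Borel_measure_def
  proof (intro conjI allI impI)
    show "sets \<upsilon> = sets borel" by (simp add: \<upsilon>_def)
    fix K :: "real set" assume "compact K"
    then have "emeasure \<upsilon> K \<le> emeasure \<mu> K" using sum[of K] by (auto simp: compact_imp_closed)
    then show "emeasure \<upsilon> K < \<infinity>" using M \<open>compact K\<close> by (auto simp: Borel_measure_def intro: le_less_trans)
  qed
  have "upsilon u \<mu> = \<upsilon>"
    unfolding upsilon_def
  proof (rule the_equality)
    show "Borel_measure \<upsilon> \<and> (\<forall>B \<in> sets borel. emeasure \<mu> B =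
        (\<integral>\<^sup>+x\<in>B. ennreal ((u x)\<^sup>2 + (vderiv u x)\<^sup>2) \<partial>lebesgue) + emeasure \<upsilon> B)"
      using B\<upsilon> sum \<nu> by simp
    fix \<sigma> assume *: "Borel_measure \<sigma> \<and> (\<forall>B \<in> sets borel. emeasure \<mu> B =
        (\<integral>\<^sup>+x\<in>B. ennreal ((u x)\<^sup>2 + (vderiv u x)\<^sup>2) \<partial>lebesgue) + emeasure \<sigma> B)"
    then have [measurable_cong, simp]: "sets \<sigma> = sets borel" by (simp add: Borel_measure_def)
    \<comment> \<open>The energy may be cancelled only where it is finite, so uniqueness is shown
      for bounded sets first; continuity from below extends it.\<close>
    have bdd: "emeasure \<sigma> B = emeasure \<upsilon> B" if "B \<in> sets borel" "B \<subseteq> {-real n..real n}" for B and n :: nat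
    proof -
      have "emeasure ?\<nu> B + emeasure \<sigma> B = emeasure ?\<nu> B + emeasure \<upsilon> B"
        using * sum[OF that(1)] \<nu>[OF that(1)] that(1) by simp
      moreover have "emeasure \<mu> B \<le> emeasure \<mu> {-real n..real n}"
        using that by (intro emeasure_mono) auto
      then have "emeasure ?\<nu> B < \<infinity>"
        using le[OF that(1)] \<nu>[OF that(1)] MD(3)[of "-real n" "real n"] by (auto intro: le_less_trans)
      ultimately show ?thesis
        by (metis ennreal_add_left_cancel infinity_ennreal_def order_less_irrefl)
    qed
    show "\<sigma> = \<upsilon>"
    proof (rule measure_eqI)
      show "sets \<sigma> = sets \<upsilon>" by (simp add: \<upsilon>_def)
      fix B assume "B \<in> sets \<sigma>"
      then have B: "B \<in> sets borel" by simp
      define A where "A n = B \<inter> {-real n..real n}" for n :: nat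
      have A: "incseq A" unfolding A_def by (auto simp: incseq_def)
      have Am: "range A \<subseteq> sets borel" using B by (auto simp: A_def)
      have "\<exists>n::nat. x \<in> {-real n..real n}" for x :: real
      proof -
        obtain n :: nat where "\<bar>x\<bar> \<le> real n" using real_arch_simple by blast
        then show ?thesis by (intro exI[of _ n]) auto
      qed
      then have BA: "B = (\<Union>n. A n)" unfolding A_def by blast
      have "emeasure \<sigma> B = (SUP n. emeasure \<sigma> (A n))"
        unfolding BA using Am A by (intro SUP_emeasure_incseq[symmetric]) auto
      also have "\<dots> = (SUP n. emeasure \<upsilon> (A n))"
        using Am by (intro SUP_cong refl bdd) (auto simp: A_def)
      also have "\<dots> = emeasure \<upsilon> B"
        unfolding BA using Am A by (intro SUP_emeasure_incseq) (auto simp: \<upsilon>_def)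
      finally show "emeasure \<sigma> B = emeasure \<upsilon> B" .
    qed
  qed
  moreover have "integral\<^sup>L \<upsilon> F = (LINT x|\<mu>. (1 - g x) *\<^sub>R F x)"
    unfolding \<upsilon>_def using g(3) by (intro integral_density) (auto elim: eventually_mono)
  moreover have intg: "integrable \<mu> (\<lambda>x. g x *\<^sub>R F x)"
    using g(2,3) by (intro Bochner_Integration.integrable_bound[OF F(2)])
      (auto elim!: eventually_mono simp: mult_left_le_one_le)
  moreover have "(LINT x|\<mu>. (1 - g x) *\<^sub>R F x) = integral\<^sup>L \<mu> F - (LINT x|\<mu>. g x *\<^sub>R F x)"
    using F(2) intg by (simp add: scaleR_diff_left)
  moreover have "(LINT x|\<mu>. g x *\<^sub>R F x) = (LINT x|lborel. e x *\<^sub>R F x)"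
  proof -
    have "(LINT x|\<mu>. g x *\<^sub>R F x) = integral\<^sup>L (density \<mu> (\<lambda>x. ennreal (g x))) F"
      using g(2) by (intro integral_density[symmetric]) auto
    also have "\<dots> = (LINT x|lborel. e x *\<^sub>R F x)"
      unfolding g(4) using e0 by (intro integral_density) auto
    finally show ?thesis .
  qed
  moreover have "integrable lborel (\<lambda>x. e x *\<^sub>R F x)"
  proof -
    have "integrable (density \<mu> (\<lambda>x. ennreal (g x))) F"
      using intg g(2) by (subst integrable_density) auto
    then show ?thesis unfolding g(4) using e0 by (subst (asm) integrable_density) auto
  qed
  ultimately show "integral\<^sup>L (upsilon u \<mu>) F = integral\<^sup>L \<mu> F - (LINT x|lborel. ((u x)\<^sup>2 + (u' x)\<^sup>2) *\<^sub>R F x)"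
    "integrable lborel (\<lambda>x. ((u x)\<^sup>2 + (u' x)\<^sup>2) *\<^sub>R F x)"
    by (simp_all add: e_def)
qed

section \<open>Oriented integrals over half-open intervals\<close>

text \<open>Quasi-derivatives may jump at atoms of \<mu>, so continuity would be too narrow. This
  class is closed under sums, products and primitives, and its members are integrable over bounded
  intervals for every locally finite measure.\<close>

definition locally_bounded_borel :: "(real \<Rightarrow> complex) \<Rightarrow> bool" where
  "locally_bounded_borel F \<longleftrightarrow> F \<in> borel_measurable borel \<and> (\<forall>a b. \<exists>C. \<forall>x\<in>{a..b}. norm (F x) \<le> C)"

lemma locally_bounded_borelE:
  assumes "locally_bounded_borel F"
  obtains C where "C > 0" "\<And>x. x \<in> {a..b} \<Longrightarrow> norm (F x) \<le> C"
proof -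
  obtain C where C: "\<forall>x\<in>{a..b}. norm (F x) \<le> C"
    using assms unfolding locally_bounded_borel_def by blast
  show ?thesis by (rule that[of "max C 1"]) (use C in \<open>auto simp: le_max_iff_disj\<close>)
qed

lemma locally_bounded_borel_measurable [measurable_dest]:
  "locally_bounded_borel F \<Longrightarrow> F \<in> borel_measurable borel"
  by (simp add: locally_bounded_borel_def)

lemma locally_bounded_borel_continuous:
  assumes "continuous_on UNIV F"
  shows "locally_bounded_borel F"
  unfolding locally_bounded_borel_def
  using assms continuous_bounded_Icc[OF assms] by (metis borel_measurable_continuous_onI)

lemma locally_bounded_borel_const: "locally_bounded_borel (\<lambda>x. c)"
  by (rule locally_bounded_borel_continuous) simp

lemma locally_bounded_borel_add:
  assumes "locally_bounded_borel F" "locally_bounded_borel G"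
  shows "locally_bounded_borel (\<lambda>x. F x + G x)"
  unfolding locally_bounded_borel_def
proof (intro conjI allI)
  show "(\<lambda>x. F x + G x) \<in> borel_measurable borel" using assms by measurable
  fix a b
  obtain C D where "\<And>x. x \<in> {a..b} \<Longrightarrow> norm (F x) \<le> C" "\<And>x. x \<in> {a..b} \<Longrightarrow> norm (G x) \<le> D"
    using locally_bounded_borelE[OF assms(1)] locally_bounded_borelE[OF assms(2)] by metis
  then show "\<exists>C. \<forall>x\<in>{a..b}. norm (F x + G x) \<le> C"
    by (intro exI[of _ "C + D"]) (auto intro!: norm_triangle_mono)
qed

lemma locally_bounded_borel_mult:
  assumes "locally_bounded_borel F" "locally_bounded_borel G"
  shows "locally_bounded_borel (\<lambda>x. F x * G x)"
  unfolding locally_bounded_borel_def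
proof (intro conjI allI)
  show "(\<lambda>x. F x * G x) \<in> borel_measurable borel" using assms by measurable
  fix a b
  obtain C where C: "C > 0" "\<And>x. x \<in> {a..b} \<Longrightarrow> norm (F x) \<le> C"
    using locally_bounded_borelE[OF assms(1)] by metis
  obtain D where D: "D > 0" "\<And>x. x \<in> {a..b} \<Longrightarrow> norm (G x) \<le> D"
    using locally_bounded_borelE[OF assms(2)] by metis
  show "\<exists>C. \<forall>x\<in>{a..b}. norm (F x * G x) \<le> C"
    using C D by (intro exI[of _ "C * D"]) (auto simp: norm_mult intro!: mult_mono)
qed

lemma locally_bounded_borel_diff:
  assumes "locally_bounded_borel F" "locally_bounded_borel G"
  shows "locally_bounded_borel (\<lambda>x. F x - G x)"
  using locally_bounded_borel_add[OF assms(1) locally_bounded_borel_mult[OF locally_bounded_borel_const[of "-1"] assms(2)]]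
  by simp

lemmas locally_bounded_borel_intros =
  locally_bounded_borel_const locally_bounded_borel_add locally_bounded_borel_mult locally_bounded_borel_diff

text \<open>Half-open on the right, so that primitives are left-continuous, as the quasi-derivative is.\<close>

definition orient :: "real \<Rightarrow> real \<Rightarrow> real \<Rightarrow> real" where
  "orient a x t = indicator {a..<x} t - indicator {x..<a} t"

definition oint :: "real measure \<Rightarrow> real \<Rightarrow> real \<Rightarrow> (real \<Rightarrow> complex) \<Rightarrow> complex" where
  "oint M a x F = (LINT t|M. orient a x t *\<^sub>R F t)"

lemma orient_measurable [measurable]:
  "(\<lambda>t. orient a x t) \<in> borel_measurable borel"
  unfolding orient_def by measurable

lemma abs_orient: "\<bar>orient a x t\<bar> = indicator {min a x..<max a x} t"
  by (auto simp: orient_def indicator_def)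

lemma orient_trans: "orient a b t + orient b c t = orient a c t"
  by (auto simp: orient_def indicator_def)

lemma measure_Ico_finite:
  assumes "Borel_measure M"
  shows "emeasure M {a..<b} < \<infinity>"
  by (rule le_less_trans[OF emeasure_mono Borel_measureD(3)[OF assms, of a b]])
     (auto simp: Borel_measureD(1)[OF assms])

lemma integrable_bounded_support:
  fixes F :: "real \<Rightarrow> 'a::{banach, second_countable_topology}"
  assumes "Borel_measure M" "F \<in> borel_measurable borel"
    and "\<And>x. x \<in> {a..b} \<Longrightarrow> norm (F x) \<le> C" "\<And>x. x \<notin> {a..b} \<Longrightarrow> F x = 0"
  shows "integrable M F"
proof -
  note MD = Borel_measureD[OF assms(1)]
  have [measurable_cong, simp]: "sets M = sets borel" by (rule MD)
  have "integrable M (\<lambda>x. C * indicator {a..b} x :: real)"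
    using MD(3)[of a b] by (intro integrable_mult_right) (auto simp: integrable_indicator_iff)
  then show ?thesis
  proof (rule Bochner_Integration.integrable_bound)
    show "F \<in> borel_measurable M" using assms(2) by measurable
    show "AE x in M. norm (F x) \<le> norm (C * indicator {a..b} x)"
      using assms(3,4) by (intro AE_I2) (fastforce simp: indicator_def)
  qed
qed

lemma integrable_oint:
  assumes "Borel_measure M" "locally_bounded_borel F"
  shows "integrable M (\<lambda>t. orient a x t *\<^sub>R F t)"
proof -
  obtain C where C: "C > 0" "\<And>t. t \<in> {min a x..max a x} \<Longrightarrow> norm (F t) \<le> C"
    using locally_bounded_borelE[OF assms(2)] by metis
  have [measurable]: "F \<in> borel_measurable borel" using assms(2) by measurable
  show ?thesis
  proof (rule integrable_bounded_support[OF assms(1), where a="min a x" and b="max a x" and C=C])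
    show "norm (orient a x t *\<^sub>R F t) \<le> C" if "t \<in> {min a x..max a x}" for t
      using C(1) C(2)[OF that] by (simp add: abs_orient indicator_def)
    show "orient a x t *\<^sub>R F t = 0" if "t \<notin> {min a x..max a x}" for t
      using that by (auto simp: orient_def indicator_def)
  qed measurable
qed

lemma oint_self [simp]: "oint M a a F = 0"
  by (simp add: oint_def orient_def)

lemma oint_trans:
  assumes "Borel_measure M" "locally_bounded_borel F"
  shows "oint M a b F + oint M b c F = oint M a c F"
  unfolding oint_def orient_trans[of a b _ c, symmetric] scaleR_add_left
  by (intro Bochner_Integration.integral_add[symmetric] integrable_oint assms)

lemma oint_swap: "oint M a b F = - oint M b a F"
  unfolding oint_def integral_minus[symmetric]
  by (intro Bochner_Integration.integral_cong) (auto simp: orient_def scaleR_diff_left)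

lemma oint_add:
  assumes "Borel_measure M" "locally_bounded_borel F" "locally_bounded_borel G"
  shows "oint M a b (\<lambda>t. F t + G t) = oint M a b F + oint M a b G"
  unfolding oint_def scaleR_add_right
  by (intro Bochner_Integration.integral_add integrable_oint assms)

lemma oint_diff:
  assumes "Borel_measure M" "locally_bounded_borel F" "locally_bounded_borel G"
  shows "oint M a b (\<lambda>t. F t - G t) = oint M a b F - oint M a b G"
  unfolding oint_def scaleR_diff_right
  by (intro Bochner_Integration.integral_diff integrable_oint assms)

lemma oint_mult: "oint M a b (\<lambda>t. c * F t) = c * oint M a b F"
  unfolding oint_def by (simp add: mult_scaleR_right[symmetric] del: mult_scaleR_right)

lemma norm_oint_le_integral:
  assumes "Borel_measure M" "locally_bounded_borel F"
    and "integrable M (\<lambda>t. indicator {min a x..<max a x} t * G t)"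
    and "\<And>t. min a x \<le> t \<Longrightarrow> t < max a x \<Longrightarrow> norm (F t) \<le> G t"
  shows "norm (oint M a x F) \<le> (LINT t|M. indicator {min a x..<max a x} t * G t)"
proof -
  have "norm (oint M a x F) \<le> (LINT t|M. norm (orient a x t *\<^sub>R F t))"
    unfolding oint_def by (rule integral_norm_bound)
  also have "\<dots> \<le> (LINT t|M. indicator {min a x..<max a x} t * G t)"
  proof (rule integral_mono)
    show "integrable M (\<lambda>t. norm (orient a x t *\<^sub>R F t))"
      by (intro integrable_norm integrable_oint assms)
  qed (use assms(3,4) in \<open>auto simp: abs_orient indicator_def\<close>)
  finally show ?thesis .
qed

lemma norm_oint_le:
  assumes "Borel_measure M" "locally_bounded_borel F"
    and "\<And>t. min a x \<le> t \<Longrightarrow> t < max a x \<Longrightarrow> norm (F t) \<le> C"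
  shows "norm (oint M a x F) \<le> C * measure M {min a x..<max a x}"
proof -
  have [measurable_cong, simp]: "sets M = sets borel" "space M = UNIV" using Borel_measureD[OF assms(1)] by auto
  have "integrable M (\<lambda>t. indicator {min a x..<max a x} t * C)"
    using measure_Ico_finite[OF assms(1)] by (intro integrable_mult_left) (auto simp: integrable_indicator_iff)
  from norm_oint_le_integral[OF assms(1,2) this assms(3)] show ?thesis by (simp add: mult.commute)
qed

lemma oint_lborel_Icc:
  assumes "a \<le> x" "F \<in> borel_measurable borel"
  shows "oint lborel a x F = (LINT t:{a..x}|lborel. F t)"
  unfolding oint_def set_lebesgue_integral_def
proof (rule integral_cong_AE)
  show "AE t in lborel. orient a x t *\<^sub>R F t = indicator {a..x} t *\<^sub>R F t"
    using AE_lborel_singleton[of x]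
    by eventually_elim (use assms in \<open>auto simp: orient_def indicator_def\<close>)
  show "(\<lambda>t. orient a x t *\<^sub>R F t) \<in> borel_measurable lborel"
    "(\<lambda>t. indicator {a..x} t *\<^sub>R F t) \<in> borel_measurable lborel"
    using assms(2) by measurable
qed

lemma locally_bounded_borel_oint:
  assumes "Borel_measure M" "locally_bounded_borel F"
  shows "locally_bounded_borel (\<lambda>x. oint M a x F)"
  unfolding locally_bounded_borel_def
proof (intro conjI allI)
  interpret sigma_finite_measure M by (rule sigma_finite_Borel_measure[OF assms(1)])
  have [measurable_cong, simp]: "sets M = sets borel" using Borel_measureD[OF assms(1)] by auto
  have [measurable]: "F \<in> borel_measurable borel" using assms(2) by measurable
  \<comment> \<open>Written with \<open>of_bool\<close>, the integrand is visibly measurable in both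
    variables jointly, so the parameter integral is measurable.\<close>
  have "(\<lambda>x. LINT t|M. (of_bool (a \<le> t \<and> t < x) - of_bool (x \<le> t \<and> t < a)) *\<^sub>R F t) \<in> borel_measurable borel"
    by measurable
  then show "(\<lambda>x. oint M a x F) \<in> borel_measurable borel"
    by (simp add: oint_def orient_def indicator_def)
  fix c d
  obtain C where C: "C > 0" "\<And>t. t \<in> {min a c..max a d} \<Longrightarrow> norm (F t) \<le> C"
    using locally_bounded_borelE[OF assms(2)] by metis
  show "\<exists>C. \<forall>x\<in>{c..d}. norm (oint M a x F) \<le> C"
  proof (intro exI ballI)
    fix x assume x: "x \<in> {c..d}"
    have "norm (oint M a x F) \<le> C * measure M {min a x..<max a x}"
      using x by (intro norm_oint_le[OF assms] C(2)) auto
    also have "\<dots> \<le> C * measure M {min a c..<max a d}"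
      using x C(1) measure_Ico_finite[OF assms(1)]
      by (intro mult_left_mono measure_mono_fmeasurable) (auto simp: fmeasurable_def)
    finally show "norm (oint M a x F) \<le> C * measure M {min a c..<max a d}" .
  qed
qed

text \<open>The intervals [S n, x) have finite measure and decrease to the empty set. With intervals
  closed on the right, the mass of an atom at x would remain.\<close>

lemma continuous_at_left_oint:
  assumes M: "Borel_measure M" and F: "locally_bounded_borel F"
  shows "continuous (at_left x) (\<lambda>x. oint M a x F)"
  unfolding continuous_within
proof (rule tendsto_at_left_sequentially[of "x - 1"])
  fix S :: "nat \<Rightarrow> real"
  assume S: "\<And>n. S n < x" "\<And>n. x - 1 < S n" "incseq S" "S \<longlonglongrightarrow> x"
  have [measurable_cong, simp]: "sets M = sets borel" using Borel_measureD[OF M] by auto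
  obtain C where C: "C > 0" "\<And>t. t \<in> {x - 1..x} \<Longrightarrow> norm (F t) \<le> C"
    using locally_bounded_borelE[OF F] by metis
  have empty: "(\<Inter>n. {S n..<x}) = {}"
  proof -
    have "\<exists>n. t \<notin> {S n..<x}" for t
    proof (cases "t < x")
      case True
      then have "eventually (\<lambda>n. t < S n) sequentially" by (rule order_tendstoD(1)[OF S(4)])
      then obtain n where "t < S n" unfolding eventually_sequentially by blast
      then show ?thesis by (intro exI[of _ n]) auto
    qed auto
    then show ?thesis by blast
  qed
  have "(\<lambda>n. measure M {S n..<x}) \<longlonglongrightarrow> measure M (\<Inter>n. {S n..<x})"
    using S(3) less_imp_neq[OF measure_Ico_finite[OF M]]
    by (intro Lim_measure_decseq) (auto simp: decseq_def incseq_def intro: order_trans)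
  then have "(\<lambda>n. C * measure M {S n..<x}) \<longlonglongrightarrow> 0"
    unfolding empty by (auto intro: tendsto_mult_right_zero)
  moreover have "norm (oint M a (S n) F - oint M a x F) \<le> C * measure M {S n..<x}" for n
  proof -
    have "oint M a (S n) F - oint M a x F = - oint M (S n) x F"
      using oint_trans[OF M F, of a "S n" x] by (simp add: algebra_simps)
    then show ?thesis
      using norm_oint_le[OF M F, of "S n" x C] C(2) S(1)[of n] S(2)[of n] by simp
  qed
  then have "eventually (\<lambda>n. norm (oint M a (S n) F - oint M a x F) \<le> C * measure M {S n..<x}) sequentially"
    by (intro always_eventually allI)
  ultimately have "(\<lambda>n. oint M a (S n) F - oint M a x F) \<longlonglongrightarrow> 0"
    by (rule Lim_null_comparison[rotated])
  then show "(\<lambda>n. oint M a (S n) F) \<longlonglongrightarrow> oint M a x F" by (simp add: LIM_zero_iff)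
qed simp

lemma norm_oint_lborel_le:
  assumes "locally_bounded_borel F" "\<And>t. min a x \<le> t \<Longrightarrow> t < max a x \<Longrightarrow> norm (F t) \<le> C"
  shows "norm (oint lborel a x F) \<le> C * \<bar>x - a\<bar>"
proof -
  have "norm (oint lborel a x F) \<le> C * measure lborel {min a x..<max a x}"
    using assms by (intro norm_oint_le[OF Borel_measure_lborel])
  then show ?thesis by (simp add: max_def min_def split: if_splits)
qed

text \<open>Integrating the exponential weight away from its centre gains a factor 1 / l. A large
  rate therefore makes the integral operators small, which is the source of the contraction used for
  the system.\<close>

lemma integral_exp_distance_le:
  fixes a x l :: real
  assumes "l > 0"
  shows "integrable lborel (\<lambda>t. indicator {min a x..<max a x} t * exp (l * \<bar>t - a\<bar>))"
    and "(LINT t|lborel. indicator {min a x..<max a x} t * exp (l * \<bar>t - a\<bar>)) \<le> exp (l * \<bar>x - a\<bar>) / l"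
proof -
  show "integrable lborel (\<lambda>t. indicator {min a x..<max a x} t * exp (l * \<bar>t - a\<bar>))"
  proof (rule integrable_bounded_support[OF Borel_measure_lborel, where a="min a x" and b="max a x" and C="exp (l * \<bar>x - a\<bar>)"])
    show "norm (indicator {min a x..<max a x} t * exp (l * \<bar>t - a\<bar>)) \<le> exp (l * \<bar>x - a\<bar>)"
      if "t \<in> {min a x..max a x}" for t
      using assms that by (auto simp: indicator_def min_def max_def split: if_splits)
  qed (auto simp: indicator_def)
  \<comment> \<open>A primitive of the weight on either side of \<open>a\<close>; its boundary term
    at \<open>a\<close> contributes -1 / l and is dropped in the final inequality.\<close>
  define G where "G t = (if a \<le> x then exp (l * (t - a)) / l else - exp (l * (a - t)) / l)" for t
  define g where "g t = (if a \<le> x then exp (l * (t - a)) else exp (l * (a - t)))" for t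
  have "(LINT t|lborel. indicator {min a x..<max a x} t * exp (l * \<bar>t - a\<bar>)) =
      (LINT t|lborel. g t * indicator {min a x..max a x} t)"
  proof (rule integral_cong_AE)
    show "AE t in lborel. indicator {min a x..<max a x} t * exp (l * \<bar>t - a\<bar>) = g t * indicator {min a x..max a x} t"
      using AE_lborel_singleton[of "max a x"]
      by eventually_elim (auto simp: indicator_def g_def min_def max_def split: if_splits)
  qed (auto simp: g_def)
  also have "\<dots> = G (max a x) - G (min a x)"
  proof (rule integral_FTC_Icc_real)
    show "(G has_real_derivative g t) (at t)" for t
      using assms unfolding G_def g_def by (cases "a \<le> x") (auto intro!: derivative_eq_intros)
    show "isCont g t" for t unfolding g_def by (cases "a \<le> x") (auto intro!: continuous_intros)
  qed auto
  also have "\<dots> \<le> exp (l * \<bar>x - a\<bar>) / l"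
    using assms by (auto simp: G_def max_def min_def field_simps)
  finally show "(LINT t|lborel. indicator {min a x..<max a x} t * exp (l * \<bar>t - a\<bar>)) \<le> exp (l * \<bar>x - a\<bar>) / l" .
qed

lemma norm_oint_exp_le:
  assumes "locally_bounded_borel F" "l > 0" "A \<ge> 0"
    and "\<And>t. min a x \<le> t \<Longrightarrow> t < max a x \<Longrightarrow> norm (F t) \<le> A * exp (l * \<bar>t - a\<bar>)"
  shows "norm (oint lborel a x F) \<le> A / l * exp (l * \<bar>x - a\<bar>)"
proof -
  have "norm (oint lborel a x F) \<le> (LINT t|lborel. indicator {min a x..<max a x} t * (A * exp (l * \<bar>t - a\<bar>)))"
    using integral_exp_distance_le(1)[OF assms(2), of a x] assms(4)
    by (intro norm_oint_le_integral[OF Borel_measure_lborel assms(1)]) (auto simp: mult.left_commute)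
  also have "\<dots> = A * (LINT t|lborel. indicator {min a x..<max a x} t * exp (l * \<bar>t - a\<bar>))"
    by (simp add: mult.left_commute)
  also have "\<dots> \<le> A * (exp (l * \<bar>x - a\<bar>) / l)"
    by (intro mult_left_mono integral_exp_distance_le assms)
  finally show ?thesis by simp
qed

lemma indefinite_integral_oint:
  assumes "locally_bounded_borel g" "\<And>x y. f y - f x = oint lborel x y g"
  shows "indefinite_integral f g" "locally_absolutely_continuous f"
proof -
  have [measurable]: "g \<in> borel_measurable borel" using assms(1) by measurable
  have "set_integrable lborel {a..b} g" for a b
  proof -
    obtain C where "\<And>x. x \<in> {a..b} \<Longrightarrow> norm (g x) \<le> C" using locally_bounded_borelE[OF assms(1)] by metis
    then show ?thesis unfolding set_integrable_def
      by (intro integrable_bounded_support[OF Borel_measure_lborel, where a=a and b=b and C=C]) auto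
  qed
  then show "indefinite_integral f g"
    unfolding indefinite_integral_def using assms(2) oint_lborel_Icc by auto
  show "locally_absolutely_continuous f"
  proof (rule locally_absolutely_continuous_lipschitz)
    fix a b
    obtain C where C: "\<And>x. x \<in> {a..b} \<Longrightarrow> norm (g x) \<le> C" using locally_bounded_borelE[OF assms(1)] by metis
    show "\<exists>L. \<forall>x\<in>{a..b}. \<forall>y\<in>{a..b}. norm (f y - f x) \<le> L * \<bar>y - x\<bar>"
      unfolding assms(2) by (intro exI[of _ C] ballI norm_oint_lborel_le[OF assms(1)] C) auto
  qed
qed

lemma oint_indefinite_integral:
  assumes "indefinite_integral f g"
  shows "f y - f x = oint lborel x y g"
proof (cases "x \<le> y")
  case True
  then show ?thesis using indefinite_integralD[OF assms] oint_lborel_Icc by metis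
next
  case False
  then have "f x - f y = oint lborel y x g"
    using indefinite_integralD[OF assms] oint_lborel_Icc by (metis linear)
  then show ?thesis using oint_swap[of lborel x y g] by (metis minus_diff_eq)
qed

section \<open>Volterra systems with a measure coefficient\<close>

definition mixed_oint ::
  "(real \<Rightarrow> complex) \<Rightarrow> (real \<Rightarrow> complex) \<Rightarrow> real measure \<Rightarrow> real \<Rightarrow> real \<Rightarrow> (real \<Rightarrow> complex) \<Rightarrow> complex" where
  "mixed_oint r m \<mu> x y \<phi> = oint lborel x y (\<lambda>t. r t * \<phi> t) + oint \<mu> x y (\<lambda>t. m t * \<phi> t)"

text \<open>Increments between arbitrary points build no base point into the notion; the orientation
  of \<open>oint\<close> gives a meaning to both orders of the end points.\<close>

definition vsol ::
  "(real \<Rightarrow> complex) \<Rightarrow> (real \<Rightarrow> complex) \<Rightarrow> (real \<Rightarrow> complex) \<Rightarrow> real measure \<Rightarrow>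
   (real \<Rightarrow> complex) \<Rightarrow> (real \<Rightarrow> complex) \<Rightarrow> bool" where
  "vsol p r m \<mu> \<phi> \<psi> \<longleftrightarrow> locally_bounded_borel \<phi> \<and> locally_bounded_borel \<psi> \<and>
     (\<forall>x y. \<phi> y - \<phi> x = oint lborel x y (\<lambda>t. p t * \<psi> t)) \<and>
     (\<forall>x y. \<psi> y - \<psi> x = mixed_oint r m \<mu> x y \<phi>)"

lemma LIMSEQ_null_norm_le:
  fixes f :: "nat \<Rightarrow> 'a::real_normed_vector"
  assumes "\<And>n. norm (f n) \<le> g n" "g \<longlonglongrightarrow> 0"
  shows "f \<longlonglongrightarrow> 0"
  by (rule Lim_null_comparison[OF always_eventually assms(2)]) (use assms(1) in blast)

text \<open>With respect to the weight \<open>exp (L \<bar>t - a\<bar>)\<close> the Volterra operators below have norm at most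
  \<open>1/2\<close>; this yields uniqueness, convergence of the Picard iteration and the estimates for
  perturbed coefficients.\<close>

lemma weighted_gronwall:
  fixes D :: "real \<Rightarrow> real"
  assumes bd: "\<And>x. x \<in> I \<Longrightarrow> D x \<le> B" "0 \<le> B" and nn: "0 \<le> \<epsilon>" "0 \<le> L"
    and step: "\<And>S x. 0 \<le> S \<Longrightarrow> (\<And>t. t \<in> I \<Longrightarrow> D t \<le> S * exp (L * \<bar>t - a\<bar>)) \<Longrightarrow> x \<in> I \<Longrightarrow>
        D x \<le> \<epsilon> + S / 2 * exp (L * \<bar>x - a\<bar>)"
    and x: "x \<in> I"
  shows "D x \<le> 2 * \<epsilon> * exp (L * \<bar>x - a\<bar>)"
proof -
  have one: "1 \<le> exp (L * \<bar>t - a\<bar>)" for t using nn by simp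
  \<comment> \<open>The number 2 \<epsilon> is the fixed point of s -> \<epsilon> + s / 2, and the
    excess \<open>B\<close> over it is halved in each round.\<close>
  have le: "D t \<le> (2 * \<epsilon> + B / 2 ^ n) * exp (L * \<bar>t - a\<bar>)" if "t \<in> I" for n t
    using that
  proof (induction n arbitrary: t)
    case 0
    have "D t \<le> (2 * \<epsilon> + B) * 1" using bd(1)[OF 0] nn by simp
    also have "\<dots> \<le> (2 * \<epsilon> + B) * exp (L * \<bar>t - a\<bar>)" using bd nn one by (intro mult_left_mono) auto
    finally show ?case by simp
  next
    case (Suc n)
    have "D t \<le> \<epsilon> + (2 * \<epsilon> + B / 2 ^ n) / 2 * exp (L * \<bar>t - a\<bar>)"
      using bd nn Suc by (intro step) auto
    also have "\<dots> \<le> \<epsilon> * exp (L * \<bar>t - a\<bar>) + (2 * \<epsilon> + B / 2 ^ n) / 2 * exp (L * \<bar>t - a\<bar>)"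
      using nn one[of t] mult_left_mono[of 1 "exp (L * \<bar>t - a\<bar>)" \<epsilon>] by simp
    also have "\<dots> = (2 * \<epsilon> + B / 2 ^ Suc n) * exp (L * \<bar>t - a\<bar>)"
      by (simp add: field_simps)
    finally show ?case .
  qed
  have lim: "(\<lambda>n. (2 * \<epsilon> + B * (1 / 2) ^ n) * exp (L * \<bar>x - a\<bar>)) \<longlonglongrightarrow> (2 * \<epsilon> + B * 0) * exp (L * \<bar>x - a\<bar>)"
    by (intro tendsto_intros LIMSEQ_power_zero) simp
  have "D x \<le> (2 * \<epsilon> + B * 0) * exp (L * \<bar>x - a\<bar>)"
  proof (rule LIMSEQ_le_const[OF lim], intro exI allI impI)
    show "D x \<le> (2 * \<epsilon> + B * (1 / 2) ^ n) * exp (L * \<bar>x - a\<bar>)" for n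
      using le[OF x, of n] by (simp add: power_divide)
  qed
  then show ?thesis by simp
qed

text \<open>With the rate L = 2 P N + 1 the integration gains 1 / L, and P N / L is at most 1/2. The
  summand 1 keeps the rate positive when P N vanishes.\<close>

lemma weighted_contraction:
  assumes "locally_bounded_borel p" "locally_bounded_borel G" and a: "a \<in> {c..d}" and x: "x \<in> {c..d}"
    and p: "\<And>t. t \<in> {c..d} \<Longrightarrow> norm (p t) \<le> P" and nn: "0 \<le> P" "0 \<le> N" "0 \<le> S"
    and G: "\<And>t. t \<in> {c..d} \<Longrightarrow> norm (G t) \<le> N * (S * exp ((2 * P * N + 1) * \<bar>t - a\<bar>))"
  shows "norm (oint lborel a x (\<lambda>t. p t * G t)) \<le> S / 2 * exp ((2 * P * N + 1) * \<bar>x - a\<bar>)"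
proof -
  have pos: "0 < 2 * P * N + 1" using nn by (simp add: add_nonneg_pos)
  have "norm (oint lborel a x (\<lambda>t. p t * G t)) \<le> (P * N * S) / (2 * P * N + 1) * exp ((2 * P * N + 1) * \<bar>x - a\<bar>)"
  proof (rule norm_oint_exp_le)
    fix t assume "min a x \<le> t" "t < max a x"
    then have t: "t \<in> {c..d}" using a x by auto
    have "norm (p t * G t) \<le> P * (N * (S * exp ((2 * P * N + 1) * \<bar>t - a\<bar>)))"
      using p[OF t] G[OF t] nn unfolding norm_mult by (intro mult_mono) auto
    then show "norm (p t * G t) \<le> P * N * S * exp ((2 * P * N + 1) * \<bar>t - a\<bar>)" by (simp add: mult.assoc)
  qed (use assms pos in \<open>auto intro: locally_bounded_borel_intros\<close>)
  also have "\<dots> \<le> S / 2 * exp ((2 * P * N + 1) * \<bar>x - a\<bar>)"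
  proof (rule mult_right_mono)
    show "P * N * S / (2 * P * N + 1) \<le> S / 2" using pos nn by (simp add: field_simps)
  qed simp
  finally show ?thesis .
qed

locale volterra =
  fixes p r m :: "real \<Rightarrow> complex" and \<mu> :: "real measure"
  assumes Borel: "Borel_measure \<mu>"
    and p_cont: "continuous_on UNIV p" and r_cont: "continuous_on UNIV r" and m_cont: "continuous_on UNIV m"
begin

lemmas lbb = locally_bounded_borel_intros
  locally_bounded_borel_continuous[OF p_cont] locally_bounded_borel_continuous[OF r_cont]
  locally_bounded_borel_continuous[OF m_cont]

lemma mixed_oint_self [simp]: "mixed_oint r m \<mu> x x \<phi> = 0"
  by (simp add: mixed_oint_def)

lemma mixed_oint_trans:
  "locally_bounded_borel \<phi> \<Longrightarrow> mixed_oint r m \<mu> x y \<phi> + mixed_oint r m \<mu> y w \<phi> = mixed_oint r m \<mu> x w \<phi>"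
  unfolding mixed_oint_def
  using oint_trans[OF Borel_measure_lborel, of "\<lambda>t. r t * \<phi> t" x y w] oint_trans[OF Borel, of "\<lambda>t. m t * \<phi> t" x y w]
  by (simp add: lbb algebra_simps)

lemma mixed_oint_add:
  "locally_bounded_borel \<phi> \<Longrightarrow> locally_bounded_borel \<phi>' \<Longrightarrow>
   mixed_oint r m \<mu> x y (\<lambda>t. \<phi> t + \<phi>' t) = mixed_oint r m \<mu> x y \<phi> + mixed_oint r m \<mu> x y \<phi>'"
  unfolding mixed_oint_def distrib_left
  by (simp add: oint_add[OF Borel] oint_add[OF Borel_measure_lborel] lbb)

lemma mixed_oint_diff:
  "locally_bounded_borel \<phi> \<Longrightarrow> locally_bounded_borel \<phi>' \<Longrightarrow>
   mixed_oint r m \<mu> x y (\<lambda>t. \<phi> t - \<phi>' t) = mixed_oint r m \<mu> x y \<phi> - mixed_oint r m \<mu> x y \<phi>'"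
  unfolding mixed_oint_def right_diff_distrib
  by (simp add: oint_diff[OF Borel] oint_diff[OF Borel_measure_lborel] lbb)

lemma mixed_oint_mult: "mixed_oint r m \<mu> x y (\<lambda>t. c * \<phi> t) = c * mixed_oint r m \<mu> x y \<phi>"
  unfolding mixed_oint_def by (simp add: mult.left_commute[of _ c] oint_mult distrib_left)

lemma locally_bounded_borel_mixed_oint:
  "locally_bounded_borel \<phi> \<Longrightarrow> locally_bounded_borel (\<lambda>y. mixed_oint r m \<mu> x y \<phi>)"
  unfolding mixed_oint_def
  by (intro lbb locally_bounded_borel_oint Borel Borel_measure_lborel)

lemma norm_mixed_oint_le:
  assumes "locally_bounded_borel \<phi>" "x \<in> {a..b}" "y \<in> {a..b}" "0 \<le> C"
    and \<phi>: "\<And>t. min x y \<le> t \<Longrightarrow> t \<le> max x y \<Longrightarrow> norm (\<phi> t) \<le> C"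
    and r: "\<And>t. t \<in> {a..b} \<Longrightarrow> norm (r t) \<le> Cr" and m: "\<And>t. t \<in> {a..b} \<Longrightarrow> norm (m t) \<le> Cm"
  shows "norm (mixed_oint r m \<mu> x y \<phi>) \<le> (Cr * (b - a) + Cm * measure \<mu> {a..b}) * C"
proof -
  have [simp]: "sets \<mu> = sets borel" using Borel_measureD[OF Borel] by auto
  have C0: "0 \<le> Cr" "0 \<le> Cm" using r[OF assms(2)] m[OF assms(2)] by (auto intro: order_trans[OF norm_ge_zero])
  have "norm (oint lborel x y (\<lambda>t. r t * \<phi> t)) \<le> Cr * C * \<bar>y - x\<bar>"
  proof (rule norm_oint_lborel_le)
    fix t assume "min x y \<le> t" "t < max x y"
    then show "norm (r t * \<phi> t) \<le> Cr * C"
      unfolding norm_mult using assms(2,3,4) C0 by (intro mult_mono \<phi> r) auto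
  qed (intro lbb assms)
  also have "\<dots> \<le> Cr * C * (b - a)" using assms(2,3,4) C0 by (intro mult_left_mono) auto
  finally have 1: "norm (oint lborel x y (\<lambda>t. r t * \<phi> t)) \<le> Cr * C * (b - a)" .
  have "norm (oint \<mu> x y (\<lambda>t. m t * \<phi> t)) \<le> Cm * C * measure \<mu> {min x y..<max x y}"
  proof (rule norm_oint_le[OF Borel])
    fix t assume "min x y \<le> t" "t < max x y"
    then show "norm (m t * \<phi> t) \<le> Cm * C"
      unfolding norm_mult using assms(2,3,4) C0 by (intro mult_mono \<phi> m) auto
  qed (intro lbb assms)
  also have "\<dots> \<le> Cm * C * measure \<mu> {a..b}"
    using assms(2,3,4) C0 Borel_measureD(3)[OF Borel, of a b]
    by (intro mult_left_mono measure_mono_fmeasurable) (auto simp: fmeasurable_def)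
  finally have 2: "norm (oint \<mu> x y (\<lambda>t. m t * \<phi> t)) \<le> Cm * C * measure \<mu> {a..b}" .
  show ?thesis unfolding mixed_oint_def using norm_triangle_mono[OF 1 2] by (simp add: algebra_simps)
qed

lemma mixed_oint_bound:
  obtains N P where "0 \<le> N" "0 \<le> P" "\<And>t. t \<in> {a..b} \<Longrightarrow> norm (p t) \<le> P"
    "\<And>x y \<phi> C. locally_bounded_borel \<phi> \<Longrightarrow> x \<in> {a..b} \<Longrightarrow> y \<in> {a..b} \<Longrightarrow> 0 \<le> C \<Longrightarrow>
      (\<And>t. min x y \<le> t \<Longrightarrow> t \<le> max x y \<Longrightarrow> norm (\<phi> t) \<le> C) \<Longrightarrow> norm (mixed_oint r m \<mu> x y \<phi>) \<le> N * C"
proof -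
  obtain P where P: "P > 0" "\<And>t. t \<in> {a..b} \<Longrightarrow> norm (p t) \<le> P" using continuous_bounded_Icc[OF p_cont] by metis
  obtain Cr where Cr: "Cr > 0" "\<And>t. t \<in> {a..b} \<Longrightarrow> norm (r t) \<le> Cr" using continuous_bounded_Icc[OF r_cont] by metis
  obtain Cm where Cm: "Cm > 0" "\<And>t. t \<in> {a..b} \<Longrightarrow> norm (m t) \<le> Cm" using continuous_bounded_Icc[OF m_cont] by metis
  \<comment> \<open>For b < a this number may be negative, hence the maximum with 0 below.\<close>
  let ?N = "Cr * (b - a) + Cm * measure \<mu> {a..b}"
  show ?thesis
  proof (rule that[of "max 0 ?N" P])
    fix x y \<phi> C
    assume *: "locally_bounded_borel \<phi>" "x \<in> {a..b}" "y \<in> {a..b}" "0 \<le> C"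
      "\<And>t. min x y \<le> t \<Longrightarrow> t \<le> max x y \<Longrightarrow> norm (\<phi> t) \<le> C"
    have "norm (mixed_oint r m \<mu> x y \<phi>) \<le> ?N * C"
      by (rule norm_mixed_oint_le[OF * Cr(2) Cm(2)])
    also have "\<dots> \<le> max 0 ?N * C" using \<open>0 \<le> C\<close> by (intro mult_right_mono) auto
    finally show "norm (mixed_oint r m \<mu> x y \<phi>) \<le> max 0 ?N * C" .
  qed (use P in auto)
qed

text \<open>The weight grows with the distance from \<open>a\<close>, so between \<open>a\<close>
  and \<open>s\<close> it is largest at \<open>s\<close>, and the unweighted bound can be applied
  with that value.\<close>

lemma mixed_oint_weighted_le:
  assumes bound: "\<And>x y \<phi> C. locally_bounded_borel \<phi> \<Longrightarrow> x \<in> {c..d} \<Longrightarrow> y \<in> {c..d} \<Longrightarrow> 0 \<le> C \<Longrightarrow>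
      (\<And>t. min x y \<le> t \<Longrightarrow> t \<le> max x y \<Longrightarrow> norm (\<phi> t) \<le> C) \<Longrightarrow> norm (mixed_oint r m \<mu> x y \<phi>) \<le> N * C"
    and "locally_bounded_borel \<phi>" "a \<in> {c..d}" "s \<in> {c..d}" "0 \<le> S" "0 \<le> L"
    and le: "\<And>t. t \<in> {c..d} \<Longrightarrow> norm (\<phi> t) \<le> S * exp (L * \<bar>t - a\<bar>)"
  shows "norm (mixed_oint r m \<mu> a s \<phi>) \<le> N * (S * exp (L * \<bar>s - a\<bar>))"
proof (rule bound)
  fix t assume t: "min a s \<le> t" "t \<le> max a s"
  then have "t \<in> {c..d}" using assms by auto
  then have "norm (\<phi> t) \<le> S * exp (L * \<bar>t - a\<bar>)" by (rule le)
  also have "\<dots> \<le> S * exp (L * \<bar>s - a\<bar>)" using t assms(5,6) by (auto intro!: mult_left_mono)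
  finally show "norm (\<phi> t) \<le> S * exp (L * \<bar>s - a\<bar>)" .
qed (use assms in auto)

text \<open>\<phi> is a primitive with respect to dx, hence absolutely continuous. \<psi> also
  integrates against \<mu> and may jump, but the half-open intervals make it left-continuous, which
  is the normalisation in \<open>quasi_deriv\<close>.\<close>

lemma vsol_continuous:
  assumes "vsol p r m \<mu> \<phi> \<psi>"
  shows "continuous_on UNIV \<phi>" "continuous (at_left x) \<psi>"
proof -
  have \<phi>\<psi>: "locally_bounded_borel \<phi>" "locally_bounded_borel \<psi>" using assms by (auto simp: vsol_def)
  have "locally_absolutely_continuous \<phi>"
    by (rule indefinite_integral_oint(2)[of "\<lambda>t. p t * \<psi> t"]) (use assms in \<open>auto simp: vsol_def intro: lbb\<close>)
  then show "continuous_on UNIV \<phi>" by (rule continuous_on_locally_absolutely_continuous)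
  have "\<psi> = (\<lambda>y. \<psi> 0 + (oint lborel 0 y (\<lambda>t. r t * \<phi> t) + oint \<mu> 0 y (\<lambda>t. m t * \<phi> t)))"
  proof
    fix y
    have "\<psi> y - \<psi> 0 = mixed_oint r m \<mu> 0 y \<phi>" using assms by (auto simp: vsol_def)
    then show "\<psi> y = \<psi> 0 + (oint lborel 0 y (\<lambda>t. r t * \<phi> t) + oint \<mu> 0 y (\<lambda>t. m t * \<phi> t))"
      by (simp add: mixed_oint_def algebra_simps)
  qed
  moreover have "continuous (at_left x) (\<lambda>y. \<psi> 0 + (oint lborel 0 y (\<lambda>t. r t * \<phi> t) + oint \<mu> 0 y (\<lambda>t. m t * \<phi> t)))"
    by (intro continuous_intros continuous_at_left_oint Borel Borel_measure_lborel lbb \<phi>\<psi>)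
  ultimately show "continuous (at_left x) \<psi>" by simp
qed

lemma vsol_lincomb:
  assumes "vsol p r m \<mu> \<phi> \<psi>" "vsol p r m \<mu> \<phi>' \<psi>'"
  shows "vsol p r m \<mu> (\<lambda>x. c * \<phi> x + d * \<phi>' x) (\<lambda>x. c * \<psi> x + d * \<psi>' x)"
proof -
  have l: "locally_bounded_borel \<phi>" "locally_bounded_borel \<psi>" "locally_bounded_borel \<phi>'" "locally_bounded_borel \<psi>'"
    using assms by (auto simp: vsol_def)
  show ?thesis unfolding vsol_def
  proof (intro conjI allI)
    fix x y
    have "oint lborel x y (\<lambda>t. p t * (c * \<psi> t + d * \<psi>' t)) = oint lborel x y (\<lambda>t. c * (p t * \<psi> t) + d * (p t * \<psi>' t))"
      by (simp add: algebra_simps)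
    also have "\<dots> = c * oint lborel x y (\<lambda>t. p t * \<psi> t) + d * oint lborel x y (\<lambda>t. p t * \<psi>' t)"
      by (subst oint_add[OF Borel_measure_lborel]) (auto simp: oint_mult intro!: lbb l)
    also have "\<dots> = c * (\<phi> y - \<phi> x) + d * (\<phi>' y - \<phi>' x)" using assms by (simp add: vsol_def)
    finally show "c * \<phi> y + d * \<phi>' y - (c * \<phi> x + d * \<phi>' x) = oint lborel x y (\<lambda>t. p t * (c * \<psi> t + d * \<psi>' t))"
      by (simp add: algebra_simps)
    have "mixed_oint r m \<mu> x y (\<lambda>x. c * \<phi> x + d * \<phi>' x) = c * mixed_oint r m \<mu> x y \<phi> + d * mixed_oint r m \<mu> x y \<phi>'"
      by (subst mixed_oint_add) (auto simp: mixed_oint_mult intro!: lbb l)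
    also have "\<dots> = c * (\<psi> y - \<psi> x) + d * (\<psi>' y - \<psi>' x)" using assms by (simp add: vsol_def)
    finally show "c * \<psi> y + d * \<psi>' y - (c * \<psi> x + d * \<psi>' x) = mixed_oint r m \<mu> x y (\<lambda>x. c * \<phi> x + d * \<phi>' x)"
      by (simp add: algebra_simps)
  qed (intro lbb l)+
qed

text \<open>Inserting the second equation into the first leaves an equation for \<phi> alone. The
  weighted estimate applies to it with inhomogeneity 0, so the bound it yields is 0.\<close>

lemma vsol_zero:
  assumes sol: "vsol p r m \<mu> \<phi> \<psi>" and zero: "\<phi> a = 0" "\<psi> a = 0"
  shows "\<phi> x = 0" "\<psi> x = 0"
proof -
  have l: "locally_bounded_borel \<phi>" "locally_bounded_borel \<psi>" using sol by (auto simp: vsol_def)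
  have \<psi>: "\<psi> y = mixed_oint r m \<mu> a y \<phi>" for y
  proof -
    have "\<psi> y - \<psi> a = mixed_oint r m \<mu> a y \<phi>" using sol by (simp add: vsol_def)
    then show ?thesis using zero by simp
  qed
  have \<phi>: "\<phi> y = oint lborel a y (\<lambda>t. p t * mixed_oint r m \<mu> a t \<phi>)" for y
  proof -
    have "\<phi> y - \<phi> a = oint lborel a y (\<lambda>t. p t * \<psi> t)" using sol by (simp add: vsol_def)
    then show ?thesis using zero \<psi> by simp
  qed
  have \<phi>0: "\<phi> x = 0" for x
  proof -
    define c d where "c = min a x" and "d = max a x"
    have ax: "a \<in> {c..d}" "x \<in> {c..d}" by (auto simp: c_def d_def)
    obtain N P where NP: "0 \<le> N" "0 \<le> P" "\<And>t. t \<in> {c..d} \<Longrightarrow> norm (p t) \<le> P"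
      "\<And>x y \<phi> C. locally_bounded_borel \<phi> \<Longrightarrow> x \<in> {c..d} \<Longrightarrow> y \<in> {c..d} \<Longrightarrow> 0 \<le> C \<Longrightarrow>
      (\<And>t. min x y \<le> t \<Longrightarrow> t \<le> max x y \<Longrightarrow> norm (\<phi> t) \<le> C) \<Longrightarrow> norm (mixed_oint r m \<mu> x y \<phi>) \<le> N * C"
      using mixed_oint_bound by metis
    obtain B where B: "B > 0" "\<And>x. x \<in> {c..d} \<Longrightarrow> norm (\<phi> x) \<le> B" using locally_bounded_borelE[OF l(1)] by metis
    have L: "0 \<le> 2 * P * N + 1" using NP by simp
    have "norm (\<phi> x) \<le> 2 * 0 * exp ((2 * P * N + 1) * \<bar>x - a\<bar>)"
    proof (rule weighted_gronwall[where D="\<lambda>x. norm (\<phi> x)" and I="{c..d}" and B=B])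
      fix S y assume S: "0 \<le> S" "\<And>t. t \<in> {c..d} \<Longrightarrow> norm (\<phi> t) \<le> S * exp ((2 * P * N + 1) * \<bar>t - a\<bar>)"
        and y: "y \<in> {c..d}"
      have "norm (mixed_oint r m \<mu> a t \<phi>) \<le> N * (S * exp ((2 * P * N + 1) * \<bar>t - a\<bar>))" if "t \<in> {c..d}" for t
        by (rule mixed_oint_weighted_le[OF NP(4) l(1) ax(1) that S(1) L S(2)])
      from weighted_contraction[OF lbb(5) locally_bounded_borel_mixed_oint[OF l(1)] ax(1) y NP(3) NP(2,1) S(1) this]
      show "norm (\<phi> y) \<le> 0 + S / 2 * exp ((2 * P * N + 1) * \<bar>y - a\<bar>)" using \<phi>[of y] by simp
    qed (use B ax L in auto)
    then show ?thesis by simp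
  qed
  show "\<phi> x = 0" by (rule \<phi>0)
  have "\<phi> = (\<lambda>x. 0)" using \<phi>0 by auto
  then show "\<psi> x = 0" using \<psi>[of x] by (simp add: mixed_oint_def oint_def)
qed

lemma vsol_unique:
  assumes "vsol p r m \<mu> \<phi> \<psi>" "vsol p r m \<mu> \<phi>' \<psi>'" "\<phi> a = \<phi>' a" "\<psi> a = \<psi>' a"
  shows "\<phi> x = \<phi>' x" "\<psi> x = \<psi>' x"
  using vsol_zero[OF vsol_lincomb[OF assms(1,2), of 1 "-1"], of a x] assms(3,4) by auto

text \<open>The Volterra operator for \<phi> alone, the second equation having been inserted into
  the first; \<psi> is recovered from a fixed point afterwards.\<close>

definition picard :: "real \<Rightarrow> complex \<Rightarrow> complex \<Rightarrow> (real \<Rightarrow> complex) \<Rightarrow> real \<Rightarrow> complex" where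
  "picard a d1 d2 \<phi> x = d1 + oint lborel a x (\<lambda>s. p s * (d2 + mixed_oint r m \<mu> a s \<phi>))"

lemma locally_bounded_borel_picard:
  "locally_bounded_borel \<phi> \<Longrightarrow> locally_bounded_borel (picard a d1 d2 \<phi>)"
  unfolding picard_def[abs_def]
  by (intro lbb locally_bounded_borel_oint Borel_measure_lborel locally_bounded_borel_mixed_oint)

lemma picard_diff:
  assumes "locally_bounded_borel \<phi>" "locally_bounded_borel \<phi>'"
  shows "picard a d1 d2 \<phi> x - picard a d1 d2 \<phi>' x =
    oint lborel a x (\<lambda>s. p s * mixed_oint r m \<mu> a s (\<lambda>t. \<phi> t - \<phi>' t))"
proof -
  have "picard a d1 d2 \<phi> x - picard a d1 d2 \<phi>' x = oint lborel a x
      (\<lambda>s. p s * (d2 + mixed_oint r m \<mu> a s \<phi>) - p s * (d2 + mixed_oint r m \<mu> a s \<phi>'))"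
    unfolding picard_def using assms
    by (subst oint_diff[OF Borel_measure_lborel]) (auto intro!: lbb locally_bounded_borel_mixed_oint)
  also have "\<dots> = oint lborel a x (\<lambda>s. p s * mixed_oint r m \<mu> a s (\<lambda>t. \<phi> t - \<phi>' t))"
    using assms by (simp add: mixed_oint_diff algebra_simps)
  finally show ?thesis .
qed

text \<open>In the weighted norm the successive differences of the Picard iterates shrink by 1/2. As
  the rate of the weight adapts to the window, this holds on windows of any size, and the series
  converges on the whole line without gluing local solutions.\<close>

lemma vsol_exists: "\<exists>\<phi> \<psi>. vsol p r m \<mu> \<phi> \<psi> \<and> \<phi> a = d1 \<and> \<psi> a = d2"
proof -
  define f where "f n = (picard a d1 d2 ^^ n) (\<lambda>_. 0)" for n
  have fS: "f (Suc n) = picard a d1 d2 (f n)" for n by (simp add: f_def)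
  have lf: "locally_bounded_borel (f n)" for n
    by (induction n) (auto simp: fS locally_bounded_borel_picard, simp add: f_def lbb)
  define D where "D n x = f (Suc n) x - f n x" for n x
  have lD: "locally_bounded_borel (D n)" for n unfolding D_def[abs_def] by (intro lbb lf)
  have DS: "D (Suc n) x = oint lborel a x (\<lambda>s. p s * mixed_oint r m \<mu> a s (D n))" for n x
    unfolding D_def[of "Suc n"] fS[of "Suc n"] fS[of n]
    by (subst picard_diff) (auto simp: D_def[abs_def] fS lf locally_bounded_borel_picard)
  define \<phi> where "\<phi> x = (\<Sum>n. D n x)" for x
  \<comment> \<open>The constants depend on the window around \<open>a\<close>, the iterates do not;
    each local claim below may therefore choose its own \<open>R\<close>.\<close>
  have key: "\<exists>N P S L. 0 \<le> N \<and> 0 \<le> P \<and> (\<forall>t\<in>{a-R..a+R}. norm (p t) \<le> P) \<and> 0 \<le> S \<and> L = 2 * P * N + 1 \<and> 0 \<le> L \<and>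
      (\<forall>n. \<forall>x\<in>{a-R..a+R}. norm (D n x) \<le> S * (1/2)^n * exp (L * \<bar>x - a\<bar>)) \<and>
      (\<forall>x\<in>{a-R..a+R}. \<forall>y\<in>{a-R..a+R}. \<forall>\<phi> C. locally_bounded_borel \<phi> \<longrightarrow> 0 \<le> C \<longrightarrow>
        (\<forall>t. min x y \<le> t \<longrightarrow> t \<le> max x y \<longrightarrow> norm (\<phi> t) \<le> C) \<longrightarrow> norm (mixed_oint r m \<mu> x y \<phi>) \<le> N * C)"
    if R: "R \<ge> 0" for R
  proof -
    let ?I = "{a-R..a+R}"
    have aI: "a \<in> ?I" using R by auto
    obtain N P where NP: "0 \<le> N" "0 \<le> P" "\<And>t. t \<in> ?I \<Longrightarrow> norm (p t) \<le> P"
      "\<And>x y \<phi> C. locally_bounded_borel \<phi> \<Longrightarrow> x \<in> ?I \<Longrightarrow> y \<in> ?I \<Longrightarrow> 0 \<le> C \<Longrightarrow>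
      (\<And>t. min x y \<le> t \<Longrightarrow> t \<le> max x y \<Longrightarrow> norm (\<phi> t) \<le> C) \<Longrightarrow> norm (mixed_oint r m \<mu> x y \<phi>) \<le> N * C"
      using mixed_oint_bound by metis
    obtain S where S: "S > 0" "\<And>x. x \<in> ?I \<Longrightarrow> norm (D 0 x) \<le> S" using locally_bounded_borelE[OF lD] by metis
    define L where "L = 2 * P * N + 1"
    have L: "0 \<le> L" using NP by (simp add: L_def)
    have "norm (D n x) \<le> S * (1/2)^n * exp (L * \<bar>x - a\<bar>)" if "x \<in> ?I" for n x
      using that
    proof (induction n arbitrary: x)
      case 0
      have "norm (D 0 x) \<le> S * 1" using S(2)[OF 0] by simp
      also have "\<dots> \<le> S * exp (L * \<bar>x - a\<bar>)" using S(1) L by (intro mult_left_mono) auto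
      finally show ?case by simp
    next
      case (Suc n)
      have S0: "0 \<le> S * (1/2)^n" using S(1) by simp
      have "norm (mixed_oint r m \<mu> a t (D n)) \<le> N * (S * (1/2)^n * exp (L * \<bar>t - a\<bar>))" if "t \<in> ?I" for t
        by (rule mixed_oint_weighted_le[OF NP(4) lD aI that S0 L Suc.IH])
      from weighted_contraction[OF lbb(5) locally_bounded_borel_mixed_oint[OF lD] aI Suc.prems NP(3) NP(2,1) S0 this[unfolded L_def]]
      show ?case by (simp add: DS L_def)
    qed
    note D_le = this
    show ?thesis
    proof (intro exI conjI ballI allI impI)
      show "0 \<le> N" "0 \<le> P" "0 \<le> S" "L = 2 * P * N + 1" "0 \<le> L" using NP S(1) L L_def by auto
      show "norm (p t) \<le> P" if "t \<in> ?I" for t using NP(3)[OF that] .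
      show "norm (D n x) \<le> S * (1/2)^n * exp (L * \<bar>x - a\<bar>)" if "x \<in> ?I" for n x using D_le[OF that] .
      fix x y \<phi> C
      assume "x \<in> ?I" "y \<in> ?I" "locally_bounded_borel \<phi>" "0 \<le> C"
        "\<forall>t. min x y \<le> t \<longrightarrow> t \<le> max x y \<longrightarrow> norm (\<phi> t) \<le> C"
      then show "norm (mixed_oint r m \<mu> x y \<phi>) \<le> N * C" by (intro NP(4)) blast+
    qed
  qed
  have lim: "f n x = (\<Sum>k<n. D k x)" for n x
    unfolding D_def by (subst sum_lessThan_telescope) (simp add: f_def)
  \<comment> \<open>The factor 2 is the sum of the geometric series with ratio 1/2.\<close>
  have tail: "norm (\<phi> x - f n x) \<le> 2 * S * (1/2)^n * exp (L * \<bar>x - a\<bar>)"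
    if "\<And>n. norm (D n x) \<le> S * (1/2)^n * exp (L * \<bar>x - a\<bar>)" for S L x n
  proof -
    have sg: "summable (\<lambda>n. S * exp (L * \<bar>x - a\<bar>) * (1/2)^n)" by (intro summable_mult summable_geometric) simp
    have sD: "summable (\<lambda>n. D n x)"
      by (rule summable_comparison_test'[OF sg, of 0]) (use that in \<open>simp add: mult_ac\<close>)
    have "\<phi> x - f n x = (\<Sum>k. D (k + n) x)"
      unfolding \<phi>_def lim using suminf_split_initial_segment[OF sD, of n] by simp
    also have "norm \<dots> \<le> (\<Sum>k. S * exp (L * \<bar>x - a\<bar>) * (1/2)^n * (1/2)^k)"
    proof (rule norm_suminf_le)
      show "norm (D (k + n) x) \<le> S * exp (L * \<bar>x - a\<bar>) * (1/2)^n * (1/2)^k" for k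
        using that[of "k + n"] by (simp add: power_add mult_ac)
      show "summable (\<lambda>k. S * exp (L * \<bar>x - a\<bar>) * (1/2)^n * (1/2)^k)"
        by (intro summable_mult summable_geometric) simp
    qed
    also have "\<dots> = S * exp (L * \<bar>x - a\<bar>) * (1/2)^n * 2"
      by (subst suminf_mult) (auto simp: suminf_geometric intro!: summable_geometric)
    finally show ?thesis by (simp add: mult_ac)
  qed
  have conv: "(\<lambda>n. f n x) \<longlonglongrightarrow> \<phi> x" for x
  proof -
    have "x \<in> {a - \<bar>x - a\<bar>..a + \<bar>x - a\<bar>}" by (simp add: abs_if)
    then obtain S L where SL: "\<And>n. norm (D n x) \<le> S * (1/2)^n * exp (L * \<bar>x - a\<bar>)"
      using key[OF abs_ge_zero[of "x - a"]] by blast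
    have "(\<lambda>n. 2 * S * (1/2)^n * exp (L * \<bar>x - a\<bar>)) \<longlonglongrightarrow> 2 * S * 0 * exp (L * \<bar>x - a\<bar>)"
      by (intro tendsto_intros LIMSEQ_power_zero) simp
    then have "(\<lambda>n. 2 * S * (1/2)^n * exp (L * \<bar>x - a\<bar>)) \<longlonglongrightarrow> 0" by simp
    with tail[OF SL] have "(\<lambda>n. \<phi> x - f n x) \<longlonglongrightarrow> 0" by (rule LIMSEQ_null_norm_le)
    then have "(\<lambda>n. \<phi> x - (\<phi> x - f n x)) \<longlonglongrightarrow> \<phi> x - 0" by (intro tendsto_intros)
    then show ?thesis by simp
  qed
  have l\<phi>: "locally_bounded_borel \<phi>"
    unfolding locally_bounded_borel_def
  proof (intro conjI allI)
    show "\<phi> \<in> borel_measurable borel"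
      by (rule borel_measurable_LIMSEQ_metric[of f]) (use conv lf in auto)
    fix c d
    define R where "R = \<bar>c - a\<bar> + \<bar>d - a\<bar>"
    have R: "R \<ge> 0" "{c..d} \<subseteq> {a-R..a+R}" by (auto simp: R_def abs_if)
    obtain S L where SL: "\<forall>n. \<forall>x\<in>{a-R..a+R}. norm (D n x) \<le> S * (1/2)^n * exp (L * \<bar>x - a\<bar>)" "0 \<le> L" "0 \<le> S"
      using key[OF R(1)] by blast
    show "\<exists>C. \<forall>x\<in>{c..d}. norm (\<phi> x) \<le> C"
    proof (intro exI ballI)
      fix x assume "x \<in> {c..d}"
      then have x: "x \<in> {a-R..a+R}" using R by blast
      have "norm (\<phi> x - f 0 x) \<le> 2 * S * (1/2)^0 * exp (L * \<bar>x - a\<bar>)"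
        by (rule tail) (use SL x in auto)
      also have "\<dots> \<le> 2 * S * exp (L * R)"
        using SL x by (auto intro!: mult_left_mono)
      finally show "norm (\<phi> x) \<le> 2 * S * exp (L * R)" by (simp add: f_def)
    qed
  qed
  have fix_pt: "\<phi> x = picard a d1 d2 \<phi> x" for x
  proof -
    define R where "R = \<bar>x - a\<bar>"
    have R: "R \<ge> 0" "x \<in> {a-R..a+R}" "a \<in> {a-R..a+R}" by (auto simp: R_def abs_if)
    from key[OF R(1)] obtain N P S L where NPSL0: "0 \<le> N \<and> 0 \<le> P \<and> (\<forall>t\<in>{a-R..a+R}. norm (p t) \<le> P) \<and> 0 \<le> S \<and> L = 2 * P * N + 1 \<and> 0 \<le> L \<and>
      (\<forall>n. \<forall>x\<in>{a-R..a+R}. norm (D n x) \<le> S * (1/2)^n * exp (L * \<bar>x - a\<bar>)) \<and>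
      (\<forall>x\<in>{a-R..a+R}. \<forall>y\<in>{a-R..a+R}. \<forall>\<phi> C. locally_bounded_borel \<phi> \<longrightarrow> 0 \<le> C \<longrightarrow>
        (\<forall>t. min x y \<le> t \<longrightarrow> t \<le> max x y \<longrightarrow> norm (\<phi> t) \<le> C) \<longrightarrow> norm (mixed_oint r m \<mu> x y \<phi>) \<le> N * C)"
      by (elim exE)
    then have NPSL: "0 \<le> N" "0 \<le> P" "\<And>t. t \<in> {a-R..a+R} \<Longrightarrow> norm (p t) \<le> P" "0 \<le> S" "L = 2 * P * N + 1" "0 \<le> L"
      "\<And>n x. x \<in> {a-R..a+R} \<Longrightarrow> norm (D n x) \<le> S * (1/2)^n * exp (L * \<bar>x - a\<bar>)"
      by blast+
    have NPSL8: "norm (mixed_oint r m \<mu> x y \<phi>) \<le> N * C"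
      if "locally_bounded_borel \<phi>" "x\<in>{a-R..a+R}" "y\<in>{a-R..a+R}" "0 \<le> C"
        "\<And>t. min x y \<le> t \<Longrightarrow> t \<le> max x y \<Longrightarrow> norm (\<phi> t) \<le> C" for x y \<phi> C
      using NPSL0 that by blast
    \<comment> \<open>One application of the operator halves the tail estimate for \<phi> - f n, so
      the image of \<phi> has the same limit as the iterates.\<close>
    have "norm (picard a d1 d2 \<phi> x - f (Suc n) x) \<le> S * (1/2)^n * exp (L * \<bar>x - a\<bar>)" for n
    proof -
      have S0: "0 \<le> 2 * S * (1/2)^n" using NPSL by simp
      have lr: "locally_bounded_borel (\<lambda>t. \<phi> t - f n t)" by (intro lbb l\<phi> lf)
      have "norm (mixed_oint r m \<mu> a t (\<lambda>t. \<phi> t - f n t)) \<le> N * (2 * S * (1/2)^n * exp (L * \<bar>t - a\<bar>))" if "t \<in> {a-R..a+R}" for t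
        by (rule mixed_oint_weighted_le[OF NPSL8 lr R(3) that S0 NPSL(6) tail[OF NPSL(7)]])
      from weighted_contraction[OF lbb(5) locally_bounded_borel_mixed_oint[OF lr] R(3,2) NPSL(3) NPSL(2,1) S0 this[unfolded NPSL(5)]]
      show ?thesis unfolding fS by (subst picard_diff[OF l\<phi> lf]) (simp add: NPSL(5))
    qed
    moreover have "(\<lambda>n. S * (1/2)^n * exp (L * \<bar>x - a\<bar>)) \<longlonglongrightarrow> S * 0 * exp (L * \<bar>x - a\<bar>)"
      by (intro tendsto_intros LIMSEQ_power_zero) simp
    then have "(\<lambda>n. S * (1/2)^n * exp (L * \<bar>x - a\<bar>)) \<longlonglongrightarrow> 0" by simp
    ultimately have "(\<lambda>n. picard a d1 d2 \<phi> x - f (Suc n) x) \<longlonglongrightarrow> 0" by (rule LIMSEQ_null_norm_le)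
    moreover have "(\<lambda>n. picard a d1 d2 \<phi> x - f (Suc n) x) \<longlonglongrightarrow> picard a d1 d2 \<phi> x - \<phi> x"
      by (intro tendsto_intros LIMSEQ_Suc conv)
    ultimately show ?thesis using LIMSEQ_unique by fastforce
  qed
  define \<psi> where "\<psi> s = d2 + mixed_oint r m \<mu> a s \<phi>" for s
  have l\<psi>: "locally_bounded_borel \<psi>"
    unfolding \<psi>_def[abs_def] by (intro lbb locally_bounded_borel_mixed_oint l\<phi>)
  have "vsol p r m \<mu> \<phi> \<psi>"
    unfolding vsol_def
  proof (intro conjI allI l\<phi> l\<psi>)
    fix x y
    have "\<phi> y - \<phi> x = oint lborel a y (\<lambda>t. p t * \<psi> t) - oint lborel a x (\<lambda>t. p t * \<psi> t)"
      by (subst (1 2) fix_pt) (simp add: picard_def \<psi>_def)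
    also have "\<dots> = oint lborel x y (\<lambda>t. p t * \<psi> t)"
      using oint_trans[OF Borel_measure_lborel lbb(3)[OF lbb(5) l\<psi>], of a x y] by (simp add: algebra_simps)
    finally show "\<phi> y - \<phi> x = oint lborel x y (\<lambda>t. p t * \<psi> t)" .
    show "\<psi> y - \<psi> x = mixed_oint r m \<mu> x y \<phi>"
      using mixed_oint_trans[OF l\<phi>, of a x y] by (simp add: \<psi>_def algebra_simps)
  qed
  moreover have "\<phi> a = d1" by (subst fix_pt) (simp add: picard_def)
  moreover have "\<psi> a = d2" by (simp add: \<psi>_def)
  ultimately show ?thesis by blast
qed

end

section \<open>The weak formulation as a Volterra system\<close>

lemma pair_sigma_finite_lborel:
  assumes "Borel_measure M"
  shows "pair_sigma_finite M (lborel :: real measure)"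
  unfolding pair_sigma_finite_def using sigma_finite_Borel_measure[OF assms] sigma_finite_lborel by simp

text \<open>As \<open>k\<close> vanishes at \<open>B\<close>, its value at t is minus the integral
  of k' from t to \<open>B\<close>. Exchanging the order of integration over t < s gives the claim;
  the strict inequality matches the interval [A, s) in \<open>oint\<close>, so atoms are counted
  correctly.\<close>

lemma oint_by_parts:
  assumes M: "Borel_measure M" and F: "locally_bounded_borel F" and k: "indefinite_integral k k'"
    and kB: "k B = 0"
  shows "(LINT t|M. indicator {A..<B} t *\<^sub>R (F t * k t)) =
    - (LINT s|lborel. indicator {A..B} s *\<^sub>R (k' s * oint M A s F))"
proof -
  interpret pair_sigma_finite M "lborel :: real measure" by (rule pair_sigma_finite_lborel[OF M])
  have [measurable_cong, simp]: "sets M = sets borel" using Borel_measureD[OF M] by auto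
  note kD = indefinite_integralD[OF k]
  have [measurable]: "F \<in> borel_measurable borel" "k' \<in> borel_measurable borel"
    using F kD by measurable
  define H where "H t s = (indicator {A..<B} t *\<^sub>R F t) * (of_bool (t < s) *\<^sub>R (indicator {A..B} s *\<^sub>R k' s))" for t s
  have [measurable]: "case_prod H \<in> borel_measurable (M \<Otimes>\<^sub>M lborel)"
    unfolding H_def[abs_def] by measurable
  have ik: "integrable lborel (\<lambda>s. indicator {A..B} s *\<^sub>R k' s)"
    using kD(2)[of A B] by (simp add: set_integrable_def)
  have iks: "integrable lborel (\<lambda>s. of_bool (t < s) *\<^sub>R (indicator {A..B} s *\<^sub>R k' s))" for t
    by (rule Bochner_Integration.integrable_bound[OF ik]) auto
  obtain C where C: "C > 0" "\<And>x. x \<in> {A..B} \<Longrightarrow> norm (F x) \<le> C" using locally_bounded_borelE[OF F] by metis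
  have iH: "integrable (M \<Otimes>\<^sub>M lborel) (case_prod H)"
  proof (rule Fubini_integrable)
    have le: "(LINT s|lborel. norm (H t s)) \<le> C * (LINT s|lborel. norm (indicator {A..B} s *\<^sub>R k' s))" if "t \<in> {A..B}" for t
    proof -
      have "(LINT s|lborel. norm (H t s)) \<le> (LINT s|lborel. C * norm (indicator {A..B} s *\<^sub>R k' s))"
      proof (rule integral_mono)
        show "integrable lborel (\<lambda>s. norm (H t s))"
          unfolding H_def by (intro integrable_norm integrable_mult_right iks)
        show "integrable lborel (\<lambda>s. C * norm (indicator {A..B} s *\<^sub>R k' s))"
          by (intro integrable_mult_right integrable_norm ik)
        show "norm (H t s) \<le> C * norm (indicator {A..B} s *\<^sub>R k' s)" for s
          using C(1) C(2)[OF that] by (auto simp: H_def norm_mult indicator_def intro!: mult_right_mono)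
      qed
      then show ?thesis by simp
    qed
    show "integrable M (\<lambda>t. LINT s|lborel. norm (case_prod H (t, s)))"
    proof (rule integrable_bounded_support[OF M, where a=A and b=B])
      have "(\<lambda>t. LINT s|lborel. norm (case_prod H (t, s))) \<in> borel_measurable M" by measurable
      then show "(\<lambda>t. LINT s|lborel. norm (case_prod H (t, s))) \<in> borel_measurable borel"
        by (simp add: measurable_cong_sets[of M borel])
      show "norm (LINT s|lborel. norm (case_prod H (t, s))) \<le> C * (LINT s|lborel. norm (indicator {A..B} s *\<^sub>R k' s))"
        if "t \<in> {A..B}" for t using le[OF that] by (simp add: integral_nonneg_AE)
      show "(LINT s|lborel. norm (case_prod H (t, s))) = 0" if "t \<notin> {A..B}" for t
      proof -
        have "H t s = 0" for s using that by (auto simp: H_def indicator_def)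
        then show ?thesis by simp
      qed
    qed
    show "AE t in M. integrable lborel (\<lambda>s. case_prod H (t, s))"
      unfolding H_def case_prod_conv by (intro AE_I2 integrable_mult_right iks)
  qed measurable
  have "(LINT t|M. indicator {A..<B} t *\<^sub>R (F t * k t)) = (LINT t|M. - (LINT s|lborel. H t s))"
  proof (rule Bochner_Integration.integral_cong[OF refl])
    fix t
    show "indicator {A..<B} t *\<^sub>R (F t * k t) = - (LINT s|lborel. H t s)"
    proof (cases "t \<in> {A..<B}")
      case True
      have "k B - k t = (LINT s:{t..B}|lborel. k' s)" using True by (intro kD(3)) auto
      then have "k t = - (LINT s:{t..B}|lborel. k' s)" using kB by (metis diff_0 minus_minus)
      also have "(LINT s:{t..B}|lborel. k' s) = (LINT s|lborel. of_bool (t < s) *\<^sub>R (indicator {A..B} s *\<^sub>R k' s))"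
        unfolding set_lebesgue_integral_def
      proof (rule integral_cong_AE)
        show "AE s in lborel. indicator {t..B} s *\<^sub>R k' s = of_bool (t < s) *\<^sub>R (indicator {A..B} s *\<^sub>R k' s)"
          using AE_lborel_singleton[of t] by eventually_elim (use True in \<open>auto simp: indicator_def\<close>)
      qed measurable
      finally have "k t = - (LINT s|lborel. of_bool (t < s) *\<^sub>R (indicator {A..B} s *\<^sub>R k' s))" .
      moreover have "(LINT s|lborel. H t s) = F t * (LINT s|lborel. of_bool (t < s) *\<^sub>R (indicator {A..B} s *\<^sub>R k' s))"
        unfolding integral_mult_right_zero[symmetric] using True
        by (intro Bochner_Integration.integral_cong refl) (simp add: H_def)
      ultimately show ?thesis using True by simp
    qed (simp add: H_def)
  qed
  also have "\<dots> = - (LINT t|M. LINT s|lborel. H t s)" by simp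
  also have "(LINT t|M. LINT s|lborel. H t s) = (LINT s|lborel. LINT t|M. H t s)"
    using Fubini_integral[OF iH] by simp
  also have "(LINT s|lborel. LINT t|M. H t s) = (LINT s|lborel. indicator {A..B} s *\<^sub>R (k' s * oint M A s F))"
  proof (rule Bochner_Integration.integral_cong[OF refl])
    fix s
    show "(LINT t|M. H t s) = indicator {A..B} s *\<^sub>R (k' s * oint M A s F)"
    proof (cases "s \<in> {A..B}")
      case True
      then have "(LINT t|M. H t s) = (LINT t|M. k' s * (orient A s t *\<^sub>R F t))"
        by (intro Bochner_Integration.integral_cong refl) (auto simp: H_def orient_def indicator_def)
      then show ?thesis using True unfolding oint_def integral_mult_right_zero by simp
    qed (simp add: H_def)
  qed
  finally show ?thesis .
qed

text \<open>Moving the base point adds a constant to the primitive of \<open>F\<close>. Since k' has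
  integral 0 over [A, B], the constant has no effect and the base point may be arbitrary.\<close>

lemma oint_by_parts_compact:
  assumes M: "Borel_measure M" and F: "locally_bounded_borel F" and k: "indefinite_integral k k'"
    and supp: "\<And>t. t \<notin> {A<..<B} \<Longrightarrow> k t = 0"
  shows "(LINT t|M. F t * k t) = - (LINT s|lborel. indicator {A..B} s *\<^sub>R (k' s * oint M a s F))"
proof -
  note kD = indefinite_integralD[OF k]
  have [measurable]: "k' \<in> borel_measurable borel" using kD by measurable
  have ik: "integrable lborel (\<lambda>s. indicator {A..B} s *\<^sub>R k' s)"
    using kD(2)[of A B] by (simp add: set_integrable_def)
  have zero: "(LINT s|lborel. indicator {A..B} s *\<^sub>R k' s) = 0"
  proof (cases "A \<le> B")
    case True
    then show ?thesis using kD(3)[OF True] supp[of A] supp[of B] by (simp add: set_lebesgue_integral_def)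
  qed simp
  have l: "locally_bounded_borel (\<lambda>s. oint M A s F)" by (rule locally_bounded_borel_oint[OF M F])
  obtain C where C: "C > 0" "\<And>s. s \<in> {A..B} \<Longrightarrow> norm (oint M A s F) \<le> C" using locally_bounded_borelE[OF l] by metis
  have io: "integrable lborel (\<lambda>s. indicator {A..B} s *\<^sub>R (k' s * oint M A s F))"
  proof (rule Bochner_Integration.integrable_bound[OF integrable_mult_right[OF integrable_norm[OF ik], of C]])
    show "(\<lambda>s. indicator {A..B} s *\<^sub>R (k' s * oint M A s F)) \<in> borel_measurable lborel" using l by measurable
    show "AE s in lborel. norm (indicator {A..B} s *\<^sub>R (k' s * oint M A s F)) \<le> norm (C * norm (indicator {A..B} s *\<^sub>R k' s))"
      using C by (intro AE_I2) (auto simp: indicator_def norm_mult mult.commute[of C] intro!: mult_left_mono)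
  qed
  have "(LINT t|M. F t * k t) = (LINT t|M. indicator {A..<B} t *\<^sub>R (F t * k t))"
    using supp by (intro Bochner_Integration.integral_cong refl) (auto simp: indicator_def)
  also have "\<dots> = - (LINT s|lborel. indicator {A..B} s *\<^sub>R (k' s * oint M A s F))"
    by (rule oint_by_parts[OF M F k]) (use supp in auto)
  also have "(LINT s|lborel. indicator {A..B} s *\<^sub>R (k' s * oint M A s F)) =
      (LINT s|lborel. oint M a A F * (indicator {A..B} s *\<^sub>R k' s) + indicator {A..B} s *\<^sub>R (k' s * oint M A s F))"
    by (simp only: Bochner_Integration.integral_add[OF integrable_mult_right[OF ik] io] integral_mult_right_zero zero mult_zero_right add_0)
  also have "\<dots> = (LINT s|lborel. indicator {A..B} s *\<^sub>R (k' s * oint M a s F))"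
  proof (intro Bochner_Integration.integral_cong refl)
    fix s
    have "oint M a s F = oint M a A F + oint M A s F" by (rule oint_trans[OF M F, symmetric])
    then show "oint M a A F * (indicator {A..B} s *\<^sub>R k' s) + indicator {A..B} s *\<^sub>R (k' s * oint M A s F) =
        indicator {A..B} s *\<^sub>R (k' s * oint M a s F)"
      by (simp add: algebra_simps)
  qed
  finally show ?thesis .
qed

text \<open>The bridge from integrands with \<open>vderiv\<close> to Borel integrands; the original
  integrand is measurable because the measure is complete.\<close>

lemma integral_lebesgue_cong:
  fixes G :: "real \<Rightarrow> complex"
  assumes "G' \<in> borel_measurable borel" "AE x in lebesgue. G x = G' x"
  shows "integral\<^sup>L lebesgue G = integral\<^sup>L lborel G'"
proof -
  have [measurable]: "G' \<in> borel_measurable lebesgue" using assms(1) by (simp add: measurable_completion)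
  have "AE x in lebesgue. G' x = G x" using assms(2) by eventually_elim simp
  then have "G \<in> borel_measurable lebesgue" by (rule borel_measurable_AE[rotated]) measurable
  then have "integral\<^sup>L lebesgue G = integral\<^sup>L lebesgue G'"
    using assms(2) by (intro integral_cong_AE) auto
  also have "\<dots> = integral\<^sup>L lborel G'" using assms(1) by (intro integral_completion) auto
  finally show ?thesis .
qed

section \<open>Locally square integrable functions and compactly supported test functions\<close>

lemma locally_square_integrable_measurable [measurable_dest]:
  "locally_square_integrable g \<Longrightarrow> g \<in> borel_measurable borel"
  by (simp add: locally_square_integrable_def)

lemma locally_square_integrable_prod:
  fixes f g :: "real \<Rightarrow> complex"
  assumes "locally_square_integrable f" "locally_square_integrable g"
  shows "set_integrable lborel {a..b} (\<lambda>x. f x * g x)"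
  unfolding set_integrable_def
proof (rule Bochner_Integration.integrable_bound)
  show "integrable lborel (\<lambda>x. indicator {a..b} x *\<^sub>R (norm (f x))\<^sup>2 + indicator {a..b} x *\<^sub>R (norm (g x))\<^sup>2)"
    using assms unfolding locally_square_integrable_def set_integrable_def
    by (intro Bochner_Integration.integrable_add) auto
  show "(\<lambda>x. indicator {a..b} x *\<^sub>R (f x * g x)) \<in> borel_measurable lborel"
    using assms by measurable
  have "norm (f x) * norm (g x) \<le> (norm (f x))\<^sup>2 + (norm (g x))\<^sup>2" for x
  proof -
    have "0 \<le> norm (f x) * norm (g x)" by simp
    then show ?thesis using sum_squares_bound[of "norm (f x)" "norm (g x)"] by linarith
  qed
  then show "AE x in lborel. norm (indicator {a..b} x *\<^sub>R (f x * g x))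
      \<le> norm (indicator {a..b} x *\<^sub>R (norm (f x))\<^sup>2 + indicator {a..b} x *\<^sub>R (norm (g x))\<^sup>2)"
    by (intro AE_I2) (auto simp: indicator_def norm_mult)
qed

lemma locally_square_integrable_add:
  fixes f g :: "real \<Rightarrow> complex"
  assumes "locally_square_integrable f" "locally_square_integrable g"
  shows "locally_square_integrable (\<lambda>x. f x + g x)"
  unfolding locally_square_integrable_def
proof (intro conjI allI)
  show "(\<lambda>x. f x + g x) \<in> borel_measurable borel" using assms by measurable
  fix a b
  show "set_integrable lborel {a..b} (\<lambda>x. (norm (f x + g x))\<^sup>2)"
    unfolding set_integrable_def
  proof (rule Bochner_Integration.integrable_bound)
    show "integrable lborel (\<lambda>x. 2 * (indicator {a..b} x *\<^sub>R (norm (f x))\<^sup>2 + indicator {a..b} x *\<^sub>R (norm (g x))\<^sup>2))"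
      using assms unfolding locally_square_integrable_def set_integrable_def
      by (intro integrable_mult_right Bochner_Integration.integrable_add) auto
    show "(\<lambda>x. indicator {a..b} x *\<^sub>R (norm (f x + g x))\<^sup>2) \<in> borel_measurable lborel"
      using assms by measurable
    have "(norm (f x + g x))\<^sup>2 \<le> 2 * ((norm (f x))\<^sup>2 + (norm (g x))\<^sup>2)" for x
    proof -
      have "(norm (f x + g x))\<^sup>2 \<le> (norm (f x) + norm (g x))\<^sup>2"
        by (intro power_mono norm_triangle_ineq) auto
      also have "\<dots> \<le> 2 * ((norm (f x))\<^sup>2 + (norm (g x))\<^sup>2)"
        using sum_squares_bound[of "norm (f x)" "norm (g x)"] by (simp add: power2_sum)
      finally show ?thesis .
    qed
    then show "AE x in lborel. norm (indicator {a..b} x *\<^sub>R (norm (f x + g x))\<^sup>2)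
      \<le> norm (2 * (indicator {a..b} x *\<^sub>R (norm (f x))\<^sup>2 + indicator {a..b} x *\<^sub>R (norm (g x))\<^sup>2))"
      by (intro AE_I2) (auto simp: indicator_def)
  qed
qed

lemma locally_square_integrable_mult:
  fixes f g :: "real \<Rightarrow> complex"
  assumes "locally_bounded_borel f" "locally_square_integrable g"
  shows "locally_square_integrable (\<lambda>x. f x * g x)"
  unfolding locally_square_integrable_def
proof (intro conjI allI)
  show "(\<lambda>x. f x * g x) \<in> borel_measurable borel" using assms by measurable
  fix a b
  obtain C where C: "C > 0" "\<And>x. x \<in> {a..b} \<Longrightarrow> norm (f x) \<le> C" using locally_bounded_borelE[OF assms(1)] by metis
  show "set_integrable lborel {a..b} (\<lambda>x. (norm (f x * g x))\<^sup>2)"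
    unfolding set_integrable_def
  proof (rule Bochner_Integration.integrable_bound)
    show "integrable lborel (\<lambda>x. C\<^sup>2 * (indicator {a..b} x *\<^sub>R (norm (g x))\<^sup>2))"
      using assms unfolding locally_square_integrable_def set_integrable_def
      by (intro integrable_mult_right) auto
    show "(\<lambda>x. indicator {a..b} x *\<^sub>R (norm (f x * g x))\<^sup>2) \<in> borel_measurable lborel"
      using assms by measurable
    show "AE x in lborel. norm (indicator {a..b} x *\<^sub>R (norm (f x * g x))\<^sup>2)
      \<le> norm (C\<^sup>2 * (indicator {a..b} x *\<^sub>R (norm (g x))\<^sup>2))"
      using C by (intro AE_I2) (auto simp: indicator_def norm_mult power_mult_distrib intro!: mult_right_mono power_mono)
  qed
qed

lemma locally_square_integrable_bounded:
  assumes "locally_bounded_borel f"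
  shows "locally_square_integrable f"
proof -
  have "set_integrable lborel {a..b} (\<lambda>x. (norm (1 :: complex))\<^sup>2)" for a b :: real
    unfolding set_integrable_def using Borel_measureD(3)[OF Borel_measure_lborel, of a b]
    by (intro integrable_scaleR_left) (auto simp: integrable_indicator_iff)
  then have "locally_square_integrable (\<lambda>x::real. 1 :: complex)"
    by (auto simp: locally_square_integrable_def)
  from locally_square_integrable_mult[OF assms this] show ?thesis by simp
qed

lemma locally_square_integrable_of_real:
  "locally_square_integrable u' \<Longrightarrow> locally_square_integrable (\<lambda>x. complex_of_real (u' x))"
  by (auto simp: locally_square_integrable_def)

lemma H1_cE:
  assumes "h \<in> H1_c"
  obtains h' R where "ae_derivative h h'" "locally_square_integrable h'" "locally_absolutely_continuous h"
    "indefinite_integral h h'" "0 < R" "\<And>x. R \<le> \<bar>x\<bar> \<Longrightarrow> h x = 0"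
proof -
  have h: "h \<in> H1_loc" "compact (closure {x. h x \<noteq> 0})" using assms by (auto simp: H1_c_def compact_support_def)
  obtain h' where h': "ae_derivative h h'" using H1_loc_ae_derivative[OF h(1)] by blast
  then have l: "locally_absolutely_continuous h" "locally_square_integrable h'"
    using H1_loc_iff[OF h'] h by auto
  obtain R where R: "\<And>x. x \<in> closure {x. h x \<noteq> 0} \<Longrightarrow> norm x \<le> R"
    using compact_imp_bounded[OF h(2)] by (auto simp: bounded_iff)
  show ?thesis
  proof (rule that[OF h' l(2,1)])
    show "indefinite_integral h h'"
      using h' l by (intro locally_absolutely_continuous_indefinite_integral) (auto simp: ae_derivative_def)
    show "0 < \<bar>R\<bar> + 1" by simp
    show "h x = 0" if "\<bar>R\<bar> + 1 \<le> \<bar>x\<bar>" for x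
    proof (rule ccontr)
      assume "h x \<noteq> 0"
      then have "norm x \<le> R" by (intro R subsetD[OF closure_subset]) simp
      then show False using that by simp
    qed
  qed
qed

lemma H1_cI:
  assumes "h \<in> H1_loc" "\<And>x. R \<le> \<bar>x\<bar> \<Longrightarrow> h x = 0"
  shows "h \<in> H1_c"
proof -
  have "{x. h x \<noteq> 0} \<subseteq> cball 0 R"
    using assms(2) by (auto simp: dist_norm) (meson le_cases)
  then have "bounded (closure {x. h x \<noteq> 0})"
    by (meson bounded_cball bounded_closure bounded_subset)
  then show ?thesis using assms(1) by (simp add: H1_c_def compact_support_def compact_eq_bounded_closed)
qed

lemma exp_double_cancel:
  fixes w a b :: complex
  shows "exp (2 * w) * ((exp (- w) * a) * (exp (- w) * b)) = a * b"
  proof -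
  have "exp (2 * w) = exp w * exp w" by (metis exp_add mult_2)
  then show ?thesis by (simp add: exp_minus field_simps)
qed

text \<open>All three coefficients depend on x only through \<open>u x\<close>, and jointly
  continuously on z and this value. Hence uniform convergence of u_k and convergence of z_k carry
  over to the coefficients.\<close>

definition pcoef :: "(real \<Rightarrow> real) \<Rightarrow> complex \<Rightarrow> real \<Rightarrow> complex" where
  "pcoef u z x = exp (- 2 * z * of_real (u x))"

definition rcoef :: "(real \<Rightarrow> real) \<Rightarrow> complex \<Rightarrow> real \<Rightarrow> complex" where
  "rcoef u z x = (1/4 - z * of_real (u x) + z\<^sup>2 * (of_real (u x))\<^sup>2) * exp (2 * z * of_real (u x))"

definition mcoef :: "(real \<Rightarrow> real) \<Rightarrow> complex \<Rightarrow> real \<Rightarrow> complex" where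
  "mcoef u z x = - z\<^sup>2 * exp (2 * z * of_real (u x))"

locale string_data =
  fixes u u' :: "real \<Rightarrow> real" and \<mu> :: "real measure"
  assumes uH: "u \<in> H1_loc" and u': "ae_derivative u u'" and Borel_\<mu>: "Borel_measure \<mu>"
    and energy_le: "\<And>B. B \<in> sets borel \<Longrightarrow>
        (\<integral>\<^sup>+x\<in>B. ennreal ((u x)\<^sup>2 + (vderiv u x)\<^sup>2) \<partial>lebesgue) \<le> emeasure \<mu> B"
begin

lemma u_lac: "locally_absolutely_continuous u" and u'_lsi: "locally_square_integrable u'"
  using uH H1_loc_iff[OF u'] by auto

lemma u_cont: "continuous_on S u"
  by (rule continuous_on_locally_absolutely_continuous[OF u_lac])

lemma volterra: "volterra (pcoef u z) (rcoef u z) (mcoef u z) \<mu>"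
  by unfold_locales
    (auto simp: pcoef_def[abs_def] rcoef_def[abs_def] mcoef_def[abs_def] intro!: Borel_\<mu> continuous_intros u_cont)

lemma exp_scale_cont: "continuous_on UNIV (\<lambda>x. exp (c * complex_of_real (u x)))"
  by (intro continuous_intros u_cont)

text \<open>Used with c = -z to strip the exponential factor and with c = z to restore it. For c =
  -z the bracket in the derivative is the expression that defines the quasi-derivative.\<close>

lemma exp_scale_mult:
  fixes f f' :: "real \<Rightarrow> complex" and c :: complex
  assumes "locally_absolutely_continuous f" "ae_derivative f f'" "locally_square_integrable f'"
  defines "g \<equiv> \<lambda>x. exp (c * complex_of_real (u x)) * f x"
    and "g' \<equiv> \<lambda>x. exp (c * complex_of_real (u x)) * (f' x + c * of_real (u' x) * f x)"
  shows "locally_absolutely_continuous g" "ae_derivative g g'" "locally_square_integrable g'" "g \<in> H1_loc"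
proof -
  have f: "continuous_on UNIV f" by (rule continuous_on_locally_absolutely_continuous[OF assms(1)])
  show lac: "locally_absolutely_continuous g"
    unfolding g_def
    by (intro locally_absolutely_continuous_mult locally_absolutely_continuous_exp
        locally_absolutely_continuous_scale u_lac assms)
  have "ae_derivative g (\<lambda>x. exp (c * of_real (u x)) * f' x + c * of_real (u' x) * exp (c * of_real (u x)) * f x)"
    unfolding g_def
    by (rule ae_derivative_mult[OF ae_derivative_exp_scale[OF u' u_cont] assms(2) exp_scale_cont f])
  also have "(\<lambda>x. exp (c * of_real (u x)) * f' x + c * of_real (u' x) * exp (c * of_real (u x)) * f x) = g'"
    unfolding g'_def by (auto simp: algebra_simps)
  finally show ae: "ae_derivative g g'" .
  have "locally_square_integrable (\<lambda>x. exp (c * complex_of_real (u x)) * (f' x + (c * f x) * of_real (u' x)))"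
    by (intro locally_square_integrable_mult locally_square_integrable_add assms
        locally_square_integrable_of_real u'_lsi locally_bounded_borel_continuous continuous_intros u_cont f)
  also have "(\<lambda>x. exp (c * complex_of_real (u x)) * (f' x + (c * f x) * of_real (u' x))) = g'"
    unfolding g'_def by (auto simp: mult_ac)
  finally show lsi: "locally_square_integrable g'" .
  show "g \<in> H1_loc" using H1_loc_iff[OF ae] lac lsi by simp
qed

text \<open>Substituting \<open>f = exp (z u) \<phi>\<close> and \<open>h = exp (z u) k\<close> removes the derivative of \<open>u\<close> from
  the weak formulation: the terms with \<open>u'\<close> complete a square, whose remainder is
  absorbed by the passage from \<open>\<upsilon>\<close> to \<open>\<mu>\<close>.\<close>

lemma weak_form_identity:
  fixes f f' h h' :: "real \<Rightarrow> complex" and z :: complex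
  assumes f: "locally_absolutely_continuous f" "ae_derivative f f'" "locally_square_integrable f'"
    and h: "locally_absolutely_continuous h" "ae_derivative h h'" "locally_square_integrable h'"
    and R0: "\<forall>x. R \<le> \<bar>x\<bar> \<longrightarrow> h x = 0"
  defines "\<phi> \<equiv> \<lambda>x. exp (- z * complex_of_real (u x)) * f x"
    and "k \<equiv> \<lambda>x. exp (- z * complex_of_real (u x)) * h x"
    and "\<phi>' \<equiv> \<lambda>x. exp (- z * complex_of_real (u x)) * (f' x + - z * of_real (u' x) * f x)"
    and "k' \<equiv> \<lambda>x. exp (- z * complex_of_real (u x)) * (h' x + - z * of_real (u' x) * h x)"
  shows "((LINT x|lebesgue. vderiv f x * vderiv h x) + 1/4 * (LINT x|lebesgue. f x * h x)
        = z * omega u (\<lambda>x. f x * h x) + z\<^sup>2 * (LINT x|upsilon u \<mu>. f x * h x)) \<longleftrightarrow>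
      (LINT s|lborel. indicator {-R..R} s *\<^sub>R (k' s * (exp (2 * z * of_real (u s)) * \<phi>' s - mixed_oint (rcoef u z) (mcoef u z) \<mu> 0 s \<phi>))) = 0"
proof -
  interpret V: volterra "pcoef u z" "rcoef u z" "mcoef u z" \<mu> by (rule volterra)
  note R = R0[rule_format]
  have cf: "continuous_on UNIV f" and ch: "continuous_on UNIV h"
    using f h continuous_on_locally_absolutely_continuous by auto
  have [measurable]: "f \<in> borel_measurable borel" "h \<in> borel_measurable borel"
    "f' \<in> borel_measurable borel" "h' \<in> borel_measurable borel" "u \<in> borel_measurable borel" "u' \<in> borel_measurable borel"
    using cf ch u_cont f h u' by (auto simp: ae_derivative_def borel_measurable_continuous_onI)
  have lf: "locally_bounded_borel f" and lh: "locally_bounded_borel h" and lu: "locally_bounded_borel (\<lambda>x. of_real (u x))"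
    using cf ch by (auto intro!: locally_bounded_borel_continuous continuous_intros u_cont)
  note sif = locally_square_integrable_bounded[OF lf] and sih = locally_square_integrable_bounded[OF lh]
  note siu' = locally_square_integrable_of_real[OF u'_lsi]
  \<comment> \<open>\<open>h\<close> vanishes on the open set where |x| exceeds \<open>R\<close>,
    and so does its derivative; every integral containing \<open>h\<close> can then be cut to
    [-R, R].\<close>
  have "AE x in lborel. (h has_vector_derivative h' x) (at x)" using h(2) by (simp add: ae_derivative_def)
  then have h'0: "AE x in lborel. R < \<bar>x\<bar> \<longrightarrow> h' x = 0"
  proof eventually_elim
    fix x assume hd: "(h has_vector_derivative h' x) (at x)"
    show "R < \<bar>x\<bar> \<longrightarrow> h' x = 0"
    proof
      assume "R < \<bar>x\<bar>"
      have "((\<lambda>_. 0) has_vector_derivative h' x) (at x)"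
      proof (rule has_vector_derivative_transform_within_open[OF hd])
        show "open {x. R < \<bar>x\<bar>}" by (intro open_Collect_less continuous_intros)
      qed (use \<open>R < \<bar>x\<bar>\<close> R in auto)
      moreover have "((\<lambda>_. 0) has_vector_derivative 0) (at x)" by (rule has_vector_derivative_const)
      ultimately show "h' x = 0" by (rule vector_derivative_unique_at)
    qed
  qed
  define I where "I x = (indicator {-R..R} x :: real)" for x
  have [measurable]: "I \<in> borel_measurable borel" unfolding I_def[abs_def] by measurable
  have cut: "integral\<^sup>L lebesgue G = (LINT x|lborel. I x *\<^sub>R G' x)"
    if [measurable]: "G' \<in> borel_measurable borel" and "AE x in lebesgue. G x = G' x"
      and 0: "AE x in lborel. R < \<bar>x\<bar> \<longrightarrow> G' x = 0" for G G' :: "real \<Rightarrow> complex"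
  proof (rule integral_lebesgue_cong)
    have "AE x in lebesgue. R < \<bar>x\<bar> \<longrightarrow> G' x = 0" using 0 by (rule AE_completion)
    then show "AE x in lebesgue. G x = I x *\<^sub>R G' x"
      using that(2) by eventually_elim (auto simp: I_def indicator_def abs_le_iff)
  qed measurable
  have df: "AE x in lebesgue. vderiv f x = f' x" and dh: "AE x in lebesgue. vderiv h x = h' x"
    and du: "AE x in lebesgue. vderiv u x = u' x"
    using ae_derivative_AE_vderiv f h u' by auto
  have dfh: "AE x in lebesgue. vderiv (\<lambda>x. f x * h x) x = f x * h' x + f' x * h x"
    using ae_derivative_AE_vderiv[OF ae_derivative_mult[OF f(2) h(2) cf ch]] .
  have t1: "(LINT x|lebesgue. vderiv f x * vderiv h x) = (LINT x|lborel. I x *\<^sub>R (f' x * h' x))"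
  proof (rule cut)
    show "AE x in lebesgue. vderiv f x * vderiv h x = f' x * h' x"
      using df dh by eventually_elim simp
    show "AE x in lborel. R < \<bar>x\<bar> \<longrightarrow> f' x * h' x = 0" using h'0 by eventually_elim simp
  qed measurable
  have t2: "(LINT x|lebesgue. f x * h x) = (LINT x|lborel. I x *\<^sub>R (f x * h x))"
    by (rule cut) (use R in auto)
  have t3: "(LINT x|lebesgue. of_real (u x) * (f x * h x)) = (LINT x|lborel. I x *\<^sub>R (of_real (u x) * (f x * h x)))"
    by (rule cut) (use R in auto)
  have t4: "(LINT x|lebesgue. of_real (vderiv u x) * vderiv (\<lambda>x. f x * h x) x) =
      (LINT x|lborel. I x *\<^sub>R (of_real (u' x) * (f x * h' x + f' x * h x)))"
  proof (rule cut)
    show "AE x in lebesgue. of_real (vderiv u x) * vderiv (\<lambda>x. f x * h x) x = of_real (u' x) * (f x * h' x + f' x * h x)"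
      using dfh du by eventually_elim simp
    show "AE x in lborel. R < \<bar>x\<bar> \<longrightarrow> of_real (u' x) * (f x * h' x + f' x * h x) = 0"
      using h'0 by eventually_elim (simp add: R)
  qed measurable
  have ifh: "integrable \<mu> (\<lambda>x. f x * h x)"
  proof -
    obtain C where "\<And>x. x \<in> {-R..R} \<Longrightarrow> norm (f x * h x) \<le> C"
      using locally_bounded_borelE[OF locally_bounded_borel_mult[OF lf lh]] by metis
    then show ?thesis
      by (rule integrable_bounded_support[OF Borel_\<mu>, rotated]) (auto simp: abs_le_iff not_le intro!: R)
  qed
  have fhm: "(\<lambda>x. f x * h x) \<in> borel_measurable borel" by measurable
  have t5: "(LINT x|upsilon u \<mu>. f x * h x) = (LINT x|\<mu>. f x * h x) -
      (LINT x|lborel. I x *\<^sub>R (((of_real (u x))\<^sup>2 + (of_real (u' x))\<^sup>2) * (f x * h x)))"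
  proof -
    have "(LINT x|upsilon u \<mu>. f x * h x) = (LINT x|\<mu>. f x * h x) -
        (LINT x|lborel. ((u x)\<^sup>2 + (u' x)\<^sup>2) *\<^sub>R (f x * h x))"
      by (rule upsilon_integral(1)[OF Borel_\<mu> u_cont u' energy_le fhm ifh])
    also have "(LINT x|lborel. ((u x)\<^sup>2 + (u' x)\<^sup>2) *\<^sub>R (f x * h x)) =
        (LINT x|lborel. I x *\<^sub>R (((of_real (u x))\<^sup>2 + (of_real (u' x))\<^sup>2) * (f x * h x)))"
    proof (intro Bochner_Integration.integral_cong refl)
      fix x
      have "h x = 0" if "x \<notin> {-R..R}" using R[of x] that by (auto simp: abs_if split: if_splits)
      then show "((u x)\<^sup>2 + (u' x)\<^sup>2) *\<^sub>R (f x * h x) =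
          I x *\<^sub>R (((of_real (u x))\<^sup>2 + (of_real (u' x))\<^sup>2) * (f x * h x))"
        by (cases "x \<in> {-R..R}") (auto simp: I_def scaleR_conv_of_real)
    qed
    finally show ?thesis .
  qed
  have int: "integrable lborel (\<lambda>x. I x *\<^sub>R (a x * b x))"
    if "locally_square_integrable a" "locally_square_integrable b" for a b :: "real \<Rightarrow> complex"
    using locally_square_integrable_prod[OF that, of "-R" R] by (simp add: set_integrable_def I_def)
  let ?E = "\<lambda>x. exp (2 * z * complex_of_real (u x))"
  have i1: "integrable lborel (\<lambda>x. I x *\<^sub>R (f' x * h' x))" by (rule int[OF f(3) h(3)])
  have i2: "integrable lborel (\<lambda>x. I x *\<^sub>R (f x * h x))" by (rule int[OF sif sih])
  have i3: "integrable lborel (\<lambda>x. I x *\<^sub>R (of_real (u x) * (f x * h x)))"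
    using int[OF locally_square_integrable_mult[OF lu sif] sih] by (simp add: mult.assoc)
  have i4: "integrable lborel (\<lambda>x. I x *\<^sub>R (of_real (u' x) * (f x * h' x + f' x * h x)))"
  proof (rule int[OF siu'])
    show "locally_square_integrable (\<lambda>x. f x * h' x + f' x * h x)"
      using locally_square_integrable_add[OF locally_square_integrable_mult[OF lf h(3)] locally_square_integrable_mult[OF lh f(3)]]
      by (simp add: mult.commute)
  qed
  have i5: "integrable lborel (\<lambda>x. I x *\<^sub>R (((of_real (u x))\<^sup>2 + (of_real (u' x))\<^sup>2) * (f x * h x)))"
  proof -
    have "integrable lborel (\<lambda>x. I x *\<^sub>R ((of_real (u x) * f x) * (of_real (u x) * h x)) + I x *\<^sub>R ((f x * of_real (u' x)) * (h x * of_real (u' x))))"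
      by (intro Bochner_Integration.integrable_add int locally_square_integrable_mult lu lf lh sif sih siu')
    then show ?thesis by (simp add: algebra_simps power2_eq_square)
  qed
  have cancel: "?E x * (exp (- z * of_real (u x)) * a * (exp (- z * of_real (u x)) * b)) = a * b" for x a b
    using exp_double_cancel[of "z * of_real (u x)" a b] by (simp add: mult.assoc)
  have im: "(LINT x|\<mu>. mcoef u z x * \<phi> x * k x) = - z\<^sup>2 * (LINT x|\<mu>. f x * h x)"
  proof -
    have "mcoef u z x * \<phi> x * k x = - z\<^sup>2 * (f x * h x)" for x
      using cancel[of x "f x" "h x"] by (simp add: mcoef_def \<phi>_def k_def mult.assoc)
    then show ?thesis by simp
  qed
  \<comment> \<open>The terms \<open>f' h' - z u' (f h)' + z^2 u'^2 f h\<close> factor as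
    \<open>(f' - z u' f) (h' - z u' h)\<close>. The term with \<open>u'^2\<close> stems from
    \<open>upsilon\<close>, and the terms free of derivatives make up \<open>rcoef\<close>.\<close>
  have ptw: "f' x * h' x + 1/4 * (f x * h x) - z * (of_real (u x) * (f x * h x))
      - z * (of_real (u' x) * (f x * h' x + f' x * h x))
      + z\<^sup>2 * (((of_real (u x))\<^sup>2 + (of_real (u' x))\<^sup>2) * (f x * h x))
      = k' x * (?E x * \<phi>' x) + rcoef u z x * \<phi> x * k x" for x
  proof -
    have "k' x * (?E x * \<phi>' x) = (f' x + - z * of_real (u' x) * f x) * (h' x + - z * of_real (u' x) * h x)"
      using cancel[of x "f' x + - z * of_real (u' x) * f x" "h' x + - z * of_real (u' x) * h x"]
      unfolding k'_def \<phi>'_def by (simp only: mult_ac)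
    moreover have "rcoef u z x * \<phi> x * k x = (1/4 - z * of_real (u x) + z\<^sup>2 * (of_real (u x))\<^sup>2) * (f x * h x)"
      using arg_cong[OF cancel[of x "f x" "h x"], of "\<lambda>w. (1/4 - z * of_real (u x) + z\<^sup>2 * (of_real (u x))\<^sup>2) * w"]
      unfolding rcoef_def \<phi>_def k_def by (simp only: mult_ac)
    ultimately show ?thesis by (simp add: algebra_simps power2_eq_square)
  qed
  note ek = exp_scale_mult[OF h, of "- z"] and ef = exp_scale_mult[OF f, of "- z"]
  have k: "locally_absolutely_continuous k" "ae_derivative k k'" "locally_square_integrable k'"
    using ek unfolding k_def k'_def by auto
  have \<phi>: "locally_absolutely_continuous \<phi>" "locally_square_integrable \<phi>'"
    using ef unfolding \<phi>_def \<phi>'_def by auto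
  have l\<phi>: "locally_bounded_borel \<phi>"
    by (intro locally_bounded_borel_continuous continuous_on_locally_absolutely_continuous \<phi>)
  have lk: "locally_bounded_borel k"
    by (intro locally_bounded_borel_continuous continuous_on_locally_absolutely_continuous k)
  have kI: "indefinite_integral k k'"
    using k by (intro locally_absolutely_continuous_indefinite_integral) (auto simp: ae_derivative_def)
  have k0: "k t = 0" if "t \<notin> {-R<..<R}" for t using R[of t] that by (auto simp: k_def abs_le_iff not_less)
  have lr: "locally_bounded_borel (\<lambda>t. rcoef u z t * \<phi> t)" and lm: "locally_bounded_borel (\<lambda>t. mcoef u z t * \<phi> t)"
    by (intro V.lbb l\<phi>)+
  let ?O1 = "\<lambda>s. oint lborel 0 s (\<lambda>t. rcoef u z t * \<phi> t)" and ?O2 = "\<lambda>s. oint \<mu> 0 s (\<lambda>t. mcoef u z t * \<phi> t)"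
  have lO: "locally_bounded_borel ?O1" "locally_bounded_borel ?O2"
    by (intro locally_bounded_borel_oint Borel_measure_lborel Borel_\<mu> lr lm)+
  have j1: "integrable lborel (\<lambda>x. I x *\<^sub>R (k' x * (?E x * \<phi>' x)))"
    by (intro int k locally_square_integrable_mult \<phi> locally_bounded_borel_continuous exp_scale_cont[of "2 * z"])
  have j2: "integrable lborel (\<lambda>x. I x *\<^sub>R (rcoef u z x * \<phi> x * k x))"
    by (intro int locally_square_integrable_bounded lr lk)
  have j3: "integrable lborel (\<lambda>x. I x *\<^sub>R (k' x * ?O1 x))" "integrable lborel (\<lambda>x. I x *\<^sub>R (k' x * ?O2 x))"
    by (intro int locally_square_integrable_bounded lO k)+
  \<comment> \<open>Integration by parts turns both terms that contain \<open>k\<close> into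
    primitives paired with k', so that in the end everything is tested against k' alone.\<close>
  have p1: "(LINT x|lborel. I x *\<^sub>R (rcoef u z x * \<phi> x * k x)) = - (LINT s|lborel. I s *\<^sub>R (k' s * ?O1 s))"
  proof -
    have "(LINT x|lborel. I x *\<^sub>R (rcoef u z x * \<phi> x * k x)) = (LINT x|lborel. rcoef u z x * \<phi> x * k x)"
      using k0 by (intro Bochner_Integration.integral_cong refl) (auto simp: I_def indicator_def)
    also have "\<dots> = - (LINT s|lborel. I s *\<^sub>R (k' s * ?O1 s))"
      unfolding I_def by (rule oint_by_parts_compact[OF Borel_measure_lborel lr kI k0])
    finally show ?thesis .
  qed
  have p2: "(LINT x|\<mu>. mcoef u z x * \<phi> x * k x) = - (LINT s|lborel. I s *\<^sub>R (k' s * ?O2 s))"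
    unfolding I_def by (rule oint_by_parts_compact[OF Borel_\<mu> lm kI k0])
  let ?X1 = "LINT x|lborel. I x *\<^sub>R (f' x * h' x)"
  let ?X2 = "LINT x|lborel. I x *\<^sub>R (f x * h x)"
  let ?X3 = "LINT x|lborel. I x *\<^sub>R (of_real (u x) * (f x * h x))"
  let ?X4 = "LINT x|lborel. I x *\<^sub>R (of_real (u' x) * (f x * h' x + f' x * h x))"
  let ?X5 = "LINT x|lborel. I x *\<^sub>R (((of_real (u x))\<^sup>2 + (of_real (u' x))\<^sup>2) * (f x * h x))"
  let ?Y1 = "LINT x|lborel. I x *\<^sub>R (k' x * (?E x * \<phi>' x))"
  have "?Y1 + (LINT x|lborel. I x *\<^sub>R (rcoef u z x * \<phi> x * k x)) =
      (LINT x|lborel. I x *\<^sub>R (k' x * (?E x * \<phi>' x)) + I x *\<^sub>R (rcoef u z x * \<phi> x * k x))"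
    by (rule Bochner_Integration.integral_add[OF j1 j2, symmetric])
  also have "\<dots> = (LINT x|lborel. I x *\<^sub>R (f' x * h' x) + 1/4 * (I x *\<^sub>R (f x * h x)) - z * (I x *\<^sub>R (of_real (u x) * (f x * h x)))
      - z * (I x *\<^sub>R (of_real (u' x) * (f x * h' x + f' x * h x)))
      + z\<^sup>2 * (I x *\<^sub>R (((of_real (u x))\<^sup>2 + (of_real (u' x))\<^sup>2) * (f x * h x))))"
    unfolding scaleR_add_right[symmetric] ptw[symmetric]
    by (simp only: scaleR_add_right scaleR_diff_right mult_scaleR_right)
  also have "\<dots> = ?X1 + 1/4 * ?X2 - z * ?X3 - z * ?X4 + z\<^sup>2 * ?X5"
    using i1 i2 i3 i4 i5 by (simp only: Bochner_Integration.integral_add Bochner_Integration.integral_diff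
        Bochner_Integration.integrable_add Bochner_Integration.integrable_diff integrable_mult_right integral_mult_right_zero)
  finally have e1: "?Y1 + - (LINT s|lborel. I s *\<^sub>R (k' s * ?O1 s)) = ?X1 + 1/4 * ?X2 - z * ?X3 - z * ?X4 + z\<^sup>2 * ?X5"
    unfolding p1 .
  have "(LINT s|lborel. I s *\<^sub>R (k' s * (?E s * \<phi>' s - mixed_oint (rcoef u z) (mcoef u z) \<mu> 0 s \<phi>)))
      = (LINT s|lborel. I s *\<^sub>R (k' s * (?E s * \<phi>' s)) - I s *\<^sub>R (k' s * ?O1 s) - I s *\<^sub>R (k' s * ?O2 s))"
    by (intro Bochner_Integration.integral_cong refl)
      (simp only: mixed_oint_def right_diff_distrib distrib_left scaleR_diff_right scaleR_add_right diff_diff_add)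
  also have "\<dots> = ?Y1 - (LINT s|lborel. I s *\<^sub>R (k' s * ?O1 s)) - (LINT s|lborel. I s *\<^sub>R (k' s * ?O2 s))"
    using j1 j3 by (simp only: Bochner_Integration.integral_diff Bochner_Integration.integrable_diff)
  also have "\<dots> = ?X1 + 1/4 * ?X2 - z * ?X3 - z * ?X4 + z\<^sup>2 * ?X5 - z\<^sup>2 * (LINT x|\<mu>. f x * h x)"
    using e1 p2 im by (simp add: algebra_simps)
  finally have main: "(LINT s|lborel. I s *\<^sub>R (k' s * (?E s * \<phi>' s - mixed_oint (rcoef u z) (mcoef u z) \<mu> 0 s \<phi>)))
      = ?X1 + 1/4 * ?X2 - z * ?X3 - z * ?X4 + z\<^sup>2 * ?X5 - z\<^sup>2 * (LINT x|\<mu>. f x * h x)" .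
  have "(A + 1/4 * B = z * (C + D) + z\<^sup>2 * (M - E)) \<longleftrightarrow> (A + 1/4 * B - z * C - z * D + z\<^sup>2 * E - z\<^sup>2 * M = 0)"
    for A B C D M E :: complex
    by (subst (1) eq_iff_diff_eq_0) (simp add: algebra_simps)
  then show ?thesis
    unfolding I_def[symmetric] main omega_def t1 t2 t3 t4 t5 by this
qed

end

section \<open>Test functions with step derivatives and the du Bois-Reymond lemma\<close>

definition ramp :: "real \<Rightarrow> real \<Rightarrow> real \<Rightarrow> real" where
  "ramp \<epsilon> x t = max 0 (min \<epsilon> (t - x))"

lemma ramp_has_derivative:
  assumes "0 < \<epsilon>" "t \<noteq> x" "t \<noteq> x + \<epsilon>"
  shows "(ramp \<epsilon> x has_vector_derivative indicator {x<..<x + \<epsilon>} t) (at t)"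
proof -
  consider "t < x" | "x < t" "t < x + \<epsilon>" | "x + \<epsilon> < t" using assms by linarith
  then show ?thesis
  proof cases
    case 1
    have "((\<lambda>_. 0) has_vector_derivative 0) (at t)" by (rule has_vector_derivative_const)
    then have "(ramp \<epsilon> x has_vector_derivative 0) (at t)"
      by (rule has_vector_derivative_transform_within_open[where S="{..<x}"])
        (use 1 assms(1) in \<open>auto simp: ramp_def\<close>)
    then show ?thesis using 1 by simp
  next
    case 2
    have "((\<lambda>t. t - x) has_vector_derivative 1 - 0) (at t)"
      by (intro has_vector_derivative_diff has_vector_derivative_id has_vector_derivative_const)
    then have "(ramp \<epsilon> x has_vector_derivative 1 - 0) (at t)"
      by (rule has_vector_derivative_transform_within_open[where S="{x<..<x+\<epsilon>}"])
        (use 2 in \<open>auto simp: ramp_def\<close>)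
    then show ?thesis using 2 by simp
  next
    case 3
    have "((\<lambda>_. \<epsilon>) has_vector_derivative 0) (at t)" by (rule has_vector_derivative_const)
    then have "(ramp \<epsilon> x has_vector_derivative 0) (at t)"
      by (rule has_vector_derivative_transform_within_open[where S="{x+\<epsilon><..}"])
        (use 3 assms(1) in \<open>auto simp: ramp_def\<close>)
    then show ?thesis using 3 by simp
  qed
qed

lemma ramp_lipschitz: "\<bar>ramp \<epsilon> x s - ramp \<epsilon> x t\<bar> \<le> \<bar>s - t\<bar>"
  by (auto simp: ramp_def max_def min_def abs_if)

text \<open>A compactly supported function that rises with slope 1 over (x, x + \<epsilon>) and
  falls over (y, y + \<epsilon>) when the two are disjoint. Pairing its derivative with a function
  compares integrals over two intervals of equal length.\<close>

definition trapezoid :: "real \<Rightarrow> real \<Rightarrow> real \<Rightarrow> real \<Rightarrow> complex" where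
  "trapezoid \<epsilon> x y t = of_real (ramp \<epsilon> x t - ramp \<epsilon> y t)"

lemma trapezoid_properties:
  assumes "0 < \<epsilon>"
  shows "locally_absolutely_continuous (trapezoid \<epsilon> x y)"
    and "ae_derivative (trapezoid \<epsilon> x y) (\<lambda>t. of_real (indicator {x<..<x + \<epsilon>} t - indicator {y<..<y + \<epsilon>} t))"
    and "locally_square_integrable (\<lambda>t. complex_of_real (indicator {x<..<x + \<epsilon>} t - indicator {y<..<y + \<epsilon>} t))"
    and "\<bar>x\<bar> + \<bar>y\<bar> + \<epsilon> \<le> \<bar>t\<bar> \<Longrightarrow> trapezoid \<epsilon> x y t = 0"
proof -
  show "locally_absolutely_continuous (trapezoid \<epsilon> x y)"
  proof (rule locally_absolutely_continuous_lipschitz, intro exI ballI)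
    fix s t
    have "norm (trapezoid \<epsilon> x y t - trapezoid \<epsilon> x y s) = \<bar>(ramp \<epsilon> x t - ramp \<epsilon> y t) - (ramp \<epsilon> x s - ramp \<epsilon> y s)\<bar>"
      unfolding trapezoid_def of_real_diff[symmetric] norm_of_real ..
    also have "\<dots> \<le> 2 * \<bar>t - s\<bar>"
      using ramp_lipschitz[of \<epsilon> x t s] ramp_lipschitz[of \<epsilon> y t s] by (smt (verit))
    finally show "norm (trapezoid \<epsilon> x y t - trapezoid \<epsilon> x y s) \<le> 2 * \<bar>t - s\<bar>" .
  qed
  show "ae_derivative (trapezoid \<epsilon> x y) (\<lambda>t. of_real (indicator {x<..<x + \<epsilon>} t - indicator {y<..<y + \<epsilon>} t))"
    unfolding ae_derivative_def
  proof
    have "AE t in lborel. t \<noteq> x \<and> t \<noteq> x + \<epsilon> \<and> t \<noteq> y \<and> t \<noteq> y + \<epsilon>"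
      by (intro AE_conjI AE_lborel_singleton)
    then show "AE t in lborel. (trapezoid \<epsilon> x y has_vector_derivative of_real (indicator {x<..<x + \<epsilon>} t - indicator {y<..<y + \<epsilon>} t)) (at t)"
    proof eventually_elim
      case (elim t)
      then have "((\<lambda>t. ramp \<epsilon> x t - ramp \<epsilon> y t) has_vector_derivative (indicator {x<..<x + \<epsilon>} t - indicator {y<..<y + \<epsilon>} t)) (at t)"
        using assms by (intro has_vector_derivative_diff ramp_has_derivative) auto
      then have "((\<lambda>t. ramp \<epsilon> x t - ramp \<epsilon> y t) has_real_derivative (indicator {x<..<x + \<epsilon>} t - indicator {y<..<y + \<epsilon>} t)) (at t)"
        by (simp add: has_real_derivative_iff_has_vector_derivative)
      then show ?case unfolding trapezoid_def[abs_def] by (rule has_vector_derivative_of_real)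
    qed
  qed measurable
  have "locally_bounded_borel (\<lambda>t. complex_of_real (indicator {x<..<x + \<epsilon>} t - indicator {y<..<y + \<epsilon>} t))"
    unfolding locally_bounded_borel_def
  proof (intro conjI allI exI ballI)
    show "norm (complex_of_real (indicator {x<..<x + \<epsilon>} t - indicator {y<..<y + \<epsilon>} t)) \<le> 1" for t
      by (auto simp: indicator_def)
  qed measurable
  then show "locally_square_integrable (\<lambda>t. complex_of_real (indicator {x<..<x + \<epsilon>} t - indicator {y<..<y + \<epsilon>} t))"
    by (rule locally_square_integrable_bounded)
  show "trapezoid \<epsilon> x y t = 0" if "\<bar>x\<bar> + \<bar>y\<bar> + \<epsilon> \<le> \<bar>t\<bar>"
    using assms that by (auto simp: trapezoid_def ramp_def max_def min_def abs_if split: if_splits)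
qed

text \<open>The counterpart of \<open>indefinite_integral_oint\<close> for densities that are
  locally integrable without being locally bounded.\<close>

lemma indefinite_integral_oint_lborel:
  fixes G :: "real \<Rightarrow> complex"
  assumes [measurable]: "G \<in> borel_measurable borel" and G: "\<And>a b. set_integrable lborel {a..b} G"
  shows "indefinite_integral (\<lambda>x. oint lborel 0 x G) G"
  unfolding indefinite_integral_def
proof (intro conjI allI impI assms)
  fix a b :: real assume "a \<le> b"
  have int: "integrable lborel (\<lambda>t. orient c d t *\<^sub>R G t)" for c d
  proof (rule Bochner_Integration.integrable_bound)
    show "integrable lborel (\<lambda>t. indicator {min c d..max c d} t *\<^sub>R G t)"
      using G by (simp add: set_integrable_def)
    show "AE t in lborel. norm (orient c d t *\<^sub>R G t) \<le> norm (indicator {min c d..max c d} t *\<^sub>R G t)"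
      by (intro AE_I2) (auto simp: abs_orient indicator_def)
  qed measurable
  have "oint lborel 0 a G + oint lborel a b G = oint lborel 0 b G"
    unfolding oint_def orient_trans[of 0 a _ b, symmetric] scaleR_add_left
    by (intro Bochner_Integration.integral_add[symmetric] int)
  then show "oint lborel 0 b G - oint lborel 0 a G = (LINT x:{a..b}|lborel. G x)"
    using oint_lborel_Icc[OF \<open>a \<le> b\<close>, of G] by (simp add: algebra_simps)
qed

lemma AE_lborel_ex:
  assumes "AE x in (lborel :: real measure). P x"
  shows "\<exists>x. P x"
proof (rule ccontr)
  assume "\<nexists>x. P x"
  then have "AE x in (lborel :: real measure). False" using assms by simp
  then show False by (simp add: AE_iff_null null_sets_def)
qed

text \<open>The increment of the primitive over a step depends only on the length of the step, so
  its translates to x and to y differ by a constant. Differentiating at 0 compares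
  \<open>G x\<close> with \<open>G y\<close> for one fixed point y of differentiability.\<close>

lemma AE_constant_of_equal_averages:
  fixes G :: "real \<Rightarrow> complex"
  assumes G: "G \<in> borel_measurable borel" "\<And>a b. set_integrable lborel {a..b} G"
    and eq: "\<And>x y \<epsilon>. 0 < \<epsilon> \<Longrightarrow> (LINT t:{x..x + \<epsilon>}|lborel. G t) = (LINT t:{y..y + \<epsilon>}|lborel. G t)"
  obtains C where "AE x in lborel. G x = C"
proof -
  let ?\<Gamma> = "\<lambda>x. oint lborel 0 x G"
  have ii: "indefinite_integral ?\<Gamma> G" by (rule indefinite_integral_oint_lborel[OF G])
  note D = AE_has_vector_derivative_indefinite_integral[OF ii]
  obtain y where y: "(?\<Gamma> has_vector_derivative G y) (at y)" using AE_lborel_ex[OF D] by blast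
  have step: "?\<Gamma> (x + \<epsilon>) - ?\<Gamma> x = ?\<Gamma> (w + \<epsilon>) - ?\<Gamma> w" if "0 < \<epsilon>" for x w \<epsilon>
    using indefinite_integralD(3)[OF ii, of x "x + \<epsilon>"] indefinite_integralD(3)[OF ii, of w "w + \<epsilon>"]
      eq[OF that, of x w] that by simp
  have const: "?\<Gamma> (x + t) - ?\<Gamma> (y + t) = ?\<Gamma> x - ?\<Gamma> y" for x t
  proof -
    consider "t = 0" | "0 < t" | "t < 0" by linarith
    then show ?thesis
    proof cases
      case 2
      then show ?thesis using step[of t x y] by (simp add: algebra_simps)
    next
      case 3
      then show ?thesis using step[of "- t" "x + t" "y + t"] by (simp add: algebra_simps)
    qed simp
  qed
  have "AE x in lborel. G x = G y"
    using D
  proof eventually_elim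
    fix x assume x: "(?\<Gamma> has_vector_derivative G x) (at x)"
    have shift: "((\<lambda>t. ?\<Gamma> (w + t)) has_vector_derivative G w) (at 0)"
      if "(?\<Gamma> has_vector_derivative G w) (at w)" for w
    proof -
      have "((\<lambda>t. w + t) has_vector_derivative 0 + 1) (at 0)"
        by (intro has_vector_derivative_add has_vector_derivative_const has_vector_derivative_id)
      then have "((?\<Gamma> \<circ> (\<lambda>t. w + t)) has_vector_derivative (0 + 1) *\<^sub>R G w) (at 0)"
        using that by (intro vector_diff_chain_at) auto
      then show ?thesis by (simp add: o_def)
    qed
    have "((\<lambda>t. ?\<Gamma> (x + t) - ?\<Gamma> (y + t)) has_vector_derivative G x - G y) (at 0)"
      by (intro has_vector_derivative_diff shift x y)
    then have "((\<lambda>t. ?\<Gamma> x - ?\<Gamma> y) has_vector_derivative G x - G y) (at 0)"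
      by (simp only: const)
    then have "G x - G y = 0"
      using has_vector_derivative_const vector_derivative_unique_at by blast
    then show "G x = G y" by simp
  qed
  then show ?thesis by (rule that)
qed

text \<open>Two left-continuous functions that differ at x differ on a whole interval to the left of
  x, which has positive measure. This is the uniqueness behind \<open>quasi_deriv\<close>.\<close>

lemma left_continuous_AE_unique:
  fixes q q' :: "real \<Rightarrow> complex"
  assumes q: "\<And>x. continuous (at_left x) q" "\<And>x. continuous (at_left x) q'"
    and eq: "AE x in lebesgue. q x = q' x"
  shows "q = q'"
proof (rule ccontr)
  assume "q \<noteq> q'"
  then obtain x where x: "q x \<noteq> q' x" by blast
  have "(q \<longlongrightarrow> q x) (at_left x)" "(q' \<longlongrightarrow> q' x) (at_left x)"
    using q by (simp_all add: continuous_within)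
  then have "((\<lambda>t. q t - q' t) \<longlongrightarrow> q x - q' x) (at_left x)" by (rule tendsto_diff)
  moreover have "open (- {0 :: complex})" by auto
  ultimately have "\<forall>\<^sub>F t in at_left x. q t - q' t \<in> - {0}"
    using x by (intro topological_tendstoD) auto
  then obtain b where b: "b < x" "\<And>t. b < t \<Longrightarrow> t < x \<Longrightarrow> q t \<noteq> q' t"
    unfolding eventually_at_left_field by auto
  have "AE t in lborel. q t = q' t" using eq by (simp add: AE_completion_iff)
  then have "AE t in lborel. t \<notin> {b<..<x}"
    by eventually_elim (use b(2) in force)
  then have "{b<..<x} \<in> null_sets lborel" by (subst AE_iff_null_sets) auto
  then have "emeasure lborel {b<..<x} = 0" by (simp add: null_sets_def)
  then show False using b(1) by simp
qed

section \<open>Equivalence of the weak equation and the Volterra system\<close>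

context string_data
begin

abbreviation string_vsol where
  "string_vsol z \<phi> \<psi> \<equiv> vsol (pcoef u z) (rcoef u z) (mcoef u z) \<mu> \<phi> \<psi>"

text \<open>By \<open>weak_form_identity\<close> the function \<open>G\<close> is orthogonal to the
  derivatives of all test functions and hence almost everywhere a constant \<open>C\<close>. This
  determines the second component as \<open>C\<close> plus the primitive occurring in
  \<open>G\<close>.\<close>

lemma solution_imp_vsol:
  assumes sol: "is_solution u \<mu> z f"
  shows "\<exists>\<psi>. string_vsol z (\<lambda>x. exp (- z * of_real (u x)) * f x) \<psi>"
proof -
  interpret V: volterra "pcoef u z" "rcoef u z" "mcoef u z" \<mu> by (rule volterra)
  have fH: "f \<in> H1_loc" using sol by (simp add: is_solution_def)
  then obtain f' where f': "ae_derivative f f'" using H1_loc_ae_derivative by blast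
  then have f: "locally_absolutely_continuous f" "ae_derivative f f'" "locally_square_integrable f'"
    using H1_loc_iff[OF f'] fH by auto
  define \<phi> where "\<phi> x = exp (- z * of_real (u x)) * f x" for x
  define \<phi>' where "\<phi>' x = exp (- z * of_real (u x)) * (f' x + - z * of_real (u' x) * f x)" for x
  note ef = exp_scale_mult[OF f, of "- z"]
  have \<phi>: "locally_absolutely_continuous \<phi>" "ae_derivative \<phi> \<phi>'" "locally_square_integrable \<phi>'"
    using ef unfolding \<phi>_def[abs_def] \<phi>'_def[abs_def] by auto
  have l\<phi>: "locally_bounded_borel \<phi>"
    by (intro locally_bounded_borel_continuous continuous_on_locally_absolutely_continuous \<phi>)
  define G where "G s = exp (2 * z * of_real (u s)) * \<phi>' s - mixed_oint (rcoef u z) (mcoef u z) \<mu> 0 s \<phi>" for s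
  have lm: "locally_bounded_borel (\<lambda>s. mixed_oint (rcoef u z) (mcoef u z) \<mu> 0 s \<phi>)"
    by (rule V.locally_bounded_borel_mixed_oint[OF l\<phi>])
  have lE: "locally_bounded_borel (\<lambda>x. exp (c * complex_of_real (u x)))" for c
    by (rule locally_bounded_borel_continuous[OF exp_scale_cont])
  have "locally_square_integrable (\<lambda>s. exp (2 * z * of_real (u s)) * \<phi>' s + (-1) * mixed_oint (rcoef u z) (mcoef u z) \<mu> 0 s \<phi>)"
    by (intro locally_square_integrable_add locally_square_integrable_mult lE \<phi> locally_bounded_borel_const
        locally_square_integrable_bounded lm)
  then have siG: "locally_square_integrable G" by (simp add: G_def[abs_def])
  then have [measurable]: "G \<in> borel_measurable borel" by measurable
  have Gint: "set_integrable lborel {a..b} G" for a b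
    using locally_square_integrable_prod[OF locally_square_integrable_bounded[OF locally_bounded_borel_const[of 1]] siG]
    by simp
  \<comment> \<open>Every admissible \<open>k\<close> arises from a test function, namely
    \<open>h = exp (z u) k\<close>.\<close>
  have test: "(LINT s|lborel. indicator {-R..R} s *\<^sub>R (k' s * G s)) = 0"
    if k: "locally_absolutely_continuous k" "ae_derivative k k'" "locally_square_integrable k'"
      and R: "\<And>x. R \<le> \<bar>x\<bar> \<Longrightarrow> k x = 0" for k k' R
  proof -
    define h where "h x = exp (z * of_real (u x)) * k x" for x
    define h' where "h' x = exp (z * of_real (u x)) * (k' x + z * of_real (u' x) * k x)" for x
    have h: "locally_absolutely_continuous h" "ae_derivative h h'" "locally_square_integrable h'" "h \<in> H1_loc"
      using exp_scale_mult[OF k, of z] unfolding h_def[abs_def] h'_def[abs_def] by auto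
    have hR: "\<forall>x. R \<le> \<bar>x\<bar> \<longrightarrow> h x = 0" using R by (simp add: h_def)
    have hk': "exp (- z * complex_of_real (u x)) * (h' x + - z * of_real (u' x) * h x) = k' x" for x
      by (simp add: h_def h'_def exp_minus field_simps)
    have "h \<in> H1_c" using hR by (intro H1_cI[OF h(4)]) blast
    then have "(LINT x|lebesgue. vderiv f x * vderiv h x) + 1/4 * (LINT x|lebesgue. f x * h x)
        = z * omega u (\<lambda>x. f x * h x) + z\<^sup>2 * (LINT x|upsilon u \<mu>. f x * h x)"
      using sol by (simp add: is_solution_def)
    then show ?thesis
      unfolding weak_form_identity[OF f h(1-3) hR] hk' G_def \<phi>_def[symmetric] \<phi>'_def[symmetric] by this
  qed
  have "(LINT t:{x..x + \<epsilon>}|lborel. G t) = (LINT t:{y..y + \<epsilon>}|lborel. G t)" if "0 < \<epsilon>" for x y \<epsilon>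
  proof -
    define R where "R = \<bar>x\<bar> + \<bar>y\<bar> + \<epsilon>"
    have "(LINT s|lborel. indicator {-R..R} s *\<^sub>R (of_real (indicator {x<..<x + \<epsilon>} s - indicator {y<..<y + \<epsilon>} s) * G s)) = 0"
      by (rule test[OF trapezoid_properties(1-3)[OF that] trapezoid_properties(4)[OF that]]) (simp add: R_def)
    also have "(LINT s|lborel. indicator {-R..R} s *\<^sub>R (of_real (indicator {x<..<x + \<epsilon>} s - indicator {y<..<y + \<epsilon>} s) * G s)) =
        (LINT s|lborel. indicator {x..x + \<epsilon>} s *\<^sub>R G s - indicator {y..y + \<epsilon>} s *\<^sub>R G s)"
    proof (rule integral_cong_AE)
      have "AE t in lborel. t \<noteq> x \<and> t \<noteq> x + \<epsilon> \<and> t \<noteq> y \<and> t \<noteq> y + \<epsilon>"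
        by (intro AE_conjI AE_lborel_singleton)
      then show "AE s in lborel. indicator {-R..R} s *\<^sub>R (of_real (indicator {x<..<x + \<epsilon>} s - indicator {y<..<y + \<epsilon>} s) * G s) =
          indicator {x..x + \<epsilon>} s *\<^sub>R G s - indicator {y..y + \<epsilon>} s *\<^sub>R G s"
        by eventually_elim (auto simp: indicator_def R_def scaleR_conv_of_real)
    qed measurable
    also have "\<dots> = (LINT t:{x..x + \<epsilon>}|lborel. G t) - (LINT t:{y..y + \<epsilon>}|lborel. G t)"
      unfolding set_lebesgue_integral_def using Gint
      by (intro Bochner_Integration.integral_diff) (auto simp: set_integrable_def)
    finally show ?thesis by simp
  qed
  then obtain C where C: "AE x in lborel. G x = C"
    using AE_constant_of_equal_averages[of G] Gint by (metis \<open>G \<in> borel_measurable borel\<close>)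
  \<comment> \<open>This is defined at every point and satisfies the second equation exactly,
    whereas it agrees with \<open>exp (2 z u) \<phi>'\<close> almost everywhere only.\<close>
  define \<psi> where "\<psi> s = C + mixed_oint (rcoef u z) (mcoef u z) \<mu> 0 s \<phi>" for s
  have l\<psi>: "locally_bounded_borel \<psi>" unfolding \<psi>_def[abs_def] by (intro V.lbb lm)
  have lp\<psi>: "locally_bounded_borel (\<lambda>x. pcoef u z x * \<psi> x)" by (intro V.lbb l\<psi>)
  have "AE x in lborel. \<phi>' x = pcoef u z x * \<psi> x"
    using C
  proof eventually_elim
    case (elim x)
    then have "exp (2 * z * of_real (u x)) * \<phi>' x = \<psi> x" by (simp add: G_def \<psi>_def algebra_simps)
    then show ?case by (auto simp: pcoef_def exp_minus field_simps)
  qed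
  then have "indefinite_integral \<phi> (\<lambda>x. pcoef u z x * \<psi> x)"
    using lp\<psi> by (intro indefinite_integral_cong_AE[OF locally_absolutely_continuous_indefinite_integral[OF \<phi>(1)]])
      (use \<phi>(2) in \<open>auto simp: ae_derivative_def\<close>)
  then have "string_vsol z \<phi> \<psi>"
    unfolding vsol_def using l\<phi> l\<psi> V.mixed_oint_trans[OF l\<phi>]
    by (auto simp: oint_indefinite_integral \<psi>_def) (metis add_diff_cancel_left')
  then show ?thesis unfolding \<phi>_def[abs_def] by blast
qed

lemma vsol_ae_derivative:
  assumes "string_vsol z \<phi> \<psi>"
  shows "locally_absolutely_continuous \<phi>" "ae_derivative \<phi> (\<lambda>x. pcoef u z x * \<psi> x)"
    "locally_square_integrable (\<lambda>x. pcoef u z x * \<psi> x)"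
proof -
  interpret V: volterra "pcoef u z" "rcoef u z" "mcoef u z" \<mu> by (rule volterra)
  have l: "locally_bounded_borel (\<lambda>x. pcoef u z x * \<psi> x)"
    using assms by (intro V.lbb) (auto simp: vsol_def)
  then have ii: "indefinite_integral \<phi> (\<lambda>x. pcoef u z x * \<psi> x)" "locally_absolutely_continuous \<phi>"
    using assms by (auto simp: vsol_def intro!: indefinite_integral_oint)
  show "locally_absolutely_continuous \<phi>" by (rule ii)
  show "ae_derivative \<phi> (\<lambda>x. pcoef u z x * \<psi> x)"
    unfolding ae_derivative_def using indefinite_integralD(1)[OF ii(1)] AE_has_vector_derivative_indefinite_integral[OF ii(1)]
    by simp
  show "locally_square_integrable (\<lambda>x. pcoef u z x * \<psi> x)"
    by (rule locally_square_integrable_bounded[OF l])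
qed

text \<open>For a solution of the system the bracket in \<open>weak_form_identity\<close> is the
  constant \<psi> 0, and the integral of k' vanishes since \<open>k\<close> has compact support. The
  quasi-derivative is then identified by left-continuity.\<close>

lemma vsol_imp_solution:
  assumes sol: "string_vsol z \<phi> \<psi>"
  shows "is_solution u \<mu> z (\<lambda>x. exp (z * of_real (u x)) * \<phi> x)"
    and "quasi_deriv u z (\<lambda>x. exp (z * of_real (u x)) * \<phi> x) = (\<lambda>x. exp (- z * of_real (u x)) * \<psi> x)"
proof -
  interpret V: volterra "pcoef u z" "rcoef u z" "mcoef u z" \<mu> by (rule volterra)
  note \<phi> = vsol_ae_derivative[OF sol]
  define f where "f x = exp (z * of_real (u x)) * \<phi> x" for x
  define f' where "f' x = exp (z * of_real (u x)) * (pcoef u z x * \<psi> x + z * of_real (u' x) * \<phi> x)" for x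
  have f: "locally_absolutely_continuous f" "ae_derivative f f'" "locally_square_integrable f'" "f \<in> H1_loc"
    using exp_scale_mult[OF \<phi>, of z] unfolding f_def[abs_def] f'_def[abs_def] by auto
  have f\<phi>: "exp (- z * complex_of_real (u x)) * f x = \<phi> x" for x
    by (simp add: f_def exp_minus)
  have f\<phi>': "exp (- z * complex_of_real (u x)) * (f' x + - z * of_real (u' x) * f x) = pcoef u z x * \<psi> x" for x
    by (simp add: f_def f'_def exp_minus field_simps)
  have Ep: "exp (2 * z * of_real (u x)) * (pcoef u z x * \<psi> x) = \<psi> x" for x
    by (simp add: pcoef_def exp_minus)
  have const: "\<psi> s - mixed_oint (rcoef u z) (mcoef u z) \<mu> 0 s \<phi> = \<psi> 0" for s
  proof -
    have "\<psi> s - \<psi> 0 = mixed_oint (rcoef u z) (mcoef u z) \<mu> 0 s \<phi>" using sol by (simp add: vsol_def)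
    then show ?thesis by (simp add: algebra_simps)
  qed
  have "is_solution u \<mu> z f"
    unfolding is_solution_def
  proof (intro conjI ballI f)
    fix h assume "h \<in> H1_c"
    then obtain h' R where h: "ae_derivative h h'" "locally_square_integrable h'" "locally_absolutely_continuous h"
      and R: "0 < R" "\<forall>x. R \<le> \<bar>x\<bar> \<longrightarrow> h x = 0" by (metis H1_cE)
    define k where "k x = exp (- z * complex_of_real (u x)) * h x" for x
    define k' where "k' x = exp (- z * complex_of_real (u x)) * (h' x + - z * of_real (u' x) * h x)" for x
    have k: "locally_absolutely_continuous k" "ae_derivative k k'"
      using exp_scale_mult[OF h(3,1,2), of "- z"] unfolding k_def[abs_def] k'_def[abs_def] by auto
    have kI: "indefinite_integral k k'"
      using k by (intro locally_absolutely_continuous_indefinite_integral) (auto simp: ae_derivative_def)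
    have "k R = 0" "k (- R) = 0" using R by (auto simp: k_def)
    then have "(LINT s:{-R..R}|lborel. k' s) = 0" using indefinite_integralD(3)[OF kI, of "- R" R] R(1) by simp
    then have "(LINT s|lborel. indicator {-R..R} s *\<^sub>R k' s) * \<psi> 0 = 0" by (simp add: set_lebesgue_integral_def)
    then have "(LINT s|lborel. indicator {-R..R} s *\<^sub>R (k' s * \<psi> 0)) = 0"
      unfolding integral_mult_left_zero[symmetric] by simp
    then show "(LINT x|lebesgue. vderiv f x * vderiv h x) + 1/4 * (LINT x|lebesgue. f x * h x)
        = z * omega u (\<lambda>x. f x * h x) + z\<^sup>2 * (LINT x|upsilon u \<mu>. f x * h x)"
      unfolding weak_form_identity[OF f(1-3) h(3,1,2) R(2)] f\<phi> f\<phi>' Ep const k'_def by this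
  qed
  then show "is_solution u \<mu> z (\<lambda>x. exp (z * of_real (u x)) * \<phi> x)" unfolding f_def[abs_def] .
  have "quasi_deriv u z f = (\<lambda>x. exp (- z * of_real (u x)) * \<psi> x)"
    unfolding quasi_deriv_def
  proof (rule the_equality)
    show *: "(\<forall>x. continuous (at_left x) (\<lambda>x. exp (- z * of_real (u x)) * \<psi> x)) \<and>
      (AE x in lebesgue. exp (- z * of_real (u x)) * \<psi> x = vderiv f x - z * of_real (vderiv u x) * f x)"
    proof (intro conjI allI)
      fix x
      have "continuous (at_left x) (\<lambda>x. exp (- z * complex_of_real (u x)))"
        using exp_scale_cont[of "- z"] continuous_on_eq_continuous_at continuous_at_imp_continuous_at_within open_UNIV by blast
      then show "continuous (at_left x) (\<lambda>x. exp (- z * of_real (u x)) * \<psi> x)"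
        by (intro continuous_mult V.vsol_continuous(2)[OF sol])
      have "AE x in lebesgue. vderiv f x = f' x" "AE x in lebesgue. vderiv u x = u' x"
        using ae_derivative_AE_vderiv f u' by auto
      then show "AE x in lebesgue. exp (- z * of_real (u x)) * \<psi> x = vderiv f x - z * of_real (vderiv u x) * f x"
      proof eventually_elim
        case (elim x)
        have "exp (z * of_real (u x)) * pcoef u z x = exp (- z * of_real (u x))"
          by (simp add: pcoef_def exp_add[symmetric] mult.assoc)
        then show ?case unfolding elim f'_def f_def by (simp add: algebra_simps)
      qed
    qed
    fix q assume q: "(\<forall>x. continuous (at_left x) q) \<and>
      (AE x in lebesgue. q x = vderiv f x - z * of_real (vderiv u x) * f x)"
    show "q = (\<lambda>x. exp (- z * of_real (u x)) * \<psi> x)"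
    proof (rule left_continuous_AE_unique)
      from q have "AE x in lebesgue. q x = vderiv f x - z * of_real (vderiv u x) * f x" by simp
      moreover from * have "AE x in lebesgue. exp (- z * of_real (u x)) * \<psi> x = vderiv f x - z * of_real (vderiv u x) * f x" by simp
      ultimately show "AE x in lebesgue. q x = exp (- z * of_real (u x)) * \<psi> x" by eventually_elim simp
    qed (use q * in auto)
  qed
  then show "quasi_deriv u z (\<lambda>x. exp (z * of_real (u x)) * \<phi> x) = (\<lambda>x. exp (- z * of_real (u x)) * \<psi> x)"
    unfolding f_def[abs_def] .
qed

text \<open>Uniqueness is inherited from the system: any competitor transforms into a solution of
  the system with the same data at \<open>a\<close>.\<close>

lemma solution_at_eq:
  assumes sol: "string_vsol z \<phi> \<psi>"
    and "exp (z * of_real (u a)) * \<phi> a = d1" "exp (- z * of_real (u a)) * \<psi> a = d2"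
  shows "solution_at a u \<mu> z d1 d2 = (\<lambda>x. exp (z * of_real (u x)) * \<phi> x)"
  unfolding solution_at_def
proof (rule the_equality)
  interpret V: volterra "pcoef u z" "rcoef u z" "mcoef u z" \<mu> by (rule volterra)
  let ?f = "\<lambda>x. exp (z * of_real (u x)) * \<phi> x"
  show "is_solution u \<mu> z ?f \<and> ?f a = d1 \<and> quasi_deriv u z ?f a = d2"
    using vsol_imp_solution[OF sol] assms by simp
  fix g assume g: "is_solution u \<mu> z g \<and> g a = d1 \<and> quasi_deriv u z g a = d2"
  then obtain \<psi>' where \<psi>': "string_vsol z (\<lambda>x. exp (- z * of_real (u x)) * g x) \<psi>'"
    using solution_imp_vsol by blast
  have gg: "exp (z * of_real (u x)) * (exp (- z * of_real (u x)) * g x) = g x" for x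
    by (simp add: exp_minus)
  have "exp (- z * of_real (u a)) * \<psi>' a = exp (- z * of_real (u a)) * \<psi> a"
    using vsol_imp_solution(2)[OF \<psi>'] g assms(3) unfolding gg by simp
  then have "\<psi>' a = \<psi> a" by simp
  moreover have "exp (- z * of_real (u a)) * g a = \<phi> a"
    using g assms(2) by (simp add: exp_minus) (metis exp_not_eq_zero nonzero_mult_div_cancel_left divide_inverse mult.commute)
  ultimately have "exp (- z * of_real (u x)) * g x = \<phi> x" for x
    using V.vsol_unique(1)[OF \<psi>' sol, of a] by simp
  then show "g = ?f" using gg by metis
qed

text \<open>Normalising f and its quasi-derivative at \<open>a\<close> rescales \<phi> and \<psi> by
  reciprocal exponentials of \<open>u a\<close>. As \<open>u\<close> has the same value at
  \<open>a + l\<close>, the factors cancel in the two diagonal entries, which are the only ones in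
  the discriminant.\<close>

lemma floquet_discriminant_eq:
  assumes u_per: "u (a + l) = u a"
    and 1: "string_vsol z \<phi>1 \<psi>1" "\<phi>1 a = 1" "\<psi>1 a = 0"
    and 2: "string_vsol z \<phi>2 \<psi>2" "\<phi>2 a = 0" "\<psi>2 a = 1"
  shows "floquet_discriminant l a u \<mu> z = 1/2 * (\<phi>1 (a + l) + \<psi>2 (a + l))"
proof -
  interpret V: volterra "pcoef u z" "rcoef u z" "mcoef u z" \<mu> by (rule volterra)
  let ?e = "exp (z * of_real (u a))" and ?d = "exp (- z * of_real (u a))"
  have ed: "?e * ?d = 1" by (simp add: exp_minus)
  have s1: "string_vsol z (\<lambda>x. ?d * \<phi>1 x) (\<lambda>x. ?d * \<psi>1 x)"
    using V.vsol_lincomb[OF 1(1) 1(1), of ?d 0] by simp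
  have s2: "string_vsol z (\<lambda>x. ?e * \<phi>2 x) (\<lambda>x. ?e * \<psi>2 x)"
    using V.vsol_lincomb[OF 2(1) 2(1), of ?e 0] by simp
  have c: "c_sol a u \<mu> z = (\<lambda>x. exp (z * of_real (u x)) * (?d * \<phi>1 x))"
    unfolding c_sol_def by (rule solution_at_eq[OF s1]) (use ed 1 in auto)
  have s: "s_sol a u \<mu> z = (\<lambda>x. exp (z * of_real (u x)) * (?e * \<phi>2 x))"
    unfolding s_sol_def by (rule solution_at_eq[OF s2]) (use ed 2 in \<open>auto simp: mult.commute\<close>)
  have de: "?d * ?e = 1" by (simp add: exp_minus)
  have ede: "?e * (?d * w) = w" "?d * (?e * w) = w" for w
    unfolding mult.assoc[symmetric] ed de by simp_all
  show ?thesis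
    unfolding floquet_discriminant_def s vsol_imp_solution(2)[OF s2] unfolding c u_per ede ..
qed

end

section \<open>Periodicity and independence of the base point\<close>

lemma oint_shift:
  assumes "distr M borel (\<lambda>t. t - l) = M" "sets M = sets borel" "F \<in> borel_measurable borel"
  shows "oint M x y (\<lambda>t. F (t + l)) = oint M (x + l) (y + l) F"
proof -
  have [measurable_cong]: "sets M = sets borel" by (rule assms)
  have [measurable]: "F \<in> borel_measurable borel" by (rule assms)
  have "oint M x y (\<lambda>t. F (t + l)) = integral\<^sup>L (distr M borel (\<lambda>t. t - l)) (\<lambda>t. orient x y t *\<^sub>R F (t + l))"
    unfolding assms(1) oint_def ..
  also have "\<dots> = (LINT t|M. orient x y (t - l) *\<^sub>R F (t - l + l))"
    by (rule integral_distr) measurable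
  also have "\<dots> = oint M (x + l) (y + l) F"
    unfolding oint_def by (intro Bochner_Integration.integral_cong refl) (auto simp: orient_def indicator_def)
  finally show ?thesis .
qed

lemma distr_shift_eq:
  fixes \<mu> :: "real measure"
  assumes "sets \<mu> = sets borel" and "\<And>B. B \<in> sets borel \<Longrightarrow> emeasure \<mu> ((\<lambda>x. x + l) ` B) = emeasure \<mu> B"
  shows "distr \<mu> borel (\<lambda>t. t - l) = \<mu>"
proof (rule measure_eqI)
  fix B assume "B \<in> sets (distr \<mu> borel (\<lambda>t. t - l))"
  then have B: "B \<in> sets borel" by simp
  have [measurable_cong]: "sets \<mu> = sets borel" by (rule assms)
  have "emeasure (distr \<mu> borel (\<lambda>t. t - l)) B = emeasure \<mu> ((\<lambda>t. t - l) -` B \<inter> space \<mu>)"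
    using B by (intro emeasure_distr) auto
  also have "(\<lambda>t. t - l) -` B \<inter> space \<mu> = (\<lambda>x. x + l) ` B"
    using sets_eq_imp_space_eq[OF assms(1)] by (auto simp: image_iff) (metis diff_add_cancel)
  finally show "emeasure (distr \<mu> borel (\<lambda>t. t - l)) B = emeasure \<mu> B" using assms(2)[OF B] by simp
qed (simp add: assms)

context string_data
begin

text \<open>Both measures and, through \<open>u\<close>, all coefficients are invariant under the
  shift by l.\<close>

lemma vsol_shift:
  assumes per: "\<And>x. u (x + l) = u x"
    and inv: "\<And>B. B \<in> sets borel \<Longrightarrow> emeasure \<mu> ((\<lambda>x. x + l) ` B) = emeasure \<mu> B"
    and sol: "string_vsol z \<phi> \<psi>"
  shows "string_vsol z (\<lambda>x. \<phi> (x + l)) (\<lambda>x. \<psi> (x + l))"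
proof -
  interpret V: volterra "pcoef u z" "rcoef u z" "mcoef u z" \<mu> by (rule volterra)
  have l: "locally_bounded_borel \<phi>" "locally_bounded_borel \<psi>" using sol by (auto simp: vsol_def)
  have sh: "locally_bounded_borel (\<lambda>x. F (x + l))" if F: "locally_bounded_borel F" for F
    unfolding locally_bounded_borel_def
  proof (intro conjI allI)
    show "(\<lambda>x. F (x + l)) \<in> borel_measurable borel"
      by (rule measurable_compose[OF _ locally_bounded_borel_measurable[OF F]]) measurable
    fix a b
    obtain C where C: "\<And>x. x \<in> {a + l..b + l} \<Longrightarrow> norm (F x) \<le> C" using locally_bounded_borelE[OF F] by metis
    show "\<exists>C. \<forall>x\<in>{a..b}. norm (F (x + l)) \<le> C" by (intro exI[of _ C] ballI C) auto
  qed
  have coef: "pcoef u z (t + l) = pcoef u z t" "rcoef u z (t + l) = rcoef u z t" "mcoef u z (t + l) = mcoef u z t" for t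
    by (simp_all add: pcoef_def rcoef_def mcoef_def per)
  have "distr lborel borel (\<lambda>t. t - l) = (lborel :: real measure)"
  proof -
    have "(+) (- l) = (\<lambda>t. t - l)" by auto
    then show ?thesis using lborel_distr_plus[of "- l"] by simp
  qed
  note d1 = oint_shift[OF this sets_lborel]
  have "distr \<mu> borel (\<lambda>t. t - l) = \<mu>" by (rule distr_shift_eq[OF Borel_measureD(1)[OF Borel_\<mu>] inv])
  note d2 = oint_shift[OF this Borel_measureD(1)[OF Borel_\<mu>]]
  show ?thesis unfolding vsol_def
  proof (intro conjI allI sh l)
    fix x y
    have "\<phi> (y + l) - \<phi> (x + l) = oint lborel (x + l) (y + l) (\<lambda>t. pcoef u z t * \<psi> t)"
      using sol by (simp add: vsol_def)
    also have "\<dots> = oint lborel x y (\<lambda>t. pcoef u z (t + l) * \<psi> (t + l))"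
      by (rule d1[symmetric]) (intro locally_bounded_borel_measurable V.lbb l)
    finally show "\<phi> (y + l) - \<phi> (x + l) = oint lborel x y (\<lambda>t. pcoef u z t * \<psi> (t + l))" by (simp add: coef)
    have "\<psi> (y + l) - \<psi> (x + l) = mixed_oint (rcoef u z) (mcoef u z) \<mu> (x + l) (y + l) \<phi>"
      using sol by (simp add: vsol_def)
    also have "\<dots> = oint lborel x y (\<lambda>t. rcoef u z (t + l) * \<phi> (t + l)) + oint \<mu> x y (\<lambda>t. mcoef u z (t + l) * \<phi> (t + l))"
      unfolding mixed_oint_def
      by (intro arg_cong2[where f="(+)"] d1[symmetric] d2[symmetric] locally_bounded_borel_measurable V.lbb l)
    finally show "\<psi> (y + l) - \<psi> (x + l) = mixed_oint (rcoef u z) (mcoef u z) \<mu> x y (\<lambda>x. \<phi> (x + l))"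
      by (simp add: coef mixed_oint_def)
  qed
qed

text \<open>The monodromy matrices at two base points are conjugate by the transfer matrix.\<close>

lemma monodromy_trace_base_point:
  assumes per: "\<And>x. u (x + l) = u x"
    and inv: "\<And>B. B \<in> sets borel \<Longrightarrow> emeasure \<mu> ((\<lambda>x. x + l) ` B) = emeasure \<mu> B"
    and a1: "string_vsol z \<phi>1 \<psi>1" "\<phi>1 a = 1" "\<psi>1 a = 0"
    and a2: "string_vsol z \<phi>2 \<psi>2" "\<phi>2 a = 0" "\<psi>2 a = 1"
    and b1: "string_vsol z \<phi>1' \<psi>1'" "\<phi>1' b = 1" "\<psi>1' b = 0"
    and b2: "string_vsol z \<phi>2' \<psi>2'" "\<phi>2' b = 0" "\<psi>2' b = 1"
  shows "\<phi>1 (a + l) + \<psi>2 (a + l) = \<phi>1' (b + l) + \<psi>2' (b + l)"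
proof -
  interpret V: volterra "pcoef u z" "rcoef u z" "mcoef u z" \<mu> by (rule volterra)
  have exp_a: "\<phi> x = \<phi> a * \<phi>1 x + \<psi> a * \<phi>2 x" "\<psi> x = \<phi> a * \<psi>1 x + \<psi> a * \<psi>2 x"
    if "string_vsol z \<phi> \<psi>" for \<phi> \<psi> x
    using V.vsol_unique[OF that V.vsol_lincomb[OF a1(1) a2(1), of "\<phi> a" "\<psi> a"], of a x] a1 a2 by auto
  have exp_b: "\<phi> x = \<phi> b * \<phi>1' x + \<psi> b * \<phi>2' x" "\<psi> x = \<phi> b * \<psi>1' x + \<psi> b * \<psi>2' x"
    if "string_vsol z \<phi> \<psi>" for \<phi> \<psi> x
    using V.vsol_unique[OF that V.vsol_lincomb[OF b1(1) b2(1), of "\<phi> b" "\<psi> b"], of b x] b1 b2 by auto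
  have shift: "string_vsol z (\<lambda>x. \<phi> (x + l)) (\<lambda>x. \<psi> (x + l))" if "string_vsol z \<phi> \<psi>" for \<phi> \<psi>
    by (rule vsol_shift[OF per inv that])
  note s1 = exp_a[OF shift[OF a1(1)], of b] and s2 = exp_a[OF shift[OF a2(1)], of b]
  note t1 = exp_b[OF a1(1), of a] and t2 = exp_b[OF a2(1), of a]
  note r1 = exp_a[OF b1(1), of "b + l"] and r2 = exp_a[OF b2(1), of "b + l"]
  define A B C D where "A = \<phi>1 b" "B = \<phi>2 b" "C = \<psi>1 b" "D = \<psi>2 b"
  define \<alpha> \<beta> \<gamma> \<delta> where "\<alpha> = \<phi>1' a" "\<beta> = \<phi>2' a" "\<gamma> = \<psi>1' a" "\<delta> = \<psi>2' a"
  define m11 m12 m21 m22 where "m11 = \<phi>1 (a + l)" "m12 = \<phi>2 (a + l)" "m21 = \<psi>1 (a + l)" "m22 = \<psi>2 (a + l)"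
  note defs = A_B_C_D_def \<alpha>_\<beta>_\<gamma>_\<delta>_def m11_m12_m21_m22_def
  \<comment> \<open>These equations say that the transfer matrices between \<open>a\<close> and
    \<open>b\<close> are inverse to each other; the identity after them expands the trace of the
    conjugated monodromy matrix.\<close>
  have "A * \<alpha> + C * \<beta> = 1" "A * \<gamma> + C * \<delta> = 0" "B * \<alpha> + D * \<beta> = 0" "B * \<gamma> + D * \<delta> = 1"
    using t1 t2 a1 a2 unfolding defs by simp_all
  moreover have "\<phi>1' (b + l) + \<psi>2' (b + l) =
      m11 * (A * \<alpha> + C * \<beta>) + m21 * (B * \<alpha> + D * \<beta>) + m12 * (A * \<gamma> + C * \<delta>) + m22 * (B * \<gamma> + D * \<delta>)"
    unfolding r1(1) r2(2) s1 s2 defs by (simp add: algebra_simps)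
  ultimately show ?thesis unfolding defs by simp
qed

text \<open>This gives the freedom to evaluate the discriminant at a base point without atom,
  whatever the point \<open>a\<close> in its definition.\<close>

lemma floquet_discriminant_base_point:
  assumes per: "\<And>x. u (x + l) = u x"
    and inv: "\<And>B. B \<in> sets borel \<Longrightarrow> emeasure \<mu> ((\<lambda>x. x + l) ` B) = emeasure \<mu> B"
    and b1: "string_vsol z \<phi>1 \<psi>1" "\<phi>1 b = 1" "\<psi>1 b = 0"
    and b2: "string_vsol z \<phi>2 \<psi>2" "\<phi>2 b = 0" "\<psi>2 b = 1"
  shows "floquet_discriminant l a u \<mu> z = 1/2 * (\<phi>1 (b + l) + \<psi>2 (b + l))"
proof -
  interpret V: volterra "pcoef u z" "rcoef u z" "mcoef u z" \<mu> by (rule volterra)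
  obtain \<phi>3 \<psi>3 where 3: "string_vsol z \<phi>3 \<psi>3" "\<phi>3 a = 1" "\<psi>3 a = 0" using V.vsol_exists by blast
  obtain \<phi>4 \<psi>4 where 4: "string_vsol z \<phi>4 \<psi>4" "\<phi>4 a = 0" "\<psi>4 a = 1" using V.vsol_exists by blast
  show ?thesis
    unfolding floquet_discriminant_eq[OF per 3 4]
    using monodromy_trace_base_point[OF per inv 3 4 b1 b2] by simp
qed

end

section \<open>Continuous dependence on the coefficients\<close>

text \<open>The difference of the first components solves the k-th Volterra equation with an
  inhomogeneity that tends to 0 in L^1: the mixed integrals of the fixed limit \<phi> converge
  almost everywhere and are bounded, so dominated convergence applies. The bounds \<open>P\<close>
  and \<open>N\<close> are uniform in k, and so is the weighted estimate. The second component is a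
  mixed integral itself, so its limit at \<open>c\<close> takes convergence at that very
  point.\<close>

lemma volterra_convergence:
  assumes V: "volterra p r m \<mu>" and Vk: "\<And>k. volterra (pk k) (rk k) (mk k) (\<mu>k k)"
    and sol: "vsol p r m \<mu> \<phi> \<psi>" and solk: "\<And>k. vsol (pk k) (rk k) (mk k) (\<mu>k k) (\<phi>k k) (\<psi>k k)"
    and init: "\<And>k. \<phi>k k b = \<phi> b" "\<And>k. \<psi>k k b = \<psi> b" and bc: "b \<le> c"
    and P: "0 \<le> P" "\<And>k t. t \<in> {b..c} \<Longrightarrow> norm (pk k t) \<le> P"
    and pconv: "\<And>t. t \<in> {b..c} \<Longrightarrow> (\<lambda>k. pk k t) \<longlonglongrightarrow> p t"
    and N: "0 \<le> N" "\<And>k s D C. s \<in> {b..c} \<Longrightarrow> locally_bounded_borel D \<Longrightarrow> 0 \<le> C \<Longrightarrow>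
      (\<And>t. b \<le> t \<Longrightarrow> t \<le> s \<Longrightarrow> norm (D t) \<le> C) \<Longrightarrow> norm (mixed_oint (rk k) (mk k) (\<mu>k k) b s D) \<le> N * C"
    and conv: "AE s in lborel. s \<in> {b..c} \<longrightarrow>
      (\<lambda>k. mixed_oint (rk k) (mk k) (\<mu>k k) b s \<phi>) \<longlonglongrightarrow> mixed_oint r m \<mu> b s \<phi>"
    and convc: "(\<lambda>k. mixed_oint (rk k) (mk k) (\<mu>k k) b c \<phi>) \<longlonglongrightarrow> mixed_oint r m \<mu> b c \<phi>"
  shows "(\<lambda>k. \<phi>k k c) \<longlonglongrightarrow> \<phi> c" "(\<lambda>k. \<psi>k k c) \<longlonglongrightarrow> \<psi> c"
proof -
  interpret V: volterra p r m \<mu> by (rule V)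
  interpret Vk: volterra "pk k" "rk k" "mk k" "\<mu>k k" for k by (rule Vk)
  have l: "locally_bounded_borel \<phi>" "locally_bounded_borel \<psi>" using sol by (auto simp: vsol_def)
  have lk: "locally_bounded_borel (\<phi>k k)" "locally_bounded_borel (\<psi>k k)" for k using solk[of k] by (auto simp: vsol_def)
  note lbb = V.lbb Vk.lbb l lk
  let ?Mk = "\<lambda>k s D. mixed_oint (rk k) (mk k) (\<mu>k k) b s D" and ?M = "\<lambda>s. mixed_oint r m \<mu> b s \<phi>"
  define e where "e k s = ?Mk k s \<phi> - ?M s" for k s
  define \<delta> where "\<delta> k s = \<phi>k k s - \<phi> s" for k s
  have l\<delta>: "locally_bounded_borel (\<delta> k)" for k unfolding \<delta>_def[abs_def] by (intro lbb)
  have lM: "locally_bounded_borel ?M" by (rule V.locally_bounded_borel_mixed_oint[OF l(1)])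
  have le: "locally_bounded_borel (e k)" for k
    unfolding e_def[abs_def] by (intro lbb lM Vk.locally_bounded_borel_mixed_oint)
  \<comment> \<open>The inhomogeneity: the error of the mixed integral of the limit solution, and
    the error of the coefficient p. Only the fixed functions \<phi> and \<psi> enter, not the
    solutions that are still to be estimated.\<close>
  define W where "W k s = pk k s * e k s + (pk k s - p s) * \<psi> s" for k s
  have lW: "locally_bounded_borel (W k)" for k unfolding W_def[abs_def] by (intro lbb le)
  have [measurable]: "W k \<in> borel_measurable borel" for k using lW by (rule locally_bounded_borel_measurable)
  have \<psi>diff: "\<psi>k k s - \<psi> s = ?Mk k s (\<delta> k) + e k s" for k s
  proof -
    have "\<psi>k k s - \<psi>k k b = ?Mk k s (\<phi>k k)" "\<psi> s - \<psi> b = ?M s" using solk[of k] sol by (auto simp: vsol_def)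
    moreover have "?Mk k s (\<delta> k) = ?Mk k s (\<phi>k k) - ?Mk k s \<phi>"
      unfolding \<delta>_def[abs_def] by (rule Vk.mixed_oint_diff[OF lk(1) l(1)])
    ultimately show ?thesis using init(2)[of k] by (simp add: e_def algebra_simps)
  qed
  have \<delta>_eq: "\<delta> k x = oint lborel b x (\<lambda>s. pk k s * ?Mk k s (\<delta> k)) + oint lborel b x (W k)" for k x
  proof -
    have "\<phi>k k x - \<phi>k k b = oint lborel b x (\<lambda>t. pk k t * \<psi>k k t)" "\<phi> x - \<phi> b = oint lborel b x (\<lambda>t. p t * \<psi> t)"
      using solk[of k] sol by (auto simp: vsol_def)
    then have "\<delta> k x = oint lborel b x (\<lambda>t. pk k t * \<psi>k k t) - oint lborel b x (\<lambda>t. p t * \<psi> t)"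
      using init(1)[of k] by (simp add: \<delta>_def algebra_simps)
    also have "\<dots> = oint lborel b x (\<lambda>t. pk k t * \<psi>k k t - p t * \<psi> t)"
      by (rule oint_diff[OF Borel_measure_lborel, symmetric]) (intro lbb)+
    also have "\<dots> = oint lborel b x (\<lambda>s. pk k s * ?Mk k s (\<delta> k) + W k s)"
    proof -
      have "pk k t * \<psi>k k t - p t * \<psi> t = pk k t * (\<psi>k k t - \<psi> t) + (pk k t - p t) * \<psi> t" for t
        by (simp add: algebra_simps)
      then show ?thesis by (simp add: \<psi>diff W_def distrib_left add.assoc)
    qed
    also have "\<dots> = oint lborel b x (\<lambda>s. pk k s * ?Mk k s (\<delta> k)) + oint lborel b x (W k)"
      by (rule oint_add[OF Borel_measure_lborel]) (intro lbb lW Vk.locally_bounded_borel_mixed_oint l\<delta>)+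
    finally show ?thesis .
  qed
  obtain C\<phi> where C\<phi>: "C\<phi> > 0" "\<And>t. t \<in> {b..c} \<Longrightarrow> norm (\<phi> t) \<le> C\<phi>" using locally_bounded_borelE[OF l(1)] by metis
  obtain C\<psi> where C\<psi>: "C\<psi> > 0" "\<And>t. t \<in> {b..c} \<Longrightarrow> norm (\<psi> t) \<le> C\<psi>" using locally_bounded_borelE[OF l(2)] by metis
  obtain CM where CM: "CM > 0" "\<And>t. t \<in> {b..c} \<Longrightarrow> norm (?M t) \<le> CM" using locally_bounded_borelE[OF lM] by metis
  define Q where "Q = P * (N * C\<phi> + CM) + (P + P) * C\<psi>"
  have Wb: "norm (W k s) \<le> Q" if s: "s \<in> {b..c}" for k s
  proof -
    have "norm (?Mk k s \<phi>) \<le> N * C\<phi>" using s C\<phi> by (intro N(2) l) auto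
    then have "norm (e k s) \<le> N * C\<phi> + CM"
      unfolding e_def using CM(2)[OF s] norm_triangle_ineq4[of "?Mk k s \<phi>" "?M s"] by linarith
    moreover have "norm (p s) \<le> P"
      by (rule LIMSEQ_le_const2[OF tendsto_norm[OF pconv[OF s]]]) (use P(2)[OF s] in blast)
    then have "norm (pk k s - p s) \<le> P + P"
      using P(2)[OF s, of k] norm_triangle_ineq4[of "pk k s" "p s"] by linarith
    ultimately have "norm (pk k s * e k s) \<le> P * (N * C\<phi> + CM)" "norm ((pk k s - p s) * \<psi> s) \<le> (P + P) * C\<psi>"
      using P C\<psi>(2)[OF s] P(2)[OF s, of k] unfolding norm_mult by (auto intro!: mult_mono)
    then show ?thesis unfolding W_def Q_def by (rule norm_triangle_mono)
  qed
  \<comment> \<open>Convergence off a null set is enough here, since \<open>W\<close> is going to be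
    integrated against dx.\<close>
  have W0: "AE s in lborel. (\<lambda>k. indicator {b..c} s * norm (W k s)) \<longlonglongrightarrow> 0"
    using conv
  proof eventually_elim
    case (elim s)
    show ?case
    proof (cases "s \<in> {b..c}")
      case True
      have "(\<lambda>k. e k s) \<longlonglongrightarrow> ?M s - ?M s" unfolding e_def using elim True by (intro tendsto_intros) auto
      then have "(\<lambda>k. pk k s * e k s + (pk k s - p s) * \<psi> s) \<longlonglongrightarrow> p s * (?M s - ?M s) + (p s - p s) * \<psi> s"
        by (intro tendsto_intros pconv True)
      then have "(\<lambda>k. W k s) \<longlonglongrightarrow> 0" by (simp add: W_def)
      then have "(\<lambda>k. norm (W k s)) \<longlonglongrightarrow> 0" by (rule tendsto_norm_zero)
      then show ?thesis using True by simp
    qed simp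
  qed
  define \<epsilon> where "\<epsilon> k = (LINT s|lborel. indicator {b..c} s * norm (W k s))" for k
  have iW: "integrable lborel (\<lambda>s. indicator {b..c} s * norm (W k s))" for k
    by (rule integrable_bounded_support[OF Borel_measure_lborel, where a=b and b=c and C=Q]) (use Wb in auto)
  have "\<epsilon> \<longlonglongrightarrow> (LINT s|(lborel :: real measure). 0)"
    unfolding \<epsilon>_def
  proof (rule integral_dominated_convergence[where w="\<lambda>s. Q * indicator {b..c} s"])
    show "integrable lborel (\<lambda>s. Q * indicator {b..c} s :: real)"
      by (rule integrable_bounded_support[OF Borel_measure_lborel, where a=b and b=c and C="\<bar>Q\<bar>"]) auto
    show "AE s in lborel. norm (indicator {b..c} s * norm (W k s)) \<le> Q * indicator {b..c} s" for k
      using Wb by (intro AE_I2) (auto simp: indicator_def)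
    show "AE s in lborel. (\<lambda>k. indicator {b..c} s * norm (W k s)) \<longlonglongrightarrow> 0" by (rule W0)
  qed auto
  then have \<epsilon>0: "\<epsilon> \<longlonglongrightarrow> 0" by simp
  have \<epsilon>_nn: "0 \<le> \<epsilon> k" for k unfolding \<epsilon>_def by (intro integral_nonneg_AE) auto
  have oW: "norm (oint lborel b x (W k)) \<le> \<epsilon> k" if x: "x \<in> {b..c}" for k x
  proof -
    have i': "integrable lborel (\<lambda>t. indicator {min b x..<max b x} t * norm (W k t))"
      by (rule integrable_bounded_support[OF Borel_measure_lborel, where a=b and b=c and C=Q])
        (use Wb x Wb[of b] in \<open>auto simp: indicator_def intro: order_trans[OF norm_ge_zero]\<close>)
    have "norm (oint lborel b x (W k)) \<le> (LINT t|lborel. indicator {min b x..<max b x} t * norm (W k t))"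
      by (rule norm_oint_le_integral[OF Borel_measure_lborel lW i']) simp
    also have "\<dots> \<le> \<epsilon> k"
      unfolding \<epsilon>_def using x by (intro integral_mono i' iW) (auto simp: indicator_def)
    finally show ?thesis .
  qed
  define L where "L = 2 * P * N + 1"
  have L: "0 \<le> L" using P N by (simp add: L_def)
  have b: "b \<in> {b..c}" and c: "c \<in> {b..c}" using bc by auto
  have \<delta>_le: "norm (\<delta> k x) \<le> 2 * \<epsilon> k * exp (L * (c - b))" if x: "x \<in> {b..c}" for k x
  proof -
    obtain B where B: "B > 0" "\<And>t. t \<in> {b..c} \<Longrightarrow> norm (\<delta> k t) \<le> B" using locally_bounded_borelE[OF l\<delta>] by metis
    have "norm (\<delta> k x) \<le> 2 * \<epsilon> k * exp (L * \<bar>x - b\<bar>)"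
    proof (rule weighted_gronwall[where D="\<lambda>x. norm (\<delta> k x)" and I="{b..c}" and B=B])
      fix S y assume S: "0 \<le> S" "\<And>t. t \<in> {b..c} \<Longrightarrow> norm (\<delta> k t) \<le> S * exp (L * \<bar>t - b\<bar>)" and y: "y \<in> {b..c}"
      have "norm (?Mk k t (\<delta> k)) \<le> N * (S * exp (L * \<bar>t - b\<bar>))" if t: "t \<in> {b..c}" for t
      proof (rule N(2)[OF t l\<delta>])
        fix w assume w: "b \<le> w" "w \<le> t"
        then have "norm (\<delta> k w) \<le> S * exp (L * \<bar>w - b\<bar>)" using t by (intro S(2)) auto
        also have "\<dots> \<le> S * exp (L * \<bar>t - b\<bar>)" using w S(1) L by (auto intro!: mult_left_mono)
        finally show "norm (\<delta> k w) \<le> S * exp (L * \<bar>t - b\<bar>)" .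
      qed (use S in auto)
      from weighted_contraction[OF Vk.lbb(5) Vk.locally_bounded_borel_mixed_oint[OF l\<delta>] b y P(2) P(1) N(1) S(1) this[unfolded L_def]]
      have "norm (oint lborel b y (\<lambda>s. pk k s * ?Mk k s (\<delta> k))) \<le> S / 2 * exp (L * \<bar>y - b\<bar>)"
        unfolding L_def .
      then show "norm (\<delta> k y) \<le> \<epsilon> k + S / 2 * exp (L * \<bar>y - b\<bar>)"
        using norm_triangle_mono[OF _ oW[OF y, of k]] unfolding \<delta>_eq[of k y] by fastforce
    qed (use B L \<epsilon>_nn x in auto)
    also have "\<dots> \<le> 2 * \<epsilon> k * exp (L * (c - b))"
      using x L \<epsilon>_nn[of k] by (auto intro!: mult_left_mono)
    finally show ?thesis .
  qed
  have "(\<lambda>k. 2 * \<epsilon> k * exp (L * (c - b))) \<longlonglongrightarrow> 2 * 0 * exp (L * (c - b))" by (intro tendsto_intros \<epsilon>0)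
  then have bound0: "(\<lambda>k. 2 * \<epsilon> k * exp (L * (c - b))) \<longlonglongrightarrow> 0" by simp
  have "(\<lambda>k. \<delta> k c) \<longlonglongrightarrow> 0" by (rule LIMSEQ_null_norm_le[OF \<delta>_le[OF c] bound0])
  then show "(\<lambda>k. \<phi>k k c) \<longlonglongrightarrow> \<phi> c" by (simp add: \<delta>_def LIM_zero_iff)
  \<comment> \<open>The second component at \<open>c\<close> splits into the mixed integral of
    \<delta>, small by the uniform estimate just obtained, and the error \<open>e\<close> at the
    single point \<open>c\<close>.\<close>
  have "norm (?Mk k c (\<delta> k)) \<le> N * (2 * \<epsilon> k * exp (L * (c - b)))" for k
    using \<epsilon>_nn[of k] by (intro N(2)[OF c l\<delta>] \<delta>_le) auto
  moreover have "(\<lambda>k. N * (2 * \<epsilon> k * exp (L * (c - b)))) \<longlonglongrightarrow> 0" by (rule tendsto_mult_right_zero[OF bound0])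
  ultimately have "(\<lambda>k. ?Mk k c (\<delta> k)) \<longlonglongrightarrow> 0" by (rule LIMSEQ_null_norm_le)
  moreover have "(\<lambda>k. e k c) \<longlonglongrightarrow> 0" using convc by (simp add: e_def LIM_zero_iff)
  ultimately have "(\<lambda>k. ?Mk k c (\<delta> k) + e k c) \<longlonglongrightarrow> 0 + 0" by (rule tendsto_add)
  then have "(\<lambda>k. \<psi>k k c - \<psi> c) \<longlonglongrightarrow> 0" by (simp only: \<psi>diff[symmetric] add_0)
  then show "(\<lambda>k. \<psi>k k c) \<longlonglongrightarrow> \<psi> c" by (simp add: LIM_zero_iff)
qed

section \<open>Consequences of convergence in the initial topology\<close>

lemma limitin_D_per_functional:
  assumes lim: "limitin (D_per_topology l) (\<lambda>k. (uk k, \<mu>k k)) (u, \<mu>) sequentially"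
    and h: "h \<in> H1_c" and g: "g \<in> C_c"
  shows "(\<lambda>k. omega (uk k) h + (LINT x|\<mu>k k. g x)) \<longlonglongrightarrow> omega u h + (LINT x|\<mu>. g x)"
proof (rule topological_tendstoI)
  fix V :: "complex set" assume V: "open V" "omega u h + (LINT x|\<mu>. g x) \<in> V"
  have D: "(u, \<mu>) \<in> D_per l" using lim by (simp add: limitin_def topspace_D_per_topology)
  let ?U = "{(u, \<mu>) \<in> D_per l. omega u h + (LINT x|\<mu>. g x) \<in> V}"
  have "openin (D_per_topology l) ?U"
    unfolding D_per_topology_def using h g V(1) by (intro topology_generated_by_Basis) blast
  moreover have "(u, \<mu>) \<in> ?U" using D V(2) by auto
  ultimately have "\<forall>\<^sub>F k in sequentially. (uk k, \<mu>k k) \<in> ?U"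
    using lim unfolding limitin_def by blast
  then show "\<forall>\<^sub>F k in sequentially. omega (uk k) h + (LINT x|\<mu>k k. g x) \<in> V"
    by eventually_elim auto
qed

lemma zero_H1_c: "(\<lambda>_. 0) \<in> H1_c"
proof (rule H1_cI)
  have ae: "ae_derivative (\<lambda>_::real. 0 :: complex) (\<lambda>_. 0)" by (simp add: ae_derivative_def)
  have "locally_square_integrable (\<lambda>_. 0 :: complex)"
    by (rule locally_square_integrable_bounded[OF locally_bounded_borel_const])
  moreover have "locally_absolutely_continuous (\<lambda>_::real. 0 :: complex)"
    by (rule locally_absolutely_continuous_lipschitz) (auto intro: exI[of _ 0])
  ultimately show "(\<lambda>_. 0 :: complex) \<in> H1_loc" using H1_loc_iff[OF ae] by blast
qed simp

lemma omega_zero: "omega u (\<lambda>_. 0) = 0"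
proof -
  have "vector_derivative (\<lambda>_. 0 :: complex) (at x) = 0" for x :: real by simp
  then show ?thesis by (simp add: omega_def)
qed

lemma C_cI:
  assumes "continuous_on UNIV g" "\<And>t. R \<le> \<bar>t\<bar> \<Longrightarrow> g t = 0"
  shows "g \<in> C_c"
proof -
  have "{x. g x \<noteq> 0} \<subseteq> cball 0 R"
    using assms(2) by (auto simp: dist_norm) (meson le_cases)
  then have "bounded (closure {x. g x \<noteq> 0})"
    by (meson bounded_cball bounded_closure bounded_subset)
  then show ?thesis using assms(1) by (simp add: C_c_def compact_support_def compact_eq_bounded_closed)
qed

text \<open>The functionals of the topology couple \<open>u\<close> and \<mu>. Taking h = 0 isolates
  the measure; taking g = 0, as in \<open>limitin_D_per_omega\<close>, isolates
  \<open>u\<close>.\<close>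

lemma limitin_D_per_vague:
  assumes lim: "limitin (D_per_topology l) (\<lambda>k. (uk k, \<mu>k k)) (u, \<mu>) sequentially" and g: "g \<in> C_c"
  shows "(\<lambda>k. LINT x|\<mu>k k. g x) \<longlonglongrightarrow> (LINT x|\<mu>. g x)"
  using limitin_D_per_functional[OF lim zero_H1_c g] by (simp add: omega_zero)

lemma limitin_D_per_omega:
  assumes lim: "limitin (D_per_topology l) (\<lambda>k. (uk k, \<mu>k k)) (u, \<mu>) sequentially" and h: "h \<in> H1_c"
  shows "(\<lambda>k. omega (uk k) h) \<longlonglongrightarrow> omega u h"
proof -
  have "(\<lambda>_. 0) \<in> C_c" by (rule C_cI) auto
  from limitin_D_per_functional[OF lim h this] show ?thesis by simp
qed

lemma D_per_string_data:
  assumes "(u, \<mu>) \<in> D_per l"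
  obtains u' where "string_data u u' \<mu>" "\<And>x. u (x + l) = u x"
    "\<And>B. B \<in> sets borel \<Longrightarrow> emeasure \<mu> ((\<lambda>x. x + l) ` B) = emeasure \<mu> B"
proof -
  have D: "u \<in> H1_loc" "\<And>x. u (x + l) = u x" "Borel_measure \<mu>"
    "\<And>B. B \<in> sets borel \<Longrightarrow> emeasure \<mu> ((\<lambda>x. x + l) ` B) = emeasure \<mu> B"
    "\<And>B. B \<in> sets borel \<Longrightarrow>
       (\<integral>\<^sup>+x\<in>B. ennreal ((u x)\<^sup>2 + (vderiv u x)\<^sup>2) \<partial>lebesgue) \<le> emeasure \<mu> B"
    using assms unfolding D_per_def by auto
  obtain u' where "ae_derivative u u'" using H1_loc_ae_derivative[OF D(1)] by blast
  then show ?thesis using D by (intro that[of u']) (auto simp: string_data_def)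
qed

section \<open>Vague convergence and integrals over intervals\<close>

definition tent :: "real \<Rightarrow> real \<Rightarrow> real \<Rightarrow> real" where
  "tent y \<eta> t = max 0 (1 - \<bar>t - y\<bar> / \<eta>)"

lemma tent_bounds: "0 \<le> tent y \<eta> t" "0 < \<eta> \<Longrightarrow> tent y \<eta> t \<le> 1"
  by (auto simp: tent_def)

lemma tent_eq_0: "0 < \<eta> \<Longrightarrow> \<bar>y\<bar> + \<eta> \<le> \<bar>t\<bar> \<Longrightarrow> tent y \<eta> t = 0"
  by (auto simp: tent_def max_def field_simps abs_if split: if_splits)

lemma tent_continuous: "0 < \<eta> \<Longrightarrow> continuous_on S (tent y \<eta>)"
  unfolding tent_def[abs_def] by (intro continuous_intros) auto

lemma tent_C_c: "0 < \<eta> \<Longrightarrow> (\<lambda>t. complex_of_real (tent y \<eta> t)) \<in> C_c"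
  by (rule C_cI[of _ "\<bar>y\<bar> + \<eta>"]) (auto intro!: continuous_intros tent_continuous tent_eq_0)

lemma tent_measurable: "0 < \<eta> \<Longrightarrow> tent y \<eta> \<in> borel_measurable borel"
  by (intro borel_measurable_continuous_onI tent_continuous)

lemma integrable_tent:
  assumes "Borel_measure M" "0 < \<eta>"
  shows "integrable M (tent y \<eta>)"
proof (rule integrable_bounded_support[OF assms(1) tent_measurable[OF assms(2)]])
  show "norm (tent y \<eta> t) \<le> 1" for t using tent_bounds(1) tent_bounds(2)[OF assms(2)] by simp
  show "tent y \<eta> t = 0" if "t \<notin> {-(\<bar>y\<bar> + \<eta>)..\<bar>y\<bar> + \<eta>}" for t
    using that assms(2) by (intro tent_eq_0) auto
qed

lemma tendsto_integral_tent:
  assumes vague: "\<And>g. g \<in> C_c \<Longrightarrow> (\<lambda>k. LINT x|\<mu>k k. g x) \<longlonglongrightarrow> (LINT x|\<mu>. g x)" and "0 < \<eta>"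
  shows "(\<lambda>k. LINT t|\<mu>k k. tent y \<eta> t) \<longlonglongrightarrow> (LINT t|\<mu>. tent y \<eta> t)"
  using vague[OF tent_C_c[OF assms(2), of y]] by (simp add: tendsto_of_real_iff)

text \<open>Dominated convergence, the tent of width 1 being the majorant. Near a point that is not
  an atom narrow tents thus have small mass; being continuous with compact support, they pass this
  smallness on to the approximating measures.\<close>

lemma tent_shrink:
  assumes "Borel_measure M"
  shows "(\<lambda>n. LINT t|M. tent y (1 / real (Suc n)) t) \<longlonglongrightarrow> measure M {y}"
proof -
  have [measurable_cong, simp]: "sets M = sets borel" "space M = UNIV" using Borel_measureD[OF assms] by auto
  have [measurable]: "tent y (1 / real (Suc n)) \<in> borel_measurable borel" for n by (intro tent_measurable) simp
  have "(\<lambda>n. LINT t|M. tent y (1 / real (Suc n)) t) \<longlonglongrightarrow> (LINT t|M. indicator {y} t)"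
  proof (rule integral_dominated_convergence[where w="\<lambda>t. tent y 1 t"])
    show "integrable M (tent y 1)" by (rule integrable_tent[OF assms]) simp
    show "AE t in M. norm (tent y (1 / real (Suc n)) t) \<le> tent y 1 t" for n
    proof (rule AE_I2)
      fix t
      have "1 - \<bar>t - y\<bar> * (1 + real n) \<le> 1 - \<bar>t - y\<bar>" by (simp add: algebra_simps)
      then show "norm (tent y (1 / real (Suc n)) t) \<le> tent y 1 t" by (auto simp: tent_def)
    qed
    show "AE t in M. (\<lambda>n. tent y (1 / real (Suc n)) t) \<longlonglongrightarrow> indicator {y} t"
    proof (rule AE_I2)
      fix t
      show "(\<lambda>n. tent y (1 / real (Suc n)) t) \<longlonglongrightarrow> indicator {y} t"
      proof (cases "t = y")
        case False
        obtain N :: nat where N: "1 / \<bar>t - y\<bar> \<le> real N" using real_arch_simple by blast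
        have "tent y (1 / real (Suc n)) t = 0" if "N \<le> n" for n
        proof -
          have "1 / \<bar>t - y\<bar> \<le> real (Suc n)" using N that by linarith
          then have "1 \<le> \<bar>t - y\<bar> * real (Suc n)" using False by (simp add: field_simps)
          then show ?thesis by (simp add: tent_def)
        qed
        then have "\<forall>\<^sub>F n in sequentially. tent y (1 / real (Suc n)) t = 0"
          unfolding eventually_sequentially by blast
        then show ?thesis using False by (simp add: tendsto_eventually)
      qed (simp add: tent_def)
    qed
  qed measurable
  then show ?thesis by simp
qed

definition plateau :: "real \<Rightarrow> real \<Rightarrow> real \<Rightarrow> real \<Rightarrow> real" where
  "plateau b s \<eta> t = max 0 (min 1 (min ((t - b) / \<eta>) ((s - t) / \<eta>)))"

text \<open>The plateau differs from the sharp indicator only within distance \<eta> of an end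
  point. A tent of width 2 \<eta> is at least 1/2 there, which explains the doubled width and the
  factor 2.\<close>

lemma plateau_diff_le:
  assumes "0 < \<eta>" "b \<le> s"
  shows "\<bar>orient b s t - plateau b s \<eta> t\<bar> \<le> 2 * tent b (2 * \<eta>) t + 2 * tent s (2 * \<eta>) t"
proof (cases "b \<le> t \<and> t < s")
  case True
  then have o: "orient b s t = 1" by (simp add: orient_def)
  show ?thesis
  proof (cases "\<eta> \<le> t - b \<and> \<eta> \<le> s - t")
    case True
    then have "plateau b s \<eta> t = 1" using assms by (simp add: plateau_def)
    then show ?thesis using o tent_bounds(1)[of b "2 * \<eta>" t] tent_bounds(1)[of s "2 * \<eta>" t] by simp
  next
    case False
    have p: "0 \<le> plateau b s \<eta> t" "plateau b s \<eta> t \<le> 1" by (auto simp: plateau_def)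
    from False have "1 \<le> 2 * tent b (2 * \<eta>) t \<or> 1 \<le> 2 * tent s (2 * \<eta>) t"
    proof (cases "t - b < \<eta>")
      case True
      then have "\<bar>t - b\<bar> / (2 * \<eta>) \<le> 1 / 2" using assms \<open>b \<le> t \<and> t < s\<close> by (simp add: field_simps)
      then show ?thesis by (auto simp: tent_def)
    next
      case False
      then have "\<bar>t - s\<bar> / (2 * \<eta>) \<le> 1 / 2"
        using \<open>\<not> (\<eta> \<le> t - b \<and> \<eta> \<le> s - t)\<close> assms \<open>b \<le> t \<and> t < s\<close> by (simp add: field_simps)
      then show ?thesis by (auto simp: tent_def)
    qed
    then show ?thesis using o p tent_bounds(1)[of b "2 * \<eta>" t] tent_bounds(1)[of s "2 * \<eta>" t] by (auto simp: abs_le_iff)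
  qed
next
  case False
  then have "orient b s t = 0" using assms by (auto simp: orient_def)
  moreover have "plateau b s \<eta> t = 0"
  proof -
    have "(t - b) / \<eta> \<le> 0 \<or> (s - t) / \<eta> \<le> 0" using False assms(1) by (auto simp: divide_le_0_iff)
    then show ?thesis by (auto simp: plateau_def)
  qed
  ultimately show ?thesis using tent_bounds(1)[of b "2 * \<eta>" t] tent_bounds(1)[of s "2 * \<eta>" t] by simp
qed

lemma plateau_properties:
  assumes "0 < \<eta>"
  shows "continuous_on S (plateau b s \<eta>)" "\<bar>plateau b s \<eta> t\<bar> \<le> 1" "t \<notin> {b<..<s} \<Longrightarrow> plateau b s \<eta> t = 0"
proof -
  show "continuous_on S (plateau b s \<eta>)" unfolding plateau_def[abs_def]
    using assms by (intro continuous_intros) auto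
  show "\<bar>plateau b s \<eta> t\<bar> \<le> 1" by (auto simp: plateau_def)
  assume "t \<notin> {b<..<s}"
  then have "(t - b) / \<eta> \<le> 0 \<or> (s - t) / \<eta> \<le> 0" using assms(1) by (auto simp: divide_le_0_iff)
  then show "plateau b s \<eta> t = 0" by (auto simp: plateau_def)
qed

text \<open>The smoothing error is expressed by integrals of continuous functions with compact
  support, so that it can be passed to the limit in the measure as well.\<close>

lemma oint_plateau_le:
  assumes M: "Borel_measure M" and F: "continuous_on UNIV F" and bs: "b \<le> s" and \<eta>: "0 < \<eta>"
    and C: "0 \<le> C" "\<And>t. t \<in> {b..s} \<Longrightarrow> norm (F t) \<le> C"
  shows "norm (oint M b s F - (LINT t|M. of_real (plateau b s \<eta> t) * F t)) \<le>
    2 * C * ((LINT t|M. tent b (2 * \<eta>) t) + (LINT t|M. tent s (2 * \<eta>) t))"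
proof -
  have lF: "locally_bounded_borel F" by (rule locally_bounded_borel_continuous[OF F])
  have 2: "0 < 2 * \<eta>" using \<eta> by simp
  have [measurable]: "F \<in> borel_measurable borel" "plateau b s \<eta> \<in> borel_measurable borel"
    using F plateau_properties(1)[OF \<eta>] by (auto intro: borel_measurable_continuous_onI)
  have ip: "integrable M (\<lambda>t. of_real (plateau b s \<eta> t) * F t)"
  proof (rule integrable_bounded_support[OF M, where a=b and b=s and C=C])
    show "norm (of_real (plateau b s \<eta> t) * F t) \<le> C" if "t \<in> {b..s}" for t
      using C(2)[OF that] plateau_properties(2)[OF \<eta>, of b s t] mult_mono[of "\<bar>plateau b s \<eta> t\<bar>" 1 "norm (F t)" C] C(1)
      by (simp add: norm_mult)
    show "of_real (plateau b s \<eta> t) * F t = 0" if "t \<notin> {b..s}" for t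
      using plateau_properties(3)[OF \<eta>, of t b s] that by auto
  qed measurable
  have "oint M b s F - (LINT t|M. of_real (plateau b s \<eta> t) * F t) =
      (LINT t|M. orient b s t *\<^sub>R F t - of_real (plateau b s \<eta> t) * F t)"
    unfolding oint_def by (rule Bochner_Integration.integral_diff[OF integrable_oint[OF M lF] ip, symmetric])
  also have "norm \<dots> \<le> (LINT t|M. norm (orient b s t *\<^sub>R F t - of_real (plateau b s \<eta> t) * F t))"
    by (rule integral_norm_bound)
  also have "\<dots> \<le> (LINT t|M. C * (2 * tent b (2 * \<eta>) t + 2 * tent s (2 * \<eta>) t))"
  proof (rule integral_mono)
    show "integrable M (\<lambda>t. norm (orient b s t *\<^sub>R F t - of_real (plateau b s \<eta> t) * F t))"
      by (intro integrable_norm Bochner_Integration.integrable_diff integrable_oint[OF M lF] ip)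
    show "integrable M (\<lambda>t. C * (2 * tent b (2 * \<eta>) t + 2 * tent s (2 * \<eta>) t))"
      by (intro integrable_mult_right Bochner_Integration.integrable_add integrable_tent[OF M 2])
    fix t
    have eq: "norm (orient b s t *\<^sub>R F t - of_real (plateau b s \<eta> t) * F t) = \<bar>orient b s t - plateau b s \<eta> t\<bar> * norm (F t)"
      by (simp add: scaleR_conv_of_real left_diff_distrib[symmetric] of_real_diff[symmetric] norm_mult del: of_real_diff)
    show "norm (orient b s t *\<^sub>R F t - of_real (plateau b s \<eta> t) * F t) \<le> C * (2 * tent b (2 * \<eta>) t + 2 * tent s (2 * \<eta>) t)"
    proof (cases "t \<in> {b..s}")
      case True
      then show ?thesis unfolding eq
        using plateau_diff_le[OF \<eta> bs, of t] C mult_mono[of "\<bar>orient b s t - plateau b s \<eta> t\<bar>" "2 * tent b (2 * \<eta>) t + 2 * tent s (2 * \<eta>) t" "norm (F t)" C]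
        by (simp add: mult.commute tent_bounds)
    next
      case False
      then have "orient b s t = 0" "plateau b s \<eta> t = 0"
        using bs plateau_properties(3)[OF \<eta>, of t b s] by (auto simp: orient_def)
      then show ?thesis unfolding eq using C(1) by (simp add: tent_bounds)
    qed
  qed
  also have "\<dots> = 2 * C * ((LINT t|M. tent b (2 * \<eta>) t) + (LINT t|M. tent s (2 * \<eta>) t))"
    using integrable_tent[OF M 2] by (simp add: algebra_simps)
  finally show ?thesis .
qed

text \<open>With the interval smoothed to a plateau, vague convergence applies. The smoothing error
  is controlled by tents at the end points: it is small for \<mu> because these are not atoms, and
  then for \<mu>_k with large k because the tent integrals converge too.\<close>

lemma oint_vague:
  assumes M: "Borel_measure \<mu>" and Mk: "\<And>k. Borel_measure (\<mu>k k)"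
    and vague: "\<And>g. g \<in> C_c \<Longrightarrow> (\<lambda>k. LINT x|\<mu>k k. g x) \<longlonglongrightarrow> (LINT x|\<mu>. g x)"
    and F: "continuous_on UNIV F" and bs: "b \<le> s" and atoms: "measure \<mu> {b} = 0" "measure \<mu> {s} = 0"
  shows "(\<lambda>k. oint (\<mu>k k) b s F) \<longlonglongrightarrow> oint \<mu> b s F"
proof (rule metric_LIMSEQ_I)
  fix e :: real assume "0 < e"
  obtain C where C: "C > 0" "\<And>x. x \<in> {b..s} \<Longrightarrow> norm (F x) \<le> C" using continuous_bounded_Icc[OF F] by metis
  let ?T = "\<lambda>M \<eta>. (LINT t|M. tent b (2 * \<eta>) t) + (LINT t|M. tent s (2 * \<eta>) t)"
  have "(\<lambda>n. (LINT t|\<mu>. tent b (1 / real (Suc n)) t) + (LINT t|\<mu>. tent s (1 / real (Suc n)) t)) \<longlonglongrightarrow> measure \<mu> {b} + measure \<mu> {s}"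
    by (intro tendsto_add tent_shrink M)
  then have "(\<lambda>n. 2 * C * ((LINT t|\<mu>. tent b (1 / real (Suc n)) t) + (LINT t|\<mu>. tent s (1 / real (Suc n)) t))) \<longlonglongrightarrow> 0"
    using atoms by (intro tendsto_mult_right_zero) simp
  then have "\<forall>\<^sub>F n in sequentially. 2 * C * ((LINT t|\<mu>. tent b (1 / real (Suc n)) t) + (LINT t|\<mu>. tent s (1 / real (Suc n)) t)) < e / 4"
    using \<open>0 < e\<close> by (intro order_tendstoD(2)[of _ 0]) auto
  then obtain n where n: "2 * C * ((LINT t|\<mu>. tent b (1 / real (Suc n)) t) + (LINT t|\<mu>. tent s (1 / real (Suc n)) t)) < e / 4"
    unfolding eventually_sequentially by blast
  \<comment> \<open>Half the width found for the tents, since \<open>oint_plateau_le\<close> uses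
    tents of width 2 \<eta>.\<close>
  define \<eta> where "\<eta> = 1 / (2 * real (Suc n))"
  have \<eta>: "0 < \<eta>" and 2: "0 < 2 * \<eta>" and \<eta>2: "2 * \<eta> = 1 / real (Suc n)" by (auto simp: \<eta>_def field_simps)
  have T: "2 * C * ?T \<mu> \<eta> < e / 4" unfolding \<eta>2 by (rule n)
  have "(\<lambda>k. 2 * C * ?T (\<mu>k k) \<eta>) \<longlonglongrightarrow> 2 * C * ?T \<mu> \<eta>"
    by (intro tendsto_mult tendsto_add tendsto_const tendsto_integral_tent vague 2)
  then have ev1: "\<forall>\<^sub>F k in sequentially. 2 * C * ?T (\<mu>k k) \<eta> < e / 4" by (rule order_tendstoD(2)[OF _ T])
  let ?G = "\<lambda>t. of_real (plateau b s \<eta> t) * F t"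
  have "?G \<in> C_c"
  proof (rule C_cI[of _ "\<bar>b\<bar> + \<bar>s\<bar>"])
    show "continuous_on UNIV ?G" by (intro continuous_intros plateau_properties(1) \<eta> F)
    show "?G t = 0" if "\<bar>b\<bar> + \<bar>s\<bar> \<le> \<bar>t\<bar>" for t
    proof -
      have "t \<notin> {b<..<s}" using that by auto
      then show ?thesis using plateau_properties(3)[OF \<eta>] by simp
    qed
  qed
  from vague[OF this] have ev2: "\<forall>\<^sub>F k in sequentially. dist (LINT t|\<mu>k k. ?G t) (LINT t|\<mu>. ?G t) < e / 4"
    using \<open>0 < e\<close> by (intro tendstoD) auto
  have "\<forall>\<^sub>F k in sequentially. dist (oint (\<mu>k k) b s F) (oint \<mu> b s F) < e"
    using ev1 ev2
  proof eventually_elim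
    case (elim k)
    have "dist (oint (\<mu>k k) b s F) (LINT t|\<mu>k k. ?G t) < e / 4"
      using oint_plateau_le[OF Mk F bs \<eta> _ C(2), of k] C(1) elim(1) unfolding dist_norm by simp
    moreover have "dist (oint \<mu> b s F) (LINT t|\<mu>. ?G t) < e / 4"
      using oint_plateau_le[OF M F bs \<eta> _ C(2)] C(1) T unfolding dist_norm by simp
    ultimately show ?case
      using elim(2) dist_triangle[of "oint (\<mu>k k) b s F" "oint \<mu> b s F" "LINT t|\<mu>k k. ?G t"]
        dist_triangle2[of "LINT t|\<mu>k k. ?G t" "oint \<mu> b s F" "LINT t|\<mu>. ?G t"] \<open>0 < e\<close>
      by simp
  qed
  then show "\<exists>N. \<forall>k\<ge>N. dist (oint (\<mu>k k) b s F) (oint \<mu> b s F) < e" by (simp add: eventually_sequentially)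
qed

text \<open>Twice a tent of width 2 r dominates the indicator of [b, c], because points of [b, c]
  have modulus at most r. The tent integrals converge and are therefore bounded.\<close>

lemma vague_measure_bounded:
  assumes Mk: "\<And>k. Borel_measure (\<mu>k k)"
    and vague: "\<And>g. g \<in> C_c \<Longrightarrow> (\<lambda>k. LINT x|\<mu>k k. g x) \<longlonglongrightarrow> (LINT x|\<mu>. g x)"
  obtains B where "0 \<le> B" "\<And>k. measure (\<mu>k k) {b..c} \<le> B"
proof -
  define r where "r = \<bar>b\<bar> + \<bar>c\<bar> + 1"
  have r: "0 < 2 * r" by (simp add: r_def)
  have "Bseq (\<lambda>k. 2 * (LINT t|\<mu>k k. tent 0 (2 * r) t))"
  proof (rule convergent_imp_Bseq, rule convergentI, rule tendsto_mult[OF tendsto_const])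
    show "(\<lambda>k. LINT t|\<mu>k k. tent 0 (2 * r) t) \<longlonglongrightarrow> (LINT t|\<mu>. tent 0 (2 * r) t)"
      by (rule tendsto_integral_tent[OF _ r]) (rule vague)
  qed
  then obtain B where B: "B > 0" "\<And>k. \<bar>2 * (LINT t|\<mu>k k. tent 0 (2 * r) t)\<bar> \<le> B"
    unfolding Bseq_def by auto
  have "measure (\<mu>k k) {b..c} \<le> B" for k
  proof -
    have [simp]: "sets (\<mu>k k) = sets borel" "space (\<mu>k k) = UNIV" using Borel_measureD[OF Mk] by auto
    have "measure (\<mu>k k) {b..c} = (LINT t|\<mu>k k. indicator {b..c} t)" by simp
    also have "\<dots> \<le> (LINT t|\<mu>k k. 2 * tent 0 (2 * r) t)"
    proof (rule integral_mono)
      show "integrable (\<mu>k k) (indicator {b..c} :: real \<Rightarrow> real)"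
        using Borel_measureD(3)[OF Mk, of k b c] by (auto simp: integrable_indicator_iff)
      show "integrable (\<mu>k k) (\<lambda>t. 2 * tent 0 (2 * r) t)"
        by (intro integrable_mult_right integrable_tent[OF Mk r])
      show "indicator {b..c} t \<le> 2 * tent 0 (2 * r) t" for t
      proof (cases "t \<in> {b..c}")
        case True
        then have "\<bar>t\<bar> \<le> r" by (auto simp: r_def)
        then have "\<bar>t\<bar> / (2 * r) \<le> 1 / 2" using r by (simp add: field_simps)
        then show ?thesis using True by (auto simp: tent_def)
      qed (simp add: tent_bounds)
    qed
    also have "\<dots> \<le> B" using B(2)[of k] by simp
    finally show ?thesis .
  qed
  then show ?thesis using B(1) by (intro that[of B]) auto
qed

text \<open>On bounded intervals the measure is finite and so has only countably many atoms;
  countably many such intervals exhaust the line.\<close>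

lemma countable_atoms:
  assumes "Borel_measure M"
  shows "countable {x. measure M {x} \<noteq> 0}"
proof -
  have [simp]: "sets M = sets borel" "space M = UNIV" using Borel_measureD[OF assms] by auto
  have "countable {x. measure (restrict_space M {-real n..real n}) {x} \<noteq> 0}" for n :: nat
  proof -
    interpret finite_measure "restrict_space M {-real n..real n}"
      using Borel_measureD(3)[OF assms, of "- real n" "real n"]
      by (intro finite_measureI) (auto simp: emeasure_restrict_space space_restrict_space less_top)
    show ?thesis by (rule countable_support)
  qed
  then have "countable (\<Union>n::nat. {x. measure (restrict_space M {-real n..real n}) {x} \<noteq> 0})" by blast
  moreover have "{x. measure M {x} \<noteq> 0} \<subseteq> (\<Union>n::nat. {x. measure (restrict_space M {-real n..real n}) {x} \<noteq> 0})"
  proof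
    fix x assume "x \<in> {x. measure M {x} \<noteq> 0}"
    moreover obtain n :: nat where "\<bar>x\<bar> \<le> real n" using real_arch_simple by blast
    then have "x \<in> {-real n..real n}" by auto
    then have "measure (restrict_space M {-real n..real n}) {x} = measure M {x}"
      by (intro measure_restrict_space) auto
    ultimately show "x \<in> (\<Union>n::nat. {x. measure (restrict_space M {-real n..real n}) {x} \<noteq> 0})"
      by (intro UN_I[of n]) auto
  qed
  ultimately show ?thesis by (rule countable_subset[rotated])
qed

lemma AE_non_atom:
  assumes "Borel_measure M"
  shows "AE x in lborel. measure M {x} = 0"
  by (rule AE_I'[OF countable_imp_null_set_lborel[OF countable_atoms[OF assms]]]) auto

text \<open>If uniform convergence fails, there are points where the distance stays at least e for
  infinitely many k, and compactness lets them converge along a further subsequence. The indices of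
  these bad points are not all of the naturals, which is why the hypothesis allows subsequences of
  \<open>F\<close>.\<close>

lemma uniform_limit_of_sequential:
  fixes F :: "nat \<Rightarrow> 'a::metric_space \<Rightarrow> 'b::metric_space"
  assumes K: "compact K"
    and F: "\<And>(r :: nat \<Rightarrow> nat) x x0. strict_mono r \<Longrightarrow> (\<And>j. x j \<in> K) \<Longrightarrow> x0 \<in> K \<Longrightarrow> x \<longlonglongrightarrow> x0 \<Longrightarrow>
      (\<lambda>j. F (r j) (x j)) \<longlonglongrightarrow> G x0"
    and G: "\<And>x x0. (\<And>j. x j \<in> K) \<Longrightarrow> x0 \<in> K \<Longrightarrow> x \<longlonglongrightarrow> x0 \<Longrightarrow> (\<lambda>j. G (x j)) \<longlonglongrightarrow> G x0"
  shows "uniform_limit K F G sequentially"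
proof (rule ccontr)
  assume "\<not> uniform_limit K F G sequentially"
  then obtain e where e: "e > 0" "\<not> (\<forall>\<^sub>F k in sequentially. \<forall>x\<in>K. dist (F k x) (G x) < e)"
    unfolding uniform_limit_iff by blast
  define S where "S = {k. \<exists>x\<in>K. \<not> dist (F k x) (G x) < e}"
  have "infinite S"
  proof
    assume "finite S"
    then obtain N where N: "\<forall>k\<in>S. k < N" using finite_nat_set_iff_bounded[THEN iffD1] by metis
    have "\<forall>k\<ge>N. \<forall>x\<in>K. dist (F k x) (G x) < e"
    proof (intro allI impI)
      fix k assume "N \<le> k"
      then have "k \<notin> S" using N by (meson leD)
      then show "\<forall>x\<in>K. dist (F k x) (G x) < e" by (simp add: S_def)
    qed
    then show False using e(2) unfolding eventually_sequentially by blast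
  qed
  then obtain r :: "nat \<Rightarrow> nat" where r: "strict_mono r" "\<And>n. r n \<in> S" using infinite_enumerate by blast
  then obtain x where x: "\<And>n. x n \<in> K" "\<And>n. \<not> dist (F (r n) (x n)) (G (x n)) < e"
    unfolding S_def by (simp only: mem_Collect_eq Bex_def) metis
  obtain x0 q where q: "x0 \<in> K" "strict_mono (q :: nat \<Rightarrow> nat)" "(x \<circ> q) \<longlonglongrightarrow> x0"
    using K x(1) unfolding compact_def by blast
  have "(\<lambda>j. F ((r \<circ> q) j) ((x \<circ> q) j)) \<longlonglongrightarrow> G x0"
    using x(1) by (intro F strict_mono_o r q) auto
  moreover have "(\<lambda>j. G ((x \<circ> q) j)) \<longlonglongrightarrow> G x0"
    using x(1) by (intro G q) auto
  ultimately have "(\<lambda>j. dist (F ((r \<circ> q) j) ((x \<circ> q) j)) (G ((x \<circ> q) j))) \<longlonglongrightarrow> dist (G x0) (G x0)"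
    by (rule tendsto_dist)
  then have "\<forall>\<^sub>F j in sequentially. dist (F ((r \<circ> q) j) ((x \<circ> q) j)) (G ((x \<circ> q) j)) < e"
    using e(1) by (intro order_tendstoD(2)) auto
  then show False using x(2) by (auto simp: eventually_sequentially)
qed

lemma uniform_limit_sequential:
  fixes F :: "nat \<Rightarrow> 'a::metric_space \<Rightarrow> 'b::metric_space"
  assumes "uniform_limit K F G sequentially" "continuous_on K G" "strict_mono (r :: nat \<Rightarrow> nat)"
    and x: "\<And>j. x j \<in> K" "x0 \<in> K" "x \<longlonglongrightarrow> x0"
  shows "(\<lambda>j. F (r j) (x j)) \<longlonglongrightarrow> G x0"
proof (rule metric_LIMSEQ_I)
  fix e :: real assume "0 < e"
  then have "\<forall>\<^sub>F k in sequentially. \<forall>x\<in>K. dist (F k x) (G x) < e / 2"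
    using assms(1) unfolding uniform_limit_iff by (meson half_gt_zero)
  then have "\<forall>\<^sub>F j in sequentially. \<forall>x\<in>K. dist (F (r j) x) (G x) < e / 2"
    by (rule eventually_subseq[OF assms(3)])
  moreover have "(\<lambda>j. G (x j)) \<longlonglongrightarrow> G x0"
    using assms(2) x by (intro continuous_on_tendsto_compose[OF assms(2)]) auto
  then have "\<forall>\<^sub>F j in sequentially. dist (G (x j)) (G x0) < e / 2"
    using \<open>0 < e\<close> by (intro tendstoD) auto
  ultimately have "\<forall>\<^sub>F j in sequentially. dist (F (r j) (x j)) (G x0) < e"
  proof eventually_elim
    case (elim j)
    then show ?case using x(1)[of j] dist_triangle[of "F (r j) (x j)" "G x0" "G (x j)"] by fastforce
  qed
  then show "\<exists>N. \<forall>j\<ge>N. dist (F (r j) (x j)) (G x0) < e" by (simp add: eventually_sequentially)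
qed

section \<open>Point values and modulus of continuity of u\<close>

lemma locally_absolutely_continuous_C1:
  fixes f f' :: "real \<Rightarrow> real"
  assumes "\<And>t. (f has_real_derivative f' t) (at t)" "continuous_on UNIV f'"
  shows "locally_absolutely_continuous f"
proof (rule locally_absolutely_continuous_lipschitz)
  fix a b
  obtain B where B: "\<And>t. t \<in> {a..b} \<Longrightarrow> norm (f' t) \<le> B" using continuous_bounded_Icc[OF assms(2)] by metis
  show "\<exists>L. \<forall>x\<in>{a..b}. \<forall>y\<in>{a..b}. norm (f y - f x) \<le> L * \<bar>y - x\<bar>"
  proof (intro exI ballI)
    fix x y assume "x \<in> {a..b}" "y \<in> {a..b}"
    then show "norm (f y - f x) \<le> B * \<bar>y - x\<bar>"
      using field_differentiable_bound[of "{a..b}" f f' B y x] assms(1) B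
      by (auto intro: has_field_derivative_at_within)
  qed
qed

text \<open>A multiple of the Green function of \<open>1 - d\<^sup>2/dx\<^sup>2\<close> with Dirichlet conditions at distance
  \<open>l\<close> from \<open>x\<close>; periodicity turns the boundary terms into values at \<open>x\<close>.\<close>

definition hump :: "real \<Rightarrow> real \<Rightarrow> real \<Rightarrow> real" where
  "hump l x y = max 0 (sinh (l - \<bar>y - x\<bar>))"

definition hump' :: "real \<Rightarrow> real \<Rightarrow> real \<Rightarrow> real" where
  "hump' l x y = indicator {x - l<..<x} y * cosh (l - x + y) - indicator {x<..<x + l} y * cosh (l + x - y)"

lemma hump_has_derivative:
  assumes "0 < l" "y \<noteq> x - l" "y \<noteq> x" "y \<noteq> x + l"
  shows "(hump l x has_real_derivative hump' l x y) (at y)"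
proof -
  consider "y < x - l \<or> x + l < y" | "x - l < y" "y < x" | "x < y" "y < x + l" using assms by linarith
  then show ?thesis
  proof cases
    case 1
    have "((\<lambda>_. 0) has_real_derivative 0) (at y)" by simp
    then have "(hump l x has_real_derivative 0) (at y)"
    proof (rule has_field_derivative_transform_within[where S=UNIV and d="if y < x - l then x - l - y else y - x - l"])
      show "0 = hump l x t" if "dist t y < (if y < x - l then x - l - y else y - x - l)" for t
        using 1 assms that by (auto simp: hump_def dist_real_def max_def split: if_splits)
    qed (use 1 assms in \<open>auto split: if_splits\<close>)
    moreover have "hump' l x y = 0" using 1 assms by (auto simp: hump'_def indicator_def)
    ultimately show ?thesis by simp
  next
    case 2
    have "((\<lambda>y. sinh (l - x + y)) has_real_derivative cosh (l - x + y)) (at y)"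
      by (auto intro!: derivative_eq_intros)
    then have "(hump l x has_real_derivative cosh (l - x + y)) (at y)"
    proof (rule has_field_derivative_transform_within[where S=UNIV and d="min (y - (x - l)) (x - y)"])
      show "sinh (l - x + t) = hump l x t" if "dist t y < min (y - (x - l)) (x - y)" for t
        using 2 that by (auto simp: hump_def dist_real_def max_def abs_if algebra_simps split: if_splits)
    qed (use 2 in auto)
    then show ?thesis using 2 by (simp add: hump'_def indicator_def)
  next
    case 3
    have "((\<lambda>y. sinh (l + x - y)) has_real_derivative - cosh (l + x - y)) (at y)"
      by (auto intro!: derivative_eq_intros)
    then have "(hump l x has_real_derivative - cosh (l + x - y)) (at y)"
    proof (rule has_field_derivative_transform_within[where S=UNIV and d="min (y - x) (x + l - y)"])
      show "sinh (l + x - t) = hump l x t" if "dist t y < min (y - x) (x + l - y)" for t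
        using 3 that by (auto simp: hump_def dist_real_def max_def abs_if algebra_simps split: if_splits)
    qed (use 3 in auto)
    then show ?thesis using 3 by (simp add: hump'_def indicator_def)
  qed
qed

lemma hump'_measurable [measurable]: "hump' l x \<in> borel_measurable borel"
proof -
  have "continuous_on UNIV (\<lambda>y. cosh (l - x + y))" "continuous_on UNIV (\<lambda>y. cosh (l + x - y))"
    by (intro continuous_intros)+
  then have [measurable]: "(\<lambda>y. cosh (l - x + y)) \<in> borel_measurable borel" "(\<lambda>y. cosh (l + x - y)) \<in> borel_measurable borel"
    by (auto intro: borel_measurable_continuous_onI)
  show ?thesis unfolding hump'_def[abs_def] by measurable
qed

lemma hump_properties:
  assumes "0 < l"
  shows "ae_derivative (\<lambda>y. complex_of_real (hump l x y)) (\<lambda>y. complex_of_real (hump' l x y))"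
    and "(\<lambda>y. complex_of_real (hump l x y)) \<in> H1_c"
    and "continuous_on UNIV (hump l x)"
    and "\<bar>y - x\<bar> \<ge> l \<Longrightarrow> hump l x y = 0"
proof -
  show ae: "ae_derivative (\<lambda>y. complex_of_real (hump l x y)) (\<lambda>y. complex_of_real (hump' l x y))"
    unfolding ae_derivative_def
  proof
    have "AE t in lborel. t \<noteq> x - l \<and> t \<noteq> x \<and> t \<noteq> x + l"
      by (intro AE_conjI AE_lborel_singleton)
    then show "AE y in lborel. ((\<lambda>y. complex_of_real (hump l x y)) has_vector_derivative complex_of_real (hump' l x y)) (at y)"
      by eventually_elim (intro has_vector_derivative_of_real hump_has_derivative assms, auto)
  qed measurable
  have zero: "hump l x y = 0" if "\<bar>y - x\<bar> \<ge> l" for y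
    using that by (simp add: hump_def max_def)
  then show "\<bar>y - x\<bar> \<ge> l \<Longrightarrow> hump l x y = 0" .
  show cont: "continuous_on UNIV (hump l x)" unfolding hump_def[abs_def] by (intro continuous_intros)
  have lac: "locally_absolutely_continuous (\<lambda>y. complex_of_real (hump l x y))"
  proof (rule locally_absolutely_continuous_lipschitz)
    fix a b
    define R where "R = l + \<bar>a\<bar> + \<bar>b\<bar> + \<bar>x\<bar>"
    have "continuous_on UNIV (\<lambda>t::real. cosh t)" by (intro continuous_intros)
    then obtain B where B: "\<And>t. t \<in> {-R..R} \<Longrightarrow> norm (cosh t) \<le> B" using continuous_bounded_Icc by metis
    show "\<exists>L. \<forall>y\<in>{a..b}. \<forall>w\<in>{a..b}. norm (complex_of_real (hump l x w) - complex_of_real (hump l x y)) \<le> L * \<bar>w - y\<bar>"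
    proof (intro exI ballI)
      fix y w assume yw: "y \<in> {a..b}" "w \<in> {a..b}"
      have "\<bar>hump l x w - hump l x y\<bar> \<le> \<bar>sinh (l - \<bar>w - x\<bar>) - sinh (l - \<bar>y - x\<bar>)\<bar>"
        by (auto simp: hump_def max_def)
      also have "\<dots> \<le> B * \<bar>(l - \<bar>w - x\<bar>) - (l - \<bar>y - x\<bar>)\<bar>"
      proof -
        have "l - \<bar>w - x\<bar> \<in> {-R..R}" "l - \<bar>y - x\<bar> \<in> {-R..R}" using yw assms by (auto simp: R_def)
        then have "norm (sinh (l - \<bar>w - x\<bar>) - sinh (l - \<bar>y - x\<bar>)) \<le> B * norm ((l - \<bar>w - x\<bar>) - (l - \<bar>y - x\<bar>))"
          by (intro field_differentiable_bound[where S="{-R..R}" and f=sinh and f'=cosh] B)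
            (auto intro!: derivative_eq_intros)
        then show ?thesis by simp
      qed
      also have "\<dots> \<le> B * \<bar>w - y\<bar>"
      proof (rule mult_left_mono)
        have "0 \<in> {-R..R}" using assms by (simp add: R_def)
        then show "0 \<le> B" using order_trans[OF norm_ge_zero B] by blast
      qed simp
      finally show "norm (complex_of_real (hump l x w) - complex_of_real (hump l x y)) \<le> B * \<bar>w - y\<bar>"
        unfolding of_real_diff[symmetric] norm_of_real .
    qed
  qed
  have "locally_bounded_borel (\<lambda>y. complex_of_real (hump' l x y))"
  proof -
    have ind: "locally_bounded_borel (\<lambda>y. complex_of_real (indicator {p<..<q} y))" for p q
      unfolding locally_bounded_borel_def
    proof (intro conjI allI exI[of _ 1] ballI)
      show "norm (complex_of_real (indicator {p<..<q} y)) \<le> 1" for y by (auto simp: indicator_def)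
    qed measurable
    have "continuous_on UNIV (\<lambda>y. complex_of_real (cosh (l - x + y)))" "continuous_on UNIV (\<lambda>y. complex_of_real (cosh (l + x - y)))"
      by (intro continuous_intros)+
    note c = this[THEN locally_bounded_borel_continuous]
    show ?thesis unfolding hump'_def of_real_diff of_real_mult
      by (intro locally_bounded_borel_intros ind c)
  qed
  then have "(\<lambda>y. complex_of_real (hump l x y)) \<in> H1_loc"
    using H1_loc_iff[OF ae] lac locally_square_integrable_bounded by blast
  then show "(\<lambda>y. complex_of_real (hump l x y)) \<in> H1_c"
    by (rule H1_cI[where R="\<bar>x\<bar> + l"]) (simp, rule zero, linarith)
qed

context string_data
begin

lemma set_integrable_u': "set_integrable lborel {a..b} u'"
  and u_diff: "a \<le> b \<Longrightarrow> u b - u a = (LINT t:{a..b}|lborel. u' t)"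
proof -
  have "indefinite_integral u u'"
    using u' u_lac by (intro locally_absolutely_continuous_indefinite_integral) (auto simp: ae_derivative_def)
  from indefinite_integralD[OF this] show "set_integrable lborel {a..b} u'" "a \<le> b \<Longrightarrow> u b - u a = (LINT t:{a..b}|lborel. u' t)"
    by auto
qed

lemma indefinite_integral_times_C1:
  assumes g: "\<And>t. (g has_real_derivative g' t) (at t)" and g': "continuous_on UNIV g'"
  shows "indefinite_integral (\<lambda>t. u t * g t) (\<lambda>t. u t * g' t + u' t * g t)"
proof (rule locally_absolutely_continuous_indefinite_integral)
  have "continuous_on UNIV g"
    by (meson g DERIV_isCont continuous_at_imp_continuous_on)
  then have [measurable]: "g \<in> borel_measurable borel" "g' \<in> borel_measurable borel" "u \<in> borel_measurable borel" "u' \<in> borel_measurable borel"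
    using g' u_cont u' by (auto simp: ae_derivative_def borel_measurable_continuous_onI)
  show "(\<lambda>t. u t * g' t + u' t * g t) \<in> borel_measurable borel" by measurable
  show "locally_absolutely_continuous (\<lambda>t. u t * g t)"
    by (intro locally_absolutely_continuous_mult u_lac locally_absolutely_continuous_C1[OF g g'])
  have "AE t in lborel. (u has_vector_derivative u' t) (at t)" using u' by (simp add: ae_derivative_def)
  then show "AE t in lborel. ((\<lambda>t. u t * g t) has_vector_derivative u t * g' t + u' t * g t) (at t)"
  proof eventually_elim
    case (elim t)
    then show ?case
      by (intro has_vector_derivative_mult g[unfolded has_real_derivative_iff_has_vector_derivative])
  qed
qed

text \<open>On either side of x the integrand is an exact derivative, of \<open>u\<close> times a
  hyperbolic cosine, because sinh is its own second derivative. The point x contributes 2 cosh l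
  times \<open>u x\<close>, and x - l and x + l contribute -u (x - l) and -u (x + l), both equal to
  -u x.\<close>

lemma omega_hump:
  assumes l: "0 < l" and per: "\<And>x. u (x + l) = u x"
  shows "omega u (\<lambda>y. of_real (hump l x y)) = of_real ((2 * cosh l - 2) * u x)"
proof -
  have [measurable]: "u \<in> borel_measurable borel" "u' \<in> borel_measurable borel" "hump l x \<in> borel_measurable borel"
    using u_cont u' hump_properties(3)[OF l] by (auto simp: ae_derivative_def borel_measurable_continuous_onI)
  define w1 where "w1 y = u y * sinh (l - x + y) + u' y * cosh (l - x + y)" for y
  define w2 where "w2 y = u y * sinh (l + x - y) + u' y * (- cosh (l + x - y))" for y
  have i1: "indefinite_integral (\<lambda>y. u y * cosh (l - x + y)) w1"
    unfolding w1_def[abs_def]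
    by (rule indefinite_integral_times_C1) (auto intro!: derivative_eq_intros continuous_intros)
  have i2: "indefinite_integral (\<lambda>y. u y * (- cosh (l + x - y))) w2"
    unfolding w2_def[abs_def]
    by (rule indefinite_integral_times_C1) (auto intro!: derivative_eq_intros continuous_intros)
  note D1 = indefinite_integralD[OF i1] and D2 = indefinite_integralD[OF i2]
  have [measurable]: "w1 \<in> borel_measurable borel" "w2 \<in> borel_measurable borel" by (rule D1 D2)+
  define I where "I y = indicator {x - l..x} y * w1 y + indicator {x..x + l} y * w2 y" for y
  have [measurable]: "I \<in> borel_measurable borel" unfolding I_def[abs_def] by measurable
  have ii: "integrable lborel (\<lambda>y. indicator {x - l..x} y * w1 y)" "integrable lborel (\<lambda>y. indicator {x..x + l} y * w2 y)"
    using D1(2)[of "x - l" x] D2(2)[of x "x + l"] by (auto simp: set_integrable_def)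
  have "integral\<^sup>L lborel I = (u x * cosh l - u (x - l)) + (- u (x + l) + u x * cosh l)"
    unfolding I_def Bochner_Integration.integral_add[OF ii]
    using D1(3)[of "x - l" x] D2(3)[of x "x + l"] l by (simp add: set_lebesgue_integral_def)
  also have "\<dots> = (2 * cosh l - 2) * u x" using per[of x] per[of "x - l"] by (simp add: algebra_simps)
  finally have val: "integral\<^sup>L lborel I = (2 * cosh l - 2) * u x" .
  define A where "A y = u y * hump l x y" for y
  define B where "B y = u' y * hump' l x y" for y
  have [measurable]: "A \<in> borel_measurable borel" "B \<in> borel_measurable borel" unfolding A_def[abs_def] B_def[abs_def] by measurable
  have AB: "AE y in lborel. A y + B y = I y"
  proof -
    have "AE t in lborel. t \<noteq> x - l \<and> t \<noteq> x \<and> t \<noteq> x + l"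
      by (intro AE_conjI AE_lborel_singleton)
    then show ?thesis
    proof eventually_elim
      case (elim y)
      consider "y < x - l \<or> x + l < y" | "x - l < y" "y < x" | "x < y" "y < x + l" using elim l by linarith
      then show ?case
      proof cases
        case 1
        then have "l \<le> \<bar>y - x\<bar>" using l by auto
        then show ?thesis using 1 l hump_properties(4)[OF l] by (auto simp: A_def B_def I_def hump'_def indicator_def)
      next
        case 2
        then have "hump l x y = sinh (l - x + y)" by (auto simp: hump_def max_def algebra_simps)
        then show ?thesis using 2 by (simp add: A_def B_def I_def hump'_def indicator_def w1_def)
      next
        case 3
        then have "hump l x y = sinh (l + x - y)" by (auto simp: hump_def max_def algebra_simps)
        then show ?thesis using 3 by (simp add: A_def B_def I_def hump'_def indicator_def w2_def)
      qed
    qed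
  qed
  have iI: "integrable lborel I" unfolding I_def by (intro Bochner_Integration.integrable_add ii)
  have iA: "integrable lborel A"
  proof -
    have "continuous_on UNIV A" unfolding A_def[abs_def] by (intro continuous_intros u_cont hump_properties(3) l)
    then obtain C where "\<And>y. y \<in> {x - l..x + l} \<Longrightarrow> norm (A y) \<le> C" using continuous_bounded_Icc by metis
    then show ?thesis
    proof (rule integrable_bounded_support[OF Borel_measure_lborel, rotated])
      show "A y = 0" if "y \<notin> {x - l..x + l}" for y
      proof -
        have "l \<le> \<bar>y - x\<bar>" using that by auto
        then show ?thesis using hump_properties(4)[OF l] by (simp add: A_def)
      qed
    qed measurable
  qed
  have "integrable lborel (\<lambda>y. A y + B y)" using iI AB by (subst integrable_cong_AE[where g=I]) auto
  then have "integrable lborel (\<lambda>y. (A y + B y) - A y)" using iA by (rule Bochner_Integration.integrable_diff)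
  then have iB: "integrable lborel B" by simp
  have "omega u (\<lambda>y. of_real (hump l x y)) = (LINT y|lborel. complex_of_real (A y)) + (LINT y|lborel. complex_of_real (B y))"
    unfolding omega_def
  proof (intro arg_cong2[where f="(+)"] integral_lebesgue_cong)
    have "AE y in lebesgue. vderiv (\<lambda>y. complex_of_real (hump l x y)) y = of_real (hump' l x y)" "AE y in lebesgue. vderiv u y = u' y"
      using ae_derivative_AE_vderiv hump_properties(1)[OF l] u' by auto
    then show "AE y in lebesgue. complex_of_real (vderiv u y) * vderiv (\<lambda>y. complex_of_real (hump l x y)) y = of_real (B y)"
      by eventually_elim (simp add: B_def)
  qed (auto simp: A_def)
  also have "\<dots> = of_real (integral\<^sup>L lborel A + integral\<^sup>L lborel B)" by simp
  also have "integral\<^sup>L lborel A + integral\<^sup>L lborel B = (LINT y|lborel. A y + B y)"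
    by (rule Bochner_Integration.integral_add[OF iA iB, symmetric])
  also have "\<dots> = integral\<^sup>L lborel I" using AB by (intro integral_cong_AE) auto
  finally show ?thesis unfolding val .
qed

text \<open>The inequality |d| \<le> 1 / (2 \<eta>) + \<eta> d^2 / 2, applied to u', replaces
  Cauchy-Schwarz; the integral of the square is bounded by the measure because \<mu> dominates the
  energy. The parameter \<eta> is left free to be balanced later.\<close>

lemma energy_estimate:
  assumes "x \<le> y" and M: "measure \<mu> {x..y} \<le> M" and "0 < \<eta>"
  shows "\<bar>u y - u x\<bar> \<le> ((y - x) / \<eta> + \<eta> * M) / 2"
proof -
  have [measurable]: "u' \<in> borel_measurable borel" using u' by (simp add: ae_derivative_def)
  have [measurable]: "u' \<in> borel_measurable lebesgue" by (simp add: measurable_completion)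
  have isq: "integrable lborel (\<lambda>t. indicator {x..y} t * (u' t)\<^sup>2)"
    using u'_lsi by (simp add: locally_square_integrable_def set_integrable_def)
  have "ennreal (LINT t|lborel. indicator {x..y} t * (u' t)\<^sup>2) = (\<integral>\<^sup>+t. ennreal (indicator {x..y} t * (u' t)\<^sup>2) \<partial>lborel)"
    by (rule nn_integral_eq_integral[OF isq, symmetric]) auto
  also have "\<dots> = (\<integral>\<^sup>+t. ennreal (indicator {x..y} t * (u' t)\<^sup>2) \<partial>lebesgue)" by (simp add: nn_integral_completion)
  also have "\<dots> \<le> (\<integral>\<^sup>+t\<in>{x..y}. ennreal ((u t)\<^sup>2 + (vderiv u t)\<^sup>2) \<partial>lebesgue)"
  proof (rule nn_integral_mono_AE)
    show "AE t in lebesgue. ennreal (indicator {x..y} t * (u' t)\<^sup>2) \<le> ennreal ((u t)\<^sup>2 + (vderiv u t)\<^sup>2) * indicator {x..y} t"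
      using ae_derivative_AE_vderiv[OF u'] by eventually_elim (auto simp: indicator_def intro!: ennreal_leI)
  qed
  also have "\<dots> \<le> emeasure \<mu> {x..y}" by (rule energy_le) simp
  also have "\<dots> = ennreal (measure \<mu> {x..y})"
    using Borel_measureD(3)[OF Borel_\<mu>, of x y] by (intro emeasure_eq_ennreal_measure) auto
  finally have "(LINT t|lborel. indicator {x..y} t * (u' t)\<^sup>2) \<le> measure \<mu> {x..y}"
    by (simp add: ennreal_le_iff)
  then have sq: "(LINT t|lborel. indicator {x..y} t * (u' t)\<^sup>2) \<le> M" using M by simp
  have i1: "integrable lborel (indicator {x..y} :: real \<Rightarrow> real)"
    using Borel_measureD(3)[OF Borel_measure_lborel, of x y] by (auto simp: integrable_indicator_iff)
  have "\<bar>u y - u x\<bar> = norm (LINT t|lborel. indicator {x..y} t *\<^sub>R u' t)"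
    using u_diff[OF assms(1)] by (simp add: set_lebesgue_integral_def)
  also have "\<dots> \<le> (LINT t|lborel. norm (indicator {x..y} t *\<^sub>R u' t))" by (rule integral_norm_bound)
  also have "\<dots> \<le> (LINT t|lborel. 1 / (2 * \<eta>) * indicator {x..y} t + \<eta> / 2 * (indicator {x..y} t * (u' t)\<^sup>2))"
  proof (rule integral_mono)
    show "integrable lborel (\<lambda>t. norm (indicator {x..y} t *\<^sub>R u' t))"
      using set_integrable_u'[of x y] by (intro integrable_norm) (simp add: set_integrable_def)
    show "integrable lborel (\<lambda>t. 1 / (2 * \<eta>) * indicator {x..y} t + \<eta> / 2 * (indicator {x..y} t * (u' t)\<^sup>2))"
      by (intro Bochner_Integration.integrable_add integrable_mult_right i1 isq)
    have "\<bar>d\<bar> \<le> 1 / (2 * \<eta>) + \<eta> / 2 * d\<^sup>2" for d :: real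
    proof -
      have "0 \<le> (1 - \<eta> * \<bar>d\<bar>)\<^sup>2" by simp
      then have "2 * \<eta> * \<bar>d\<bar> \<le> 1 + \<eta>\<^sup>2 * d\<^sup>2" by (simp add: power2_diff power_mult_distrib)
      then show ?thesis using \<open>0 < \<eta>\<close> by (simp add: field_simps power2_eq_square)
    qed
    then show "norm (indicator {x..y} t *\<^sub>R u' t) \<le> 1 / (2 * \<eta>) * indicator {x..y} t + \<eta> / 2 * (indicator {x..y} t * (u' t)\<^sup>2)" for t
      by (auto simp: indicator_def)
  qed
  also have "\<dots> = 1 / (2 * \<eta>) * (LINT t|lborel. indicator {x..y} t) + \<eta> / 2 * (LINT t|lborel. indicator {x..y} t * (u' t)\<^sup>2)"
    by (subst Bochner_Integration.integral_add) (intro integrable_mult_right i1 isq | simp)+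
  also have "\<dots> \<le> 1 / (2 * \<eta>) * (y - x) + \<eta> / 2 * M"
    using sq assms by (intro add_mono mult_left_mono) auto
  also have "\<dots> = ((y - x) / \<eta> + \<eta> * M) / 2" by (simp add: add_divide_distrib)
  finally show ?thesis .
qed

text \<open>The constant depends only on a bound for the mass of [b, c]. Along a sequence with
  bounded masses the estimate is therefore equicontinuity.\<close>

lemma holder_estimate:
  assumes "x \<in> {b..c}" "y \<in> {b..c}" and M: "measure \<mu> {b..c} \<le> M"
  shows "\<bar>u y - u x\<bar> \<le> sqrt \<bar>y - x\<bar> * ((1 + M) / 2)"
proof -
  have main: "\<bar>u y - u x\<bar> \<le> sqrt \<bar>y - x\<bar> * ((1 + M) / 2)"
    if xy: "x \<in> {b..c}" "y \<in> {b..c}" "x < y" for x y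
  proof -
    have [simp]: "sets \<mu> = sets borel" using Borel_measureD[OF Borel_\<mu>] by simp
    have "measure \<mu> {x..y} \<le> measure \<mu> {b..c}"
      using xy Borel_measureD(3)[OF Borel_\<mu>, of b c] by (intro measure_mono_fmeasurable) (auto simp: fmeasurable_def)
    \<comment> \<open>The choice \<eta> = sqrt (y - x) gives both terms of
      \<open>energy_estimate\<close> the same order.\<close>
    then have "\<bar>u y - u x\<bar> \<le> ((y - x) / sqrt (y - x) + sqrt (y - x) * M) / 2"
      using xy M by (intro energy_estimate) auto
    also have "(y - x) / sqrt (y - x) = sqrt (y - x)" using xy by (simp add: real_div_sqrt)
    finally show ?thesis using xy by (simp add: algebra_simps)
  qed
  consider "x < y" | "x = y" | "y < x" by linarith
  then show ?thesis
  proof cases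
    case 3
    then show ?thesis using main[OF assms(2,1) 3] by (simp add: abs_minus_commute)
  qed (use main[OF assms(1,2)] in auto)
qed

end

section \<open>Convergent sequences of pairs and their discriminants\<close>

lemma limitin_D_per_pointwise:
  assumes l: "0 < l" and lim: "limitin (D_per_topology l) (\<lambda>k. (uk k, \<mu>k k)) (u, \<mu>) sequentially"
    and Dk: "\<And>k. (uk k, \<mu>k k) \<in> D_per l"
  shows "(\<lambda>k. uk k x) \<longlonglongrightarrow> u x"
proof -
  have val: "omega v (\<lambda>y. of_real (hump l x y)) = of_real ((2 * cosh l - 2) * v x)" if D: "(v, \<nu>) \<in> D_per l" for v \<nu>
  proof (rule D_per_string_data[OF D])
    fix v' assume "string_data v v' \<nu>" "\<And>x. v (x + l) = v x"
    then show ?thesis using string_data.omega_hump[of v v' \<nu> l x] l by blast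
  qed
  have D: "(u, \<mu>) \<in> D_per l" using lim by (simp add: limitin_def topspace_D_per_topology)
  have "(\<lambda>k. complex_of_real ((2 * cosh l - 2) * uk k x)) \<longlonglongrightarrow> of_real ((2 * cosh l - 2) * u x)"
    using limitin_D_per_omega[OF lim hump_properties(2)[OF l, of x]] unfolding val[OF D] val[OF Dk] .
  then have "(\<lambda>k. (2 * cosh l - 2) * uk k x) \<longlonglongrightarrow> (2 * cosh l - 2) * u x"
    by (simp only: tendsto_of_real_iff)
  \<comment> \<open>The factor is nonzero because cosh l exceeds 1 for l > 0.\<close>
  then have "(\<lambda>k. (2 * cosh l - 2) * uk k x / (2 * cosh l - 2)) \<longlonglongrightarrow> (2 * cosh l - 2) * u x / (2 * cosh l - 2)"
    using l by (intro tendsto_divide) auto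
  then show ?thesis using l by simp
qed

text \<open>Vague convergence bounds the masses, the masses bound the Hoelder constants, and these
  together with the convergent values at b bound the functions themselves.\<close>

lemma limitin_D_per_bounds:
  assumes l: "0 < l" and lim: "limitin (D_per_topology l) (\<lambda>k. (uk k, \<mu>k k)) (u, \<mu>) sequentially"
    and Dk: "\<And>k. (uk k, \<mu>k k) \<in> D_per l"
  obtains M where "0 \<le> M" "\<And>k. measure (\<mu>k k) {b..c} \<le> M"
    "\<And>k x y. x \<in> {b..c} \<Longrightarrow> y \<in> {b..c} \<Longrightarrow> \<bar>uk k y - uk k x\<bar> \<le> sqrt \<bar>y - x\<bar> * M"
    "\<And>k x. x \<in> {b..c} \<Longrightarrow> \<bar>uk k x\<bar> \<le> M"
proof -
  have Bk: "Borel_measure (\<mu>k k)" for k using Dk[of k] by (simp add: D_per_def)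
  obtain B where B: "0 \<le> B" "\<And>k. measure (\<mu>k k) {b..c} \<le> B"
  proof (rule vague_measure_bounded[of \<mu>k \<mu> b c])
    show "Borel_measure (\<mu>k k)" for k by (rule Bk)
    show "(\<lambda>k. LINT x|\<mu>k k. g x) \<longlonglongrightarrow> (LINT x|\<mu>. g x)" if "g \<in> C_c" for g
      by (rule limitin_D_per_vague[OF lim that])
  qed (erule that)
  have H: "\<bar>uk k y - uk k x\<bar> \<le> sqrt \<bar>y - x\<bar> * ((1 + B) / 2)" if "x \<in> {b..c}" "y \<in> {b..c}" for k x y
  proof (rule D_per_string_data[OF Dk[of k]])
    fix v' assume "string_data (uk k) v' (\<mu>k k)"
    then show ?thesis by (rule string_data.holder_estimate[OF _ that B(2)])
  qed
  have "Bseq (\<lambda>k. uk k b)"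
    by (rule convergent_imp_Bseq[OF convergentI[OF limitin_D_per_pointwise[OF l lim Dk]]])
  then obtain A where A: "A > 0" "\<And>k. \<bar>uk k b\<bar> \<le> A" unfolding Bseq_def by auto
  define Q where "Q = sqrt \<bar>c - b\<bar> * ((1 + B) / 2)"
  have Q: "0 \<le> Q" using B by (simp add: Q_def)
  have b2: "0 \<le> (1 + B) / 2" using B by simp
  \<comment> \<open>A sum of the separate nonnegative bounds serves as the common constant.\<close>
  show ?thesis
  proof (rule that[of "B + (1 + B) / 2 + A + Q"])
    show "0 \<le> B + (1 + B) / 2 + A + Q" using A B Q by simp
    show "measure (\<mu>k k) {b..c} \<le> B + (1 + B) / 2 + A + Q" for k using B(2)[of k] A Q b2 by linarith
    show "\<bar>uk k y - uk k x\<bar> \<le> sqrt \<bar>y - x\<bar> * (B + (1 + B) / 2 + A + Q)" if "x \<in> {b..c}" "y \<in> {b..c}" for k x y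
    proof -
      have "sqrt \<bar>y - x\<bar> * ((1 + B) / 2) \<le> sqrt \<bar>y - x\<bar> * (B + (1 + B) / 2 + A + Q)"
      proof (rule mult_left_mono)
        show "(1 + B) / 2 \<le> B + (1 + B) / 2 + A + Q" using A(1) B(1) Q by linarith
      qed simp
      then show ?thesis using H[OF that, of k] by linarith
    qed
    show "\<bar>uk k x\<bar> \<le> B + (1 + B) / 2 + A + Q" if x: "x \<in> {b..c}" for k x
    proof -
      have "b \<in> {b..c}" using x by simp
      then have "\<bar>uk k x - uk k b\<bar> \<le> sqrt \<bar>x - b\<bar> * ((1 + B) / 2)" using x by (rule H)
      also have "\<dots> \<le> Q" unfolding Q_def using x b2 by (intro mult_right_mono) auto
      finally show ?thesis using A(2)[of k] B b2 by linarith
    qed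
  qed
qed

text \<open>Pointwise convergence together with equicontinuity: the values at x j are compared with
  those at the limit point, and the Hoelder bound makes the difference vanish uniformly in the
  index.\<close>

lemma limitin_D_per_uniform:
  assumes l: "0 < l" and lim: "limitin (D_per_topology l) (\<lambda>k. (uk k, \<mu>k k)) (u, \<mu>) sequentially"
    and Dk: "\<And>k. (uk k, \<mu>k k) \<in> D_per l"
  shows "uniform_limit {b..c} uk u sequentially"
proof -
  obtain M where M: "0 \<le> M" "\<And>k x y. x \<in> {b..c} \<Longrightarrow> y \<in> {b..c} \<Longrightarrow> \<bar>uk k y - uk k x\<bar> \<le> sqrt \<bar>y - x\<bar> * M"
    by (rule limitin_D_per_bounds[OF l lim Dk, of b c]) blast
  have D: "(u, \<mu>) \<in> D_per l" using lim by (simp add: limitin_def topspace_D_per_topology)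
  have cu: "continuous_on UNIV u"
    by (rule D_per_string_data[OF D]) (rule string_data.u_cont)
  show ?thesis
  proof (rule uniform_limit_of_sequential)
    fix r :: "nat \<Rightarrow> nat" and x :: "nat \<Rightarrow> real" and x0 :: real
    assume r: "strict_mono r" and x: "\<And>j. x j \<in> {b..c}" "x0 \<in> {b..c}" "x \<longlonglongrightarrow> x0"
    have "(\<lambda>j. sqrt \<bar>x j - x0\<bar> * M) \<longlonglongrightarrow> sqrt \<bar>x0 - x0\<bar> * M" by (intro tendsto_intros x)
    then have lim0: "(\<lambda>j. sqrt \<bar>x j - x0\<bar> * M) \<longlonglongrightarrow> 0" by simp
    have "norm (uk (r j) (x j) - uk (r j) x0) \<le> sqrt \<bar>x j - x0\<bar> * M" for j
      using M(2)[OF x(2,1)] by simp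
    then have "(\<lambda>j. uk (r j) (x j) - uk (r j) x0) \<longlonglongrightarrow> 0" using lim0 by (rule LIMSEQ_null_norm_le)
    moreover have "(\<lambda>j. uk (r j) x0) \<longlonglongrightarrow> u x0"
      using LIMSEQ_subseq_LIMSEQ[OF limitin_D_per_pointwise[OF l lim Dk] r] by (simp add: o_def)
    ultimately have "(\<lambda>j. (uk (r j) (x j) - uk (r j) x0) + uk (r j) x0) \<longlonglongrightarrow> 0 + u x0" by (rule tendsto_add)
    then show "(\<lambda>j. uk (r j) (x j)) \<longlonglongrightarrow> u x0" by simp
  next
    fix x :: "nat \<Rightarrow> real" and x0 :: real assume "x \<longlonglongrightarrow> x0"
    then show "(\<lambda>j. u (x j)) \<longlonglongrightarrow> u x0" by (intro continuous_on_tendsto_compose[OF cu]) auto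
  qed simp
qed

text \<open>The sequential criterion needs only continuity of \<Phi> at limits of pairs, so no
  modulus of continuity on a compact set has to be produced.\<close>

lemma uniform_limit_joint:
  fixes \<Phi> :: "complex \<times> real \<Rightarrow> complex" and uk :: "nat \<Rightarrow> real \<Rightarrow> real" and b c :: real
  assumes \<Phi>: "continuous_on UNIV \<Phi>" and z: "zk \<longlonglongrightarrow> z"
    and u: "uniform_limit {b..c} uk u sequentially" and cu: "continuous_on UNIV u"
  shows "uniform_limit {b..c} (\<lambda>k t. \<Phi> (zk k, uk k t)) (\<lambda>t. \<Phi> (z, u t)) sequentially"
proof (rule uniform_limit_of_sequential[where F="\<lambda>k t. \<Phi> (zk k, uk k t)" and G="\<lambda>t. \<Phi> (z, u t)"])
  fix r :: "nat \<Rightarrow> nat" and x :: "nat \<Rightarrow> real" and x0 :: real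
  assume r: "strict_mono r" and x: "\<And>j. x j \<in> {b..c}" "x0 \<in> {b..c}" "x \<longlonglongrightarrow> x0"
  have "(\<lambda>j. uk (r j) (x j)) \<longlonglongrightarrow> u x0"
    by (rule uniform_limit_sequential[OF u continuous_on_subset[OF cu] r x]) simp
  moreover have "(\<lambda>j. zk (r j)) \<longlonglongrightarrow> z" using LIMSEQ_subseq_LIMSEQ[OF z r] by (simp add: o_def)
  ultimately have "(\<lambda>j. (zk (r j), uk (r j) (x j))) \<longlonglongrightarrow> (z, u x0)" by (intro tendsto_Pair)
  then show "(\<lambda>j. \<Phi> (zk (r j), uk (r j) (x j))) \<longlonglongrightarrow> \<Phi> (z, u x0)"
    by (intro continuous_on_tendsto_compose[OF \<Phi>]) auto
next
  fix x :: "nat \<Rightarrow> real" and x0 :: real assume "x \<longlonglongrightarrow> x0"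
  then have "(\<lambda>j. u (x j)) \<longlonglongrightarrow> u x0" by (intro continuous_on_tendsto_compose[OF cu]) auto
  then have "(\<lambda>j. (z, u (x j))) \<longlonglongrightarrow> (z, u x0)" by (intro tendsto_Pair tendsto_const)
  then show "(\<lambda>j. \<Phi> (z, u (x j))) \<longlonglongrightarrow> \<Phi> (z, u x0)"
    by (intro continuous_on_tendsto_compose[OF \<Phi>]) auto
qed simp

lemma joint_bounded:
  fixes \<Phi> :: "complex \<times> real \<Rightarrow> complex"
  assumes \<Phi>: "continuous_on UNIV \<Phi>"
  obtains C where "0 \<le> C" "\<And>w v. norm w \<le> B \<Longrightarrow> \<bar>v\<bar> \<le> B \<Longrightarrow> norm (\<Phi> (w, v)) \<le> C"
proof -
  have "compact (\<Phi> ` (cball 0 B \<times> {-B..B}))"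
    by (intro compact_continuous_image compact_Times continuous_on_subset[OF \<Phi>]) auto
  then obtain C where C: "C > 0" "\<And>y. y \<in> \<Phi> ` (cball 0 B \<times> {-B..B}) \<Longrightarrow> norm y \<le> C"
    using compact_imp_bounded bounded_pos by metis
  show ?thesis
  proof (rule that[of C])
    fix w :: complex and v :: real assume "norm w \<le> B" "\<bar>v\<bar> \<le> B"
    then have "(w, v) \<in> cball 0 B \<times> {-B..B}" by auto
    then show "norm (\<Phi> (w, v)) \<le> C" by (intro C imageI)
  qed (use C in simp)
qed

text \<open>Coefficients and measure vary together. Replacing the coefficients by their limits costs
  their uniform distance times the bounded masses; what remains has fixed continuous integrands and
  converges by \<open>oint_vague\<close>.\<close>

lemma mixed_oint_tendsto:
  assumes M: "Borel_measure \<mu>" and Mk: "\<And>k. Borel_measure (\<mu>k k)"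
    and vague: "\<And>g. g \<in> C_c \<Longrightarrow> (\<lambda>k. LINT x|\<mu>k k. g x) \<longlonglongrightarrow> (LINT x|\<mu>. g x)"
    and cont: "continuous_on UNIV r" "continuous_on UNIV m" "continuous_on UNIV \<phi>"
      "\<And>k. continuous_on UNIV (rk k)" "\<And>k. continuous_on UNIV (mk k)"
    and unif: "uniform_limit {b..c} rk r sequentially" "uniform_limit {b..c} mk m sequentially"
    and s: "s \<in> {b..c}" and atoms: "measure \<mu> {b} = 0" "measure \<mu> {s} = 0"
    and B: "\<And>k. measure (\<mu>k k) {b..c} \<le> B"
  shows "(\<lambda>k. mixed_oint (rk k) (mk k) (\<mu>k k) b s \<phi>) \<longlonglongrightarrow> mixed_oint r m \<mu> b s \<phi>"
proof -
  have B0: "0 \<le> B" using B[of 0] measure_nonneg[of "\<mu>k 0" "{b..c}"] by linarith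
  have l\<phi>: "locally_bounded_borel \<phi>" by (rule locally_bounded_borel_continuous[OF cont(3)])
  obtain C where C: "C > 0" "\<And>x. x \<in> {b..c} \<Longrightarrow> norm (\<phi> x) \<le> C" using continuous_bounded_Icc[OF cont(3)] by metis
  have b: "b \<in> {b..c}" using s by simp
  define K where "K = ((c - b) + B) * C"
  have K: "0 \<le> K" using s B0 C by (simp add: K_def)
  \<comment> \<open>The differences of the coefficients are read as coefficients of a system with p
    = 0, so that the norm estimate of the locale applies to them.\<close>
  have V: "volterra (\<lambda>_. 0) (\<lambda>t. rk k t - r t) (\<lambda>t. mk k t - m t) (\<mu>k k)" for k
    by unfold_locales (intro Mk continuous_intros cont)+
  let ?D = "\<lambda>k. mixed_oint (\<lambda>t. rk k t - r t) (\<lambda>t. mk k t - m t) (\<mu>k k) b s \<phi>"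
  have "?D \<longlonglongrightarrow> 0"
  proof (rule LIMSEQ_I)
    fix e :: real assume e: "0 < e"
    \<comment> \<open>The denominator K + 1 is positive even if K = 0, and d K < e.\<close>
    define d where "d = e / (K + 1)"
    have d: "0 < d" using e K by (simp add: d_def)
    have "\<forall>\<^sub>F k in sequentially. \<forall>t\<in>{b..c}. dist (rk k t) (r t) < d" "\<forall>\<^sub>F k in sequentially. \<forall>t\<in>{b..c}. dist (mk k t) (m t) < d"
      using unif d unfolding uniform_limit_iff by blast+
    then have "\<forall>\<^sub>F k in sequentially. norm (?D k) < e"
    proof eventually_elim
      case (elim k)
      have "norm (?D k) \<le> (d * (c - b) + d * measure (\<mu>k k) {b..c}) * C"
      proof (rule volterra.norm_mixed_oint_le[OF V l\<phi> b s])
        show "norm (rk k t - r t) \<le> d" "norm (mk k t - m t) \<le> d" if "t \<in> {b..c}" for t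
          using elim that unfolding dist_norm by (auto intro: less_imp_le)
        show "norm (\<phi> t) \<le> C" if "min b s \<le> t" "t \<le> max b s" for t
          using that s by (intro C) auto
      qed (use C in simp)
      also have "\<dots> \<le> (d * (c - b) + d * B) * C"
        using B[of k] d C by (intro mult_right_mono add_left_mono mult_left_mono) auto
      also have "\<dots> = d * K" by (simp add: K_def algebra_simps)
      also have "\<dots> < d * (K + 1)" using d by simp
      also have "\<dots> = e" using K by (simp add: d_def)
      finally show ?case .
    qed
    then show "\<exists>N. \<forall>k\<ge>N. norm (?D k - 0) < e" by (simp add: eventually_sequentially)
  qed
  moreover have "(\<lambda>k. oint (\<mu>k k) b s (\<lambda>t. m t * \<phi> t)) \<longlonglongrightarrow> oint \<mu> b s (\<lambda>t. m t * \<phi> t)"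
    using s by (intro oint_vague M Mk vague atoms continuous_intros cont) auto
  ultimately have "(\<lambda>k. ?D k + (oint lborel b s (\<lambda>t. r t * \<phi> t) + oint (\<mu>k k) b s (\<lambda>t. m t * \<phi> t))) \<longlonglongrightarrow>
      0 + (oint lborel b s (\<lambda>t. r t * \<phi> t) + oint \<mu> b s (\<lambda>t. m t * \<phi> t))"
    by (intro tendsto_add tendsto_const)
  moreover have "?D k + (oint lborel b s (\<lambda>t. r t * \<phi> t) + oint (\<mu>k k) b s (\<lambda>t. m t * \<phi> t)) =
      mixed_oint (rk k) (mk k) (\<mu>k k) b s \<phi>" for k
  proof -
    have l: "locally_bounded_borel (\<lambda>t. rk k t * \<phi> t)" "locally_bounded_borel (\<lambda>t. r t * \<phi> t)"
      "locally_bounded_borel (\<lambda>t. mk k t * \<phi> t)" "locally_bounded_borel (\<lambda>t. m t * \<phi> t)"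
      by (intro locally_bounded_borel_continuous continuous_intros cont)+
    show ?thesis
      unfolding mixed_oint_def left_diff_distrib
      by (simp add: oint_diff[OF Borel_measure_lborel l(1,2)] oint_diff[OF Mk l(3,4)])
  qed
  ultimately show ?thesis by (simp add: mixed_oint_def)
qed

text \<open>The spectral parameter enters the system only through the coefficients and can therefore
  vary with k on the same footing as u_k.\<close>

lemma floquet_discriminant_tendsto:
  assumes l: "0 < l" and D: "(u, \<mu>) \<in> D_per l" and Dk: "\<And>k. (uk k, \<mu>k k) \<in> D_per l"
    and lim: "limitin (D_per_topology l) (\<lambda>k. (uk k, \<mu>k k)) (u, \<mu>) sequentially"
    and z: "zk \<longlonglongrightarrow> z"
  shows "(\<lambda>k. floquet_discriminant l a (uk k) (\<mu>k k) (zk k)) \<longlonglongrightarrow> floquet_discriminant l a u \<mu> z"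
proof -
  obtain u' where S: "string_data u u' \<mu>" and per: "\<And>x. u (x + l) = u x"
    and inv: "\<And>B. B \<in> sets borel \<Longrightarrow> emeasure \<mu> ((\<lambda>x. x + l) ` B) = emeasure \<mu> B"
    using D_per_string_data[OF D] by metis
  have "\<exists>u'. string_data (uk k) u' (\<mu>k k)" for k using D_per_string_data[OF Dk[of k]] by metis
  then obtain uk' where Sk: "\<And>k. string_data (uk k) (uk' k) (\<mu>k k)" by metis
  have perk: "uk k (x + l) = uk k x" for k x using D_per_string_data[OF Dk[of k]] by metis
  have invk: "emeasure (\<mu>k k) ((\<lambda>x. x + l) ` B) = emeasure (\<mu>k k) B" if "B \<in> sets borel" for k B
    using D_per_string_data[OF Dk[of k]] that by metis
  note M = string_data.Borel_\<mu>[OF S] and Mk = string_data.Borel_\<mu>[OF Sk]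
  have cu: "continuous_on UNIV u" by (rule string_data.u_cont[OF S])
  have vague: "(\<lambda>k. LINT x|\<mu>k k. g x) \<longlonglongrightarrow> (LINT x|\<mu>. g x)" if "g \<in> C_c" for g
    by (rule limitin_D_per_vague[OF lim that])
  \<comment> \<open>Only countably many points are atoms of \<mu>, so a base point without mass
    exists.\<close>
  obtain b where b: "measure \<mu> {b} = 0" using AE_lborel_ex[OF AE_non_atom[OF M]] by blast
  define c where "c = b + l"
  have bc: "b \<le> c" using l by (simp add: c_def)
  \<comment> \<open>Invariance of \<mu> under the shift carries the absence of an atom to the other
    end of the period.\<close>
  have "(\<lambda>x. x + l) ` {b} = {c}" by (simp add: c_def)
  then have atom_c: "measure \<mu> {c} = 0" using inv[of "{b}"] b by (simp add: measure_def)
  obtain M0 where M0: "0 \<le> M0" "\<And>k. measure (\<mu>k k) {b..c} \<le> M0" "\<And>k x. x \<in> {b..c} \<Longrightarrow> \<bar>uk k x\<bar> \<le> M0"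
    by (rule limitin_D_per_bounds[OF l lim Dk, of b c]) blast
  obtain Z where Z: "Z > 0" "\<And>k. norm (zk k) \<le> Z"
    using convergent_imp_Bseq[OF convergentI[OF z]] unfolding Bseq_def by auto
  note unif = limitin_D_per_uniform[OF l lim Dk, of b c]
  define Pf where "Pf = (\<lambda>(w, v). exp (- 2 * w * complex_of_real v))"
  define Rf where "Rf = (\<lambda>(w, v). (1/4 - w * complex_of_real v + w\<^sup>2 * (complex_of_real v)\<^sup>2) * exp (2 * w * complex_of_real v))"
  define Mf where "Mf = (\<lambda>(w, v). - w\<^sup>2 * exp (2 * w * complex_of_real v))"
  have cf: "continuous_on UNIV Pf" "continuous_on UNIV Rf" "continuous_on UNIV Mf"
    unfolding Pf_def Rf_def Mf_def case_prod_unfold by (intro continuous_intros)+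
  have coef: "pcoef v w = (\<lambda>t. Pf (w, v t))" "rcoef v w = (\<lambda>t. Rf (w, v t))" "mcoef v w = (\<lambda>t. Mf (w, v t))" for v w
    by (auto simp: pcoef_def rcoef_def mcoef_def Pf_def Rf_def Mf_def)
  note V = string_data.volterra[OF S, of z] and Vk = string_data.volterra[OF Sk]
  have up: "uniform_limit {b..c} (\<lambda>k. pcoef (uk k) (zk k)) (pcoef u z) sequentially"
    and ur: "uniform_limit {b..c} (\<lambda>k. rcoef (uk k) (zk k)) (rcoef u z) sequentially"
    and um: "uniform_limit {b..c} (\<lambda>k. mcoef (uk k) (zk k)) (mcoef u z) sequentially"
    unfolding coef by (intro uniform_limit_joint cf z unif cu)+
  \<comment> \<open>A common bound for the parameters z_k and the values of u_k confines all pairs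
    to one compact set, which bounds the coefficients uniformly in k.\<close>
  define Q where "Q = max Z M0"
  obtain Cp where Cp: "0 \<le> Cp" "\<And>w v. norm w \<le> Q \<Longrightarrow> \<bar>v\<bar> \<le> Q \<Longrightarrow> norm (Pf (w, v)) \<le> Cp" using joint_bounded[OF cf(1)] by metis
  obtain Cr where Cr: "0 \<le> Cr" "\<And>w v. norm w \<le> Q \<Longrightarrow> \<bar>v\<bar> \<le> Q \<Longrightarrow> norm (Rf (w, v)) \<le> Cr" using joint_bounded[OF cf(2)] by metis
  obtain Cm where Cm: "0 \<le> Cm" "\<And>w v. norm w \<le> Q \<Longrightarrow> \<bar>v\<bar> \<le> Q \<Longrightarrow> norm (Mf (w, v)) \<le> Cm" using joint_bounded[OF cf(3)] by metis
  have zQ: "norm (zk k) \<le> Q" for k using Z(2)[of k] by (simp add: Q_def le_max_iff_disj)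
  have uQ: "\<bar>uk k t\<bar> \<le> Q" if "t \<in> {b..c}" for k t using M0(3)[OF that, of k] by (simp add: Q_def le_max_iff_disj)
  have pb: "norm (pcoef (uk k) (zk k) t) \<le> Cp" and rb: "norm (rcoef (uk k) (zk k) t) \<le> Cr" and mb: "norm (mcoef (uk k) (zk k) t) \<le> Cm"
    if "t \<in> {b..c}" for k t
    unfolding coef using Cp(2) Cr(2) Cm(2) zQ uQ[OF that] by auto
  have conv: "(\<lambda>k. \<phi>k k c) \<longlonglongrightarrow> \<phi> c \<and> (\<lambda>k. \<psi>k k c) \<longlonglongrightarrow> \<psi> c"
    if sol: "vsol (pcoef u z) (rcoef u z) (mcoef u z) \<mu> \<phi> \<psi>"
      and solk: "\<And>k. vsol (pcoef (uk k) (zk k)) (rcoef (uk k) (zk k)) (mcoef (uk k) (zk k)) (\<mu>k k) (\<phi>k k) (\<psi>k k)"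
      and init: "\<And>k. \<phi>k k b = \<phi> b" "\<And>k. \<psi>k k b = \<psi> b" for \<phi> \<psi> \<phi>k \<psi>k
  proof -
    have mixed: "(\<lambda>k. mixed_oint (rcoef (uk k) (zk k)) (mcoef (uk k) (zk k)) (\<mu>k k) b s \<phi>) \<longlonglongrightarrow>
        mixed_oint (rcoef u z) (mcoef u z) \<mu> b s \<phi>" if "s \<in> {b..c}" "measure \<mu> {s} = 0" for s
      by (rule mixed_oint_tendsto[where c=c and B=M0])
        (use M Mk vague volterra.r_cont[OF V] volterra.m_cont[OF V] volterra.vsol_continuous(1)[OF V sol]
           volterra.r_cont[OF Vk] volterra.m_cont[OF Vk] ur um that b M0(2) in \<open>simp_all\<close>)
    have Nb: "norm (mixed_oint (rcoef (uk k) (zk k)) (mcoef (uk k) (zk k)) (\<mu>k k) b s D) \<le> (Cr * (c - b) + Cm * M0) * C"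
      if "s \<in> {b..c}" "locally_bounded_borel D" "0 \<le> C" "\<And>t. b \<le> t \<Longrightarrow> t \<le> s \<Longrightarrow> norm (D t) \<le> C" for k s D C
    proof -
      have "norm (mixed_oint (rcoef (uk k) (zk k)) (mcoef (uk k) (zk k)) (\<mu>k k) b s D) \<le>
          (Cr * (c - b) + Cm * measure (\<mu>k k) {b..c}) * C"
        by (rule volterra.norm_mixed_oint_le[OF Vk that(2) _ that(1,3)]) (use that bc rb mb in \<open>simp_all\<close>)
      also have "\<dots> \<le> (Cr * (c - b) + Cm * M0) * C"
        using M0(2)[of k] Cm(1) that(3) by (intro mult_right_mono add_left_mono mult_left_mono) auto
      finally show ?thesis .
    qed
    have N0: "0 \<le> Cr * (c - b) + Cm * M0" using Cr Cm M0 bc by simp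
    have pc: "(\<lambda>k. pcoef (uk k) (zk k) t) \<longlonglongrightarrow> pcoef u z t" if "t \<in> {b..c}" for t
      by (rule tendsto_uniform_limitI[OF up that])
    \<comment> \<open>The exceptional set consists of the atoms of \<mu>.\<close>
    have ae: "AE s in lborel. s \<in> {b..c} \<longrightarrow> (\<lambda>k. mixed_oint (rcoef (uk k) (zk k)) (mcoef (uk k) (zk k)) (\<mu>k k) b s \<phi>) \<longlonglongrightarrow>
        mixed_oint (rcoef u z) (mcoef u z) \<mu> b s \<phi>"
      using AE_non_atom[OF M] by eventually_elim (use mixed in blast)
    have mc: "(\<lambda>k. mixed_oint (rcoef (uk k) (zk k)) (mcoef (uk k) (zk k)) (\<mu>k k) b c \<phi>) \<longlonglongrightarrow>
        mixed_oint (rcoef u z) (mcoef u z) \<mu> b c \<phi>" using bc by (intro mixed atom_c) auto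
    show ?thesis
      by (intro conjI; rule volterra_convergence[OF V Vk sol solk init bc Cp(1) _ _ N0 _ ae mc])
         (use pb pc Nb in blast)+
  qed
  obtain \<phi>1 \<psi>1 where 1: "vsol (pcoef u z) (rcoef u z) (mcoef u z) \<mu> \<phi>1 \<psi>1" "\<phi>1 b = 1" "\<psi>1 b = 0"
    using volterra.vsol_exists[OF V] by blast
  obtain \<phi>2 \<psi>2 where 2: "vsol (pcoef u z) (rcoef u z) (mcoef u z) \<mu> \<phi>2 \<psi>2" "\<phi>2 b = 0" "\<psi>2 b = 1"
    using volterra.vsol_exists[OF V] by blast
  have "\<exists>\<phi> \<psi>. vsol (pcoef (uk k) (zk k)) (rcoef (uk k) (zk k)) (mcoef (uk k) (zk k)) (\<mu>k k) \<phi> \<psi> \<and> \<phi> b = d1 \<and> \<psi> b = d2" for k d1 d2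
    by (rule volterra.vsol_exists[OF Vk])
  then obtain \<phi>k \<psi>k where k: "\<And>k d1 d2. vsol (pcoef (uk k) (zk k)) (rcoef (uk k) (zk k)) (mcoef (uk k) (zk k)) (\<mu>k k) (\<phi>k k d1 d2) (\<psi>k k d1 d2)"
    "\<And>k d1 d2. \<phi>k k d1 d2 b = d1" "\<And>k d1 d2. \<psi>k k d1 d2 b = d2"
    by metis
  have "(\<lambda>k. \<phi>k k 1 0 c) \<longlonglongrightarrow> \<phi>1 c" "(\<lambda>k. \<psi>k k 0 1 c) \<longlonglongrightarrow> \<psi>2 c"
    using conv[OF 1(1) k(1)[of _ 1 0]] conv[OF 2(1) k(1)[of _ 0 1]] k(2,3) 1 2 by auto
  then have "(\<lambda>k. 1/2 * (\<phi>k k 1 0 c + \<psi>k k 0 1 c)) \<longlonglongrightarrow> 1/2 * (\<phi>1 c + \<psi>2 c)"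
    by (intro tendsto_intros)
  moreover have "floquet_discriminant l a u \<mu> z = 1/2 * (\<phi>1 c + \<psi>2 c)"
    unfolding c_def by (rule string_data.floquet_discriminant_base_point[OF S per inv 1 2])
  moreover have "floquet_discriminant l a (uk k) (\<mu>k k) (zk k) = 1/2 * (\<phi>k k 1 0 c + \<psi>k k 0 1 c)" for k
    unfolding c_def
    by (rule string_data.floquet_discriminant_base_point[OF Sk perk invk k(1)[of k 1 0] k(2,3) k(1)[of k 0 1] k(2,3)])
  ultimately show ?thesis by (simp only:)
qed

theorem theorem5p1:
  fixes l a :: real
    and u :: "real \<Rightarrow> real" and \<mu> :: "real measure"
    and uk :: "nat \<Rightarrow> real \<Rightarrow> real" and \<mu>k :: "nat \<Rightarrow> real measure"
  assumes "l > 0"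
    and "(u, \<mu>) \<in> D_per l"
    and "\<And>k. (uk k, \<mu>k k) \<in> D_per l"
    and "limitin (D_per_topology l) (\<lambda>k. (uk k, \<mu>k k)) (u, \<mu>) sequentially"
  shows "\<forall>w. \<exists>r>0. uniform_limit (cball w r)
           (\<lambda>k z. floquet_discriminant l a (uk k) (\<mu>k k) z)
           (\<lambda>z. floquet_discriminant l a u \<mu> z) sequentially"
proof (intro allI exI[of _ 1] conjI)
  fix w :: complex
  show "uniform_limit (cball w 1) (\<lambda>k z. floquet_discriminant l a (uk k) (\<mu>k k) z)
      (\<lambda>z. floquet_discriminant l a u \<mu> z) sequentially"
  proof (rule uniform_limit_of_sequential[where F="\<lambda>k. floquet_discriminant l a (uk k) (\<mu>k k)" and G="floquet_discriminant l a u \<mu>"])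
    fix r :: "nat \<Rightarrow> nat" and x :: "nat \<Rightarrow> complex" and x0 :: complex assume "strict_mono r" "x \<longlonglongrightarrow> x0"
    then show "(\<lambda>j. floquet_discriminant l a (uk (r j)) (\<mu>k (r j)) (x j)) \<longlonglongrightarrow> floquet_discriminant l a u \<mu> x0"
      using limitin_subsequence[OF _ assms(4), of r] assms(1-3)
      by (intro floquet_discriminant_tendsto) (auto simp: o_def)
  next
    \<comment> \<open>Continuity of the limit discriminant is the same convergence result for the
      constant sequence of pairs.\<close>
    fix x :: "nat \<Rightarrow> complex" and x0 :: complex assume "x \<longlonglongrightarrow> x0"
    then show "(\<lambda>j. floquet_discriminant l a u \<mu> (x j)) \<longlonglongrightarrow> floquet_discriminant l a u \<mu> x0"
      using assms(1,2) by (intro floquet_discriminant_tendsto) (auto simp: topspace_D_per_topology)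
  qed simp
qed simp

end
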